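(* Let $f_1$ and $f_2$ be completely multiplicative functions with $|f_1(n)|\le 1$ and $|f_2(n)|\le1$ for all $n$. Suppose that $\eta>0$ and $x_1$, $x_2$ are real numbers such that, for $j=1,2$, $$ \Big| \sum_{n\leq x_j} f_j(n)\Big| \geq \eta x_j . $$ Then, with $\xi = c \eta^6$ for a suitable absolute constant $c>0$, there exists $x\geq (\min (x_1,x_2) )^{\xi}$ such that $$ \Big| \sum_{n\leq x} f_1(n) f_2(n) \Big| \geq \xi x. $$ *)

theory Defs
  imports Complex_Main
begin

text \<open>Completely multiplicative arithmetic function (values at n = 0 are irrelevant).\<close>
definition completely_multiplicative :: "(nat \<Rightarrow> complex) \<Rightarrow> bool" where
  "completely_multiplicative f \<longleftrightarrow>
     f 1 = 1 \<and> (\<forall>m n. m > 0 \<longrightarrow> n > 0 \<longrightarrow> f (m * n) = f m * f n)"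

definition psum :: "(nat \<Rightarrow> complex) \<Rightarrow> real \<Rightarrow> complex" where
  "psum f x = (\<Sum>n\<in>{1..nat \<lfloor>x\<rfloor>}. f n)"

end

theory Submission
  imports Defs "HOL-Analysis.Analysis" "HOL-Number_Theory.Number_Theory"
    "HOL-Computational_Algebra.Squarefree" "HOL-Probability.Sinc_Integral"
begin

text \<open>
  Write \<open>S\<close> for the partial sums of \<open>f\<close>, \<open>F\<close> for its Dirichlet series and \<open>L = ln x\<close>. As
  \<open>f ln\<^sup>2 = f * (f \<Lambda>\<^sub>2)\<close> with \<open>\<Lambda>\<^sub>2 = \<Lambda> ln + \<Lambda> * \<Lambda>\<close>, Selberg's asymptotic formula for the summatory
  function of \<open>\<Lambda>\<^sub>2\<close> bounds \<open>|S x| / x\<close> by the mean of \<open>|S (exp v)| exp (-v)\<close> over \<open>0 \<le> v \<le> L\<close>.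

  Suppose \<open>|F s| \<le> \<lambda> |s| L\<close> on the line \<open>Re s = 1 + 1 / L\<close>. The Fourier transform of
  \<open>v \<mapsto> exp (-v (1 + 1 / L)) (\<Sum>n \<le> exp v. f n ln n)\<close> is, up to sign, \<open>F' / s = (F / s) (F' / F)\<close>. Weighting with
  the Fejer kernel of width \<open>a\<close> makes the mean square of \<open>F' / F\<close> as small as the density of the primes
  in the intervals \<open>[m, m exp a]\<close> suggests, and this density is again controlled by Selberg's formula.
  Hence \<open>v |S (exp v)| exp (-v)\<close> has mean square at most of order \<open>(\<lambda>\<^sup>2 + a\<^sup>2) L\<^sup>2\<close> over \<open>[0, L]\<close>. Splitting
  the mean of \<open>|S (exp v)| exp (-v)\<close> at \<open>v = \<eta> L / 10\<close> and taking \<open>a\<close> of order \<open>\<eta>\<^bsup>3/2\<^esup>\<close> shows that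
  \<open>|S x| \<ge> \<eta> x\<close> forces \<open>|F s| \<ge> c \<eta>\<^bsup>3/2\<^esup> |s| L\<close> for some \<open>s\<close> on the line.

  Apply this to both functions. For \<open>|z|, |w| \<le> 1\<close> one has \<open>2 Re z + 2 Re w \<le> 3 + Re (z w)\<close>, so the Euler
  products satisfy \<open>|F1|\<^sup>2 |F2|\<^sup>2 \<le> \<zeta>\<^sup>3 |G|\<close>, where \<open>G\<close> is the series of \<open>f1 f2\<close> at the sum of the
  two ordinates. Thus \<open>|G s|\<close> is at least of order \<open>\<eta>\<^sup>6 |s| L\<close>, while it would be at most \<open>2 \<xi> |s| L\<close> if the
  partial sums of \<open>f1 f2\<close> were smaller than \<open>\<xi> x\<close> for all \<open>x \<ge> exp (\<xi> L)\<close>.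
\<close>

section \<open>Divisor sums and prime sums\<close>

text \<open>The exponent 3/2 comes from a balance. With the cut at v = \<theta> L, \<theta> of order
  \<eta>, the mean is at most of order \<theta> + (\<lambda>^2 + a^2) / \<theta>^2, so \<lambda>^2
  and a^2 have to be small multiples of \<eta>^3. Four factors \<eta>^(3/2) in the Euler product
  inequality give \<eta>^6, and \<zeta>^3 uses up three of the four factors L. Three obstacles shape
  the rest. The ordinates are not bounded, so the upper bound for G loses |s|; the lower bounds keep
  |s1| and |s2|, whose squares pay for this. The two functions are large at different points x1 and
  x2, while the Euler products must be compared on one line; since |F / \<zeta>| does not decrease
  to the right, both lower bounds move to the line of the smaller point at the cost of a factor 2.
  Finally, the small primes require a^2 L \<ge> 1, that is L of order \<eta>^(-3) at least; for
  smaller L the conclusion holds because the partial sums on [1, 2) equal 1.\<close>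

definition nats_le :: "real \<Rightarrow> nat set" where
  "nats_le x = {1..nat \<lfloor>x\<rfloor>}"

lemma in_nats_le: "n \<in> nats_le x \<longleftrightarrow> 1 \<le> n \<and> real n \<le> x"
  unfolding nats_le_def by (cases "x \<ge> 0") (auto simp: le_nat_iff le_floor_iff)

lemma finite_nats_le [simp, intro]: "finite (nats_le x)"
  by (simp add: nats_le_def)

lemma nats_le_empty: "x < 1 \<Longrightarrow> nats_le x = {}"
  by (auto simp: in_nats_le)

lemma nats_le_mono: "x \<le> y \<Longrightarrow> nats_le x \<subseteq> nats_le y"
  by (auto simp: in_nats_le)

lemma psum_altdef: "psum f x = (\<Sum>n\<in>nats_le x. f n)"
  by (simp add: psum_def nats_le_def)

lemma card_nats_le_bounds:
  assumes "x \<ge> 0"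
  shows "real (card (nats_le x)) \<le> x" "real (card (nats_le x)) > x - 1"
  using assms unfolding nats_le_def by (auto; linarith)+

lemma sum_nats_le_hyperbola:
  fixes h :: "nat \<Rightarrow> nat \<Rightarrow> 'a::comm_monoid_add"
  shows "(\<Sum>n\<in>nats_le x. \<Sum>d | d dvd n. h d (n div d)) = (\<Sum>d\<in>nats_le x. \<Sum>m\<in>nats_le (x / d). h d m)"
proof -
  have "(\<Sum>n\<in>nats_le x. \<Sum>d | d dvd n. h d (n div d)) =
        (\<Sum>(n,d)\<in>(SIGMA n:nats_le x. {d. d dvd n}). h d (n div d))"
    by (intro sum.Sigma) (auto simp: in_nats_le)
  also have "\<dots> = (\<Sum>(d,m)\<in>(SIGMA d:nats_le x. nats_le (x / d)). h d m)"
  proof (rule sum.reindex_bij_witness[of _ "\<lambda>(d,m). (d*m, d)" "\<lambda>(n,d). (d, n div d)"])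
    fix a assume "a \<in> (SIGMA n:nats_le x. {d. d dvd n})"
    then obtain d m where a: "a = (d*m, d)" "d*m \<in> nats_le x" by (auto elim!: dvdE)
    hence d: "d > 0" "m > 0" "real d * real m \<le> x" by (auto simp: in_nats_le intro: Nat.gr0I)
    have "real d * 1 \<le> real d * real m" using d by (intro mult_left_mono) auto
    hence "real d \<le> x" using d by linarith
    with a d show "(case a of (n, d) \<Rightarrow> (d, n div d)) \<in> (SIGMA d:nats_le x. nats_le (x / d))"
      by (auto simp: in_nats_le field_simps)
  next
    fix b assume "b \<in> (SIGMA d:nats_le x. nats_le (x / d))"
    thus "(case b of (d, m) \<Rightarrow> (d * m, d)) \<in> (SIGMA n:nats_le x. {d. d dvd n})"
      by (auto simp: in_nats_le field_simps)
  qed (auto simp: in_nats_le)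
  also have "\<dots> = (\<Sum>d\<in>nats_le x. \<Sum>m\<in>nats_le (x / d). h d m)"
    by (intro sum.Sigma [symmetric]) auto
  finally show ?thesis .
qed

text \<open>Associativity of Dirichlet convolution: both sides run over the factorisations n = e d
  k.\<close>

lemma sum_divisors_assoc:
  fixes h :: "nat \<Rightarrow> nat \<Rightarrow> nat \<Rightarrow> 'a::comm_monoid_add"
  assumes "n > 0"
  shows "(\<Sum>d | d dvd n. \<Sum>e | e dvd d. h e (d div e) (n div d)) =
         (\<Sum>e | e dvd n. \<Sum>d | d dvd n div e. h e d (n div e div d))"
proof -
  have "(\<Sum>d | d dvd n. \<Sum>e | e dvd d. h e (d div e) (n div d)) =
        (\<Sum>(d,e)\<in>(SIGMA d:{d. d dvd n}. {e. e dvd d}). h e (d div e) (n div d))"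
    using assms by (intro sum.Sigma) (auto dest: dvd_pos_nat)
  also have "\<dots> = (\<Sum>(e,d)\<in>(SIGMA e:{e. e dvd n}. {d. d dvd n div e}). h e d (n div e div d))"
    using assms
    by (intro sum.reindex_bij_witness[of _ "\<lambda>(e,d). (e*d, e)" "\<lambda>(d,e). (e, d div e)"])
       (auto elim!: dvdE simp: dvd_div_iff_mult mult_ac div_mult2_eq intro: dvd_trans)
  also have "\<dots> = (\<Sum>e | e dvd n. \<Sum>d | d dvd n div e. h e d (n div e div d))"
    using assms by (intro sum.Sigma [symmetric]) (auto elim!: dvdE)
  finally show ?thesis .
qed

lemma sum_divisors_flip:
  fixes h :: "nat \<Rightarrow> nat \<Rightarrow> 'a::comm_monoid_add"
  assumes "n > 0"
  shows "(\<Sum>d | d dvd n. h d (n div d)) = (\<Sum>d | d dvd n. h (n div d) d)"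
  using assms
  by (intro sum.reindex_bij_witness[of _ "\<lambda>d. n div d" "\<lambda>d. n div d"]) (auto elim!: dvdE)

section \<open>The Moebius function\<close>

definition moebius_mu :: "nat \<Rightarrow> real" where
  "moebius_mu n = (if squarefree n then (-1) ^ card (prime_factors n) else 0)"

lemma abs_moebius_mu_le_1: "\<bar>moebius_mu n\<bar> \<le> 1"
  by (simp add: moebius_mu_def)

lemma moebius_mult_prime:
  assumes "prime p" "n > 0" "\<not> p dvd n"
  shows "moebius_mu (p * n) = - moebius_mu n"
proof -
  have "coprime p n" using assms by (simp add: prime_imp_coprime)
  hence "squarefree (p * n) \<longleftrightarrow> squarefree n"
    using squarefree_mult_coprime[of p n] squarefree_multD(2)[of p n] squarefree_prime[of p] assms(1)
    by blast
  moreover have "prime_factors (p * n) = insert p (prime_factors n)"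
    using assms prime_factors_product[of p n] prime_prime_factors[of p] by (auto simp: prime_gt_0_nat)
  moreover have "p \<notin> prime_factors n" using assms(3) by (simp add: in_prime_factors_iff)
  ultimately show ?thesis by (simp add: moebius_mu_def)
qed

text \<open>Fix a prime p dividing n. Each divisor not divisible by p cancels against p times itself
  by \<open>moebius_mult_prime\<close>; every other divisor is a multiple of p^2, where
  \<open>moebius_mu\<close> vanishes.\<close>

lemma sum_moebius_divisors:
  assumes "n > 0"
  shows "(\<Sum>d | d dvd n. moebius_mu d) = (if n = 1 then 1 else 0)"
proof (cases "n = 1")
  case False
  then obtain p where p: "prime p" "p dvd n" using prime_factor_nat by blast
  define A where "A = {d. d dvd n \<and> \<not> p dvd d \<and> p * d dvd n}"
  have fin: "finite {d. d dvd n}" using assms by simp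
  have "(\<Sum>d | d dvd n. moebius_mu d) = (\<Sum>d\<in>A \<union> (\<lambda>d. p * d) ` A. moebius_mu d)"
  proof (rule sum.mono_neutral_right)
    show "A \<union> (*) p ` A \<subseteq> {d. d dvd n}" by (auto simp: A_def)
    show "\<forall>i\<in>{d. d dvd n} - (A \<union> (*) p ` A). moebius_mu i = 0"
    proof
      fix i assume i: "i \<in> {d. d dvd n} - (A \<union> (*) p ` A)"
      hence "i dvd n" by auto
      have "p dvd i"
      proof (rule ccontr)
        assume "\<not> p dvd i"
        hence "coprime p i" using p by (simp add: prime_imp_coprime)
        hence "p * i dvd n" using p \<open>i dvd n\<close> by (simp add: divides_mult)
        thus False using i \<open>\<not> p dvd i\<close> \<open>i dvd n\<close> by (simp add: A_def)
      qed
      then obtain j where j: "i = p * j" by (auto elim: dvdE)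
      have "j \<notin> A" using i j by blast
      moreover have "j dvd n" using \<open>i dvd n\<close> j dvd_mult_right by blast
      ultimately have "p dvd j" using \<open>i dvd n\<close> j by (simp add: A_def)
      hence "p ^ 2 dvd i" using j by (auto simp: power2_eq_square)
      hence "\<not> squarefree i" by (rule not_squarefreeI) (use p(1) in auto)
      thus "moebius_mu i = 0" by (simp add: moebius_mu_def)
    qed
  qed (use fin in auto)
  also have "\<dots> = (\<Sum>d\<in>A. moebius_mu d) + (\<Sum>d\<in>(\<lambda>d. p * d) ` A. moebius_mu d)"
    using p fin by (intro sum.union_disjoint) (auto simp: A_def)
  also have "(\<Sum>d\<in>(\<lambda>d. p * d) ` A. moebius_mu d) = (\<Sum>d\<in>A. moebius_mu (p * d))"
    using p by (subst sum.reindex) (auto simp: inj_on_def)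
  also have "\<dots> = (\<Sum>d\<in>A. - moebius_mu d)"
    using assms p by (intro sum.cong refl moebius_mult_prime) (auto simp: A_def dest: dvd_pos_nat)
  finally show ?thesis using False by (simp add: sum_negf)
qed (simp add: moebius_mu_def)

text \<open>Moebius inversion of \<open>mangoldt_sum\<close>: as convolutions, mu * (1 * Lambda) =
  (mu * 1) * Lambda. Between the two uses of associativity the factors are exchanged, so that the
  last inner sum is the one of \<open>moebius_mu\<close>, which leaves only e = n.\<close>

lemma sum_moebius_ln:
  assumes "n > 0"
  shows "(\<Sum>d | d dvd n. moebius_mu d * ln (real (n div d))) = mangoldt n"
proof -
  have "(\<Sum>d | d dvd n. moebius_mu d * ln (real (n div d))) =
        (\<Sum>d | d dvd n. \<Sum>e | e dvd n div d. moebius_mu d * mangoldt e)"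
  proof (intro sum.cong refl)
    fix d assume "d \<in> {d. d dvd n}"
    hence "n div d \<noteq> 0" using assms by (auto elim!: dvdE)
    thus "moebius_mu d * ln (real (n div d)) = (\<Sum>e | e dvd n div d. moebius_mu d * mangoldt e)"
      using mangoldt_sum[of "n div d", where ?'a = real] by (simp add: sum_distrib_left [symmetric])
  qed
  also have "\<dots> = (\<Sum>d | d dvd n. \<Sum>e | e dvd d. moebius_mu e * mangoldt (d div e))"
    using sum_divisors_assoc[OF assms, of "\<lambda>e d k. moebius_mu e * mangoldt d"] by simp
  also have "\<dots> = (\<Sum>d | d dvd n. \<Sum>e | e dvd d. moebius_mu (d div e) * mangoldt e)"
  proof (rule sum.cong [OF refl])
    fix d assume "d \<in> {d. d dvd n}"
    hence "d > 0" using assms by (auto dest: dvd_pos_nat)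
    from sum_divisors_flip[OF this, of "\<lambda>e d. moebius_mu e * mangoldt d"]
    show "(\<Sum>e | e dvd d. moebius_mu e * mangoldt (d div e)) =
          (\<Sum>e | e dvd d. moebius_mu (d div e) * mangoldt e :: real)" .
  qed
  also have "\<dots> = (\<Sum>e | e dvd n. \<Sum>d | d dvd n div e. moebius_mu d * mangoldt e)"
    using sum_divisors_assoc[OF assms, of "\<lambda>e d k. moebius_mu d * mangoldt e"] by simp
  also have "\<dots> = (\<Sum>e | e dvd n. if e = n then mangoldt n else 0)"
  proof (intro sum.cong refl)
    fix e assume "e \<in> {e. e dvd n}"
    then obtain k where k: "n = e * k" by (auto elim: dvdE)
    with assms have "e > 0" "k > 0" by auto
    thus "(\<Sum>d | d dvd n div e. moebius_mu d * mangoldt e) = (if e = n then mangoldt n else 0)"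
      using k sum_moebius_divisors[of k] by (auto simp: sum_distrib_right [symmetric])
  qed
  finally show ?thesis using assms by (simp add: sum.delta')
qed

section \<open>Sums of logarithms, reciprocals and square roots\<close>

lemma ln_add1_diff_bounds:
  assumes "x > (0::real)"
  shows "ln (x + 1) - ln x \<le> 1 / x" "ln (x + 1) - ln x \<ge> 1 / (x + 1)"
proof -
  have "ln ((x + 1) / x) \<le> (x + 1) / x - 1" using assms by (intro ln_le_minus_one) auto
  thus "ln (x + 1) - ln x \<le> 1 / x" using assms by (simp add: ln_div field_simps)
  have "ln (x / (x + 1)) \<le> x / (x + 1) - 1" using assms by (intro ln_le_minus_one) auto
  thus "ln (x + 1) - ln x \<ge> 1 / (x + 1)" using assms by (simp add: ln_div field_simps)
qed

lemma sum_ln_nat_bounds: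
  assumes "N \<ge> 1"
  shows "(\<Sum>n=1..N. ln (real n)) \<in> {N * ln N - N + 1 .. N * ln N - N + 1 + ln N}"
  using assms
proof (induction N rule: dec_induct)
  case (step N)
  have N: "real N > 0" using step by simp
  have "real N * (ln (real N + 1) - ln (real N)) \<le> real N * (1 / real N)"
    using ln_add1_diff_bounds[OF N] by (intro mult_left_mono) auto
  moreover have "(real N + 1) * (ln (real N + 1) - ln (real N)) \<ge> (real N + 1) * (1 / (real N + 1))"
    using ln_add1_diff_bounds[OF N] by (intro mult_left_mono) auto
  ultimately show ?case using step N by (simp add: algebra_simps)
qed auto

definition ln_sum :: "real \<Rightarrow> real" where
  "ln_sum x = (\<Sum>n\<in>nats_le x. ln (real n))"

text \<open>Stirling's formula for real x: the bound ln u \<le> u - 1, taken at x / N and at N / x,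
  compares N ln N - N with x ln x - x.\<close>

lemma ln_sum_approx:
  assumes "x \<ge> 1"
  shows "\<bar>ln_sum x - (x * ln x - x)\<bar> \<le> 1 + ln x"
proof -
  define N where "N = nat \<lfloor>x\<rfloor>"
  have N: "N \<ge> 1" "real N \<le> x" using assms by (auto simp: N_def le_nat_iff)
  have S: "ln_sum x \<in> {N * ln N - N + 1 .. N * ln N - N + 1 + ln N}"
    using sum_ln_nat_bounds[OF N(1)] by (simp add: ln_sum_def nats_le_def N_def)
  have "ln (x / N) \<le> x / N - 1" using N by (intro ln_le_minus_one) auto
  hence "real N * (ln x - ln N) \<le> x - N" using N assms by (simp add: ln_div field_simps)
  moreover have "ln (N / x) \<le> N / x - 1" using N assms by (intro ln_le_minus_one) auto
  hence "x * (ln x - ln N) \<ge> x - N" using N assms by (simp add: ln_div field_simps)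
  moreover have "ln N \<le> ln x" "0 \<le> ln N" using N by auto
  moreover have "real N * ln N \<le> x * ln N" using N by (intro mult_right_mono) auto
  moreover have "(x - N) * ln x \<le> 1 * ln x" using assms N unfolding N_def
    by (intro mult_right_mono) (auto, linarith)
  ultimately show ?thesis using S by (auto simp: algebra_simps abs_le_iff)
qed

lemma inverse_sum_approx:
  assumes "x \<ge> 1"
  shows "\<bar>(\<Sum>n\<in>nats_le x. 1 / real n) - ln x - euler_mascheroni\<bar> \<le> 3 / x"
proof -
  define N where "N = nat \<lfloor>x\<rfloor>"
  have N: "N \<ge> 1" "real N \<le> x" "x < N + 1" using assms by (auto simp: N_def le_nat_iff; linarith)+
  have "(\<Sum>n\<in>nats_le x. 1 / real n) = harm N"
    by (simp add: nats_le_def harm_def N_def inverse_eq_divide)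
  moreover have "\<bar>harm N - ln (N + 1) - euler_mascheroni\<bar> \<le> 1 / N"
    using euler_mascheroni_bounds[OF N(1)] N by (auto simp: abs_le_iff inverse_eq_divide add_ac field_simps)
  moreover have "1 / N \<le> 2 / x" using N by (simp add: field_simps)
  moreover have "ln ((N + 1) / x) \<le> (N + 1) / x - 1" using N assms by (intro ln_le_minus_one) auto
  hence "ln (N + 1) - ln x \<le> (N + 1 - x) / x" using N assms by (simp add: ln_div field_simps)
  moreover have "(N + 1 - x) / x \<le> 1 / x" using N assms by (intro divide_right_mono) auto
  moreover have "ln (N + 1) \<ge> ln x" using N assms by (subst ln_le_cancel_iff) auto
  ultimately show ?thesis by (simp add: abs_le_iff)
qed

text \<open>Powers of ln (x / n) are bounded by multiples of sqrt (x / n); this sum lets them be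
  added up over n \<le> x at the cost O(x), without a remaining logarithm.\<close>

lemma sum_sqrt_le:
  assumes "x \<ge> 0"
  shows "(\<Sum>n\<in>nats_le x. sqrt (x / n)) \<le> 2 * x"
proof -
  have *: "(\<Sum>n=1..N. 1 / sqrt (real n)) \<le> 2 * sqrt (real N)" for N
  proof (induction N)
    case (Suc N)
    have "2 * sqrt (real N) * sqrt (real N + 1) \<le> real N + (real N + 1)"
      using sum_squares_bound[of "sqrt N" "sqrt (N + 1)"] by (simp add: add_ac)
    hence "2 * sqrt (real N) + 1 / sqrt (real N + 1) \<le> 2 * sqrt (real N + 1)"
      by (simp add: field_simps)
    thus ?case using Suc by (simp add: add_ac)
  qed auto
  have "(\<Sum>n\<in>nats_le x. sqrt (x / n)) = sqrt x * (\<Sum>n=1..nat \<lfloor>x\<rfloor>. 1 / sqrt (real n))"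
    by (simp add: nats_le_def sum_distrib_left real_sqrt_divide)
  also have "\<dots> \<le> sqrt x * (2 * sqrt (real (nat \<lfloor>x\<rfloor>)))"
    using assms by (intro mult_left_mono *) auto
  also have "\<dots> \<le> sqrt x * (2 * sqrt x)" using assms by (intro mult_left_mono) auto
  also have "\<dots> = 2 * x" using assms by (simp add: mult.left_commute)
  finally show ?thesis .
qed

lemma ln_le_sqrt: "y \<ge> 1 \<Longrightarrow> ln y \<le> 2 * sqrt (y::real)"
  using ln_le_minus_one[of "sqrt y"] by (simp add: ln_sqrt)

lemma ln_squared_le_sqrt: "y \<ge> 1 \<Longrightarrow> (ln y)^2 \<le> 16 * sqrt (y::real)"
proof -
  assume y: "y \<ge> 1"
  hence "ln y \<le> 4 * sqrt (sqrt y)" using ln_le_sqrt[of "sqrt y"] by (simp add: ln_sqrt)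
  hence "(ln y)^2 \<le> (4 * sqrt (sqrt y))^2" using y by (intro power_mono) auto
  thus ?thesis using y by (simp add: power_mult_distrib)
qed

lemma sum_ln_quotient_le:
  assumes "x \<ge> 0"
  shows "(\<Sum>n\<in>nats_le x. ln (x / n)) \<le> 4 * x"
proof -
  have "(\<Sum>n\<in>nats_le x. ln (x / n)) \<le> (\<Sum>n\<in>nats_le x. 2 * sqrt (x / n))"
    by (intro sum_mono ln_le_sqrt) (auto simp: in_nats_le field_simps)
  also have "\<dots> \<le> 4 * x" using sum_sqrt_le[OF assms] by (simp add: sum_distrib_left [symmetric])
  finally show ?thesis .
qed

section \<open>Chebyshev and Mertens estimates\<close>

definition psi :: "real \<Rightarrow> real" where
  "psi x = (\<Sum>n\<in>nats_le x. mangoldt n)"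

lemma psi_nonneg: "psi x \<ge> 0"
  by (simp add: psi_def sum_nonneg mangoldt_nonneg)

lemma psi_less_2:
  assumes "x < 2"
  shows "psi x = 0"
  unfolding psi_def
proof (rule sum.neutral, rule ballI)
  fix n assume "n \<in> nats_le x"
  hence "n = Suc 0" using assms by (simp add: in_nats_le)
  thus "mangoldt n = (0::real)" by simp
qed

lemma ln_sum_eq_mangoldt: "ln_sum x = (\<Sum>d\<in>nats_le x. mangoldt d * card (nats_le (x / d)))"
proof -
  have "ln_sum x = (\<Sum>n\<in>nats_le x. \<Sum>d | d dvd n. mangoldt d)"
    unfolding ln_sum_def by (intro sum.cong refl, subst mangoldt_sum) (auto simp: in_nats_le)
  also have "\<dots> = (\<Sum>d\<in>nats_le x. \<Sum>m\<in>nats_le (x / d). mangoldt d)"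
    by (rule sum_nats_le_hyperbola)
  finally show ?thesis by (simp add: mult.commute)
qed

lemma card_nats_le: "y \<ge> 0 \<Longrightarrow> real (card (nats_le y)) = \<lfloor>y\<rfloor>"
  by (simp add: nats_le_def)

text \<open>Chebyshev's argument. In \<open>ln_sum x - 2 * ln_sum (x / 2)\<close> the weight of
  \<open>mangoldt d\<close> is floor y - 2 floor (y / 2) with y = x / d; it is never negative, and
  it is 1 for x / 2 < d \<le> x. By Stirling's formula the whole is x ln 2 up to logarithms.\<close>

lemma psi_diff_le: 
  assumes "x \<ge> 0"
  shows "psi x - psi (x / 2) \<le> 7 * x"
proof (cases "x \<ge> 2")
  case True
  have sub: "nats_le (x / 2) \<subseteq> nats_le x" using assms by (intro nats_le_mono) auto
  have "ln_sum (x / 2) = (\<Sum>d\<in>nats_le x. mangoldt d * card (nats_le (x / 2 / d)))"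
    unfolding ln_sum_eq_mangoldt
    by (rule sum.mono_neutral_left) (use sub in \<open>auto simp: in_nats_le field_simps intro!: nats_le_empty\<close>)
  hence eq: "ln_sum x - 2 * ln_sum (x / 2) =
           (\<Sum>d\<in>nats_le x. mangoldt d * (real (card (nats_le (x / d))) - 2 * real (card (nats_le (x / 2 / d)))))"
    by (simp add: ln_sum_eq_mangoldt[of x] sum_distrib_left sum_subtractf [symmetric] algebra_simps)
  have "psi x - psi (x / 2) =
             (\<Sum>d\<in>nats_le x. mangoldt d - (if d \<in> nats_le (x / 2) then mangoldt d else 0))"
    unfolding psi_def sum_subtractf using sub
    by (subst sum.inter_restrict [symmetric]) (auto simp: Int_absorb1)
  also have "\<dots> = (\<Sum>d\<in>nats_le x. mangoldt d * (if d \<in> nats_le (x / 2) then 0 else 1))"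
    by (intro sum.cong) auto
  also have "\<dots> \<le> ln_sum x - 2 * ln_sum (x / 2)"
    unfolding eq
  proof (intro sum_mono mult_left_mono mangoldt_nonneg)
    fix d assume d: "d \<in> nats_le x"
    have "x / d \<ge> 0" using assms by simp
    define y where "y = x / d"
    have y: "y \<ge> 1" "x / 2 / d = y / 2" using d by (auto simp: in_nats_le y_def)
    have "2 * \<lfloor>y / 2\<rfloor> \<le> \<lfloor>y\<rfloor>" by linarith
    moreover have "y < 2" if "d \<notin> nats_le (x / 2)" using that d by (auto simp: y_def in_nats_le field_simps)
    hence "\<lfloor>y\<rfloor> \<ge> 1 \<and> \<lfloor>y / 2\<rfloor> = 0" if "d \<notin> nats_le (x / 2)" using that y by linarith
    ultimately show "(if d \<in> nats_le (x / 2) then 0 else 1) \<le>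
        real (card (nats_le (x / d))) - 2 * real (card (nats_le (x / 2 / d)))"
      unfolding y(2) y_def[symmetric] using y by (subst (1 2) card_nats_le) auto
  qed
  also have "\<dots> \<le> 3 + x * ln 2 + ln x + 2 * ln (x / 2)"
  proof -
    have eq: "ln x = ln 2 + ln (x / 2)" using True by (simp add: ln_div)
    have "x * ln x - 2 * (x / 2 * ln (x / 2)) = x * ln 2" unfolding eq by (simp add: distrib_left)
    thus ?thesis using ln_sum_approx[of x] ln_sum_approx[of "x / 2"] True by (simp add: abs_le_iff)
  qed
  finally have "psi x - psi (x / 2) \<le> 3 + x * ln 2 + ln x + 2 * ln (x / 2)" .
  moreover have "ln (x / 2) \<le> x / 2 - 1" using True by (intro ln_le_minus_one) auto
  moreover have "ln x \<le> x - 1" using True by (intro ln_le_minus_one) auto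
  moreover have "x * ln 2 \<le> x * 1" using True ln2_le_25_over_36 by (intro mult_left_mono) auto
  ultimately show ?thesis using True by linarith
qed (use assms psi_nonneg[of "x / 2"] in \<open>auto simp: psi_less_2\<close>)

text \<open>The dyadic blocks add up to 7 (x + x / 2 + x / 4 + ...) = 14 x, and \<open>psi\<close>
  is 0 below 2.\<close>

lemma psi_le:
  assumes "x \<ge> 0"
  shows "psi x \<le> 14 * x"
proof -
  have "psi x \<le> 14 * x" if "x \<ge> 0" "x < 2 ^ k" for k x
    using that
  proof (induction k arbitrary: x)
    case (Suc k)
    show ?case using Suc.IH[of "x / 2"] Suc.prems psi_diff_le[of x] by simp
  qed (auto simp: psi_less_2)
  moreover obtain k where "x < 2 ^ k" using real_arch_pow[of 2 x] by auto
  ultimately show ?thesis using assms by blast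
qed

text \<open>Replacing floor (x / k) by x / k in the prime factorisation of the factorial costs at
  most \<open>psi x\<close> \<le> 14 x; Stirling's formula costs at most 3 x more.\<close>

lemma mertens_mangoldt:
  assumes "x \<ge> 1"
  shows "\<bar>(\<Sum>k\<in>nats_le x. mangoldt k / k) - ln x\<bar> \<le> 17"
proof -
  have "\<bar>x * (\<Sum>k\<in>nats_le x. mangoldt k / k) - ln_sum x\<bar> =
        \<bar>\<Sum>k\<in>nats_le x. mangoldt k * (x / k - card (nats_le (x / k)))\<bar>"
    by (simp add: ln_sum_eq_mangoldt sum_distrib_left sum_subtractf algebra_simps)
  also have "\<dots> \<le> (\<Sum>k\<in>nats_le x. mangoldt k * 1)"
  proof (intro sum_abs[THEN order_trans] sum_mono)
    fix k :: nat
    have "\<bar>x / k - card (nats_le (x / k))\<bar> \<le> 1"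
      using card_nats_le_bounds[of "x / k"] assms by (simp add: abs_le_iff)
    thus "\<bar>mangoldt k * (x / k - card (nats_le (x / k)))\<bar> \<le> mangoldt k * 1"
      unfolding abs_mult abs_mangoldt by (intro mult_left_mono mangoldt_nonneg)
  qed
  also have "\<dots> \<le> 14 * x" using psi_le[of x] assms by (simp add: psi_def)
  finally have "\<bar>x * (\<Sum>k\<in>nats_le x. mangoldt k / k) - ln_sum x\<bar> \<le> 14 * x" .
  moreover have "ln x \<le> x - 1" using assms by (intro ln_le_minus_one) auto
  ultimately have "\<bar>x * (\<Sum>k\<in>nats_le x. mangoldt k / k) - x * ln x\<bar> \<le> 17 * x"
    using ln_sum_approx[OF assms] assms by (simp add: abs_le_iff)
  moreover have "\<bar>x * (\<Sum>k\<in>nats_le x. mangoldt k / k) - x * ln x\<bar> =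
                 x * \<bar>(\<Sum>k\<in>nats_le x. mangoldt k / k) - ln x\<bar>"
    using assms by (simp add: abs_mult right_diff_distrib [symmetric])
  ultimately have "x * \<bar>(\<Sum>k\<in>nats_le x. mangoldt k / k) - ln x\<bar> \<le> x * 17" by linarith
  thus ?thesis using assms by (subst (asm) mult_le_cancel_left_pos) auto
qed

section \<open>Selberg's formula and primes in short intervals\<close>

definition mangoldt2 :: "nat \<Rightarrow> real" where
  "mangoldt2 n = mangoldt n * ln n + (\<Sum>d | d dvd n. mangoldt d * mangoldt (n div d))"

lemma mangoldt2_nonneg: "mangoldt2 n \<ge> 0"
  unfolding mangoldt2_def
  by (cases "n = 0") (auto intro!: add_nonneg_nonneg mult_nonneg_nonneg sum_nonneg mangoldt_nonneg)

lemma mangoldt_ln_le_mangoldt2: "mangoldt n * ln (real n) \<le> mangoldt2 n"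
  unfolding mangoldt2_def by (auto intro!: sum_nonneg mult_nonneg_nonneg mangoldt_nonneg)

text \<open>Summing Lambda * Lambda over divisors gives the sum of Lambda e (ln n - ln e), and the
  part with ln e cancels against the terms \<open>mangoldt d * ln d\<close>. What remains is ln n
  times the divisor sum of Lambda.\<close>

lemma sum_mangoldt2_divisors:
  fixes n :: nat
  assumes "n > 0"
  shows "(\<Sum>d | d dvd n. mangoldt2 d) = (ln n)^2"
proof -
  have ms: "(\<Sum>d | d dvd m. mangoldt d) = ln (real m)" if "m > 0" for m
    using mangoldt_sum[of m, where ?'a = real] that by simp
  have "(\<Sum>d | d dvd n. \<Sum>e | e dvd d. mangoldt e * mangoldt (d div e)) =
        (\<Sum>e | e dvd n. \<Sum>d | d dvd n div e. mangoldt e * mangoldt d :: real)"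
    using sum_divisors_assoc[OF assms, of "\<lambda>e d k. mangoldt e * mangoldt d :: real"] by simp
  also have "\<dots> = (\<Sum>e | e dvd n. mangoldt e * (ln n - ln e))"
  proof (rule sum.cong [OF refl])
    fix e assume "e \<in> {e. e dvd n}"
    then obtain k where k: "n = e * k" by (auto elim: dvdE)
    with assms have "e > 0" "k > 0" by auto
    thus "(\<Sum>d | d dvd n div e. mangoldt e * mangoldt d) = mangoldt e * (ln n - ln e)"
      using k by (simp add: sum_distrib_left [symmetric] ms ln_mult)
  qed
  finally have "(\<Sum>d | d dvd n. mangoldt2 d) = (\<Sum>d | d dvd n. mangoldt d * ln n)"
    by (simp add: mangoldt2_def sum.distrib right_diff_distrib sum_subtractf)
  thus ?thesis using assms by (simp add: sum_distrib_right [symmetric] ms power2_eq_square)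
qed

text \<open>Put k = n m and split ln (x / n) = ln (x / k) + ln (k / n). Moebius inversion keeps only
  k = 1 from the first term and turns the second into \<open>mangoldt k\<close>. The identity
  converts a bound for the sums of F (x / m) into information on F itself.\<close>

lemma tatuzawa_iseki:
  fixes F :: "real \<Rightarrow> real"
  assumes "x \<ge> 1"
  shows "(\<Sum>n\<in>nats_le x. moebius_mu n * ln (x / n) * (\<Sum>m\<in>nats_le (x / n). F (x / n / m))) =
         F x * ln x + (\<Sum>k\<in>nats_le x. mangoldt k * F (x / k))"
proof -
  have "(\<Sum>n\<in>nats_le x. moebius_mu n * ln (x / n) * (\<Sum>m\<in>nats_le (x / n). F (x / n / m))) =
        (\<Sum>n\<in>nats_le x. \<Sum>m\<in>nats_le (x / n). moebius_mu n * ln (x / n) * F (x / (real (n * m))))"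
    by (simp add: sum_distrib_left)
  also have "\<dots> = (\<Sum>k\<in>nats_le x. \<Sum>d | d dvd k. moebius_mu d * ln (x / d) * F (x / (real (d * (k div d)))))"
    by (rule sum_nats_le_hyperbola [symmetric])
  also have "\<dots> = (\<Sum>k\<in>nats_le x. (if k = 1 then F x * ln x else 0) + mangoldt k * F (x / k))"
  proof (rule sum.cong [OF refl])
    fix k assume k: "k \<in> nats_le x"
    hence "k > 0" by (auto simp: in_nats_le)
    have "(\<Sum>d | d dvd k. moebius_mu d * ln (x / d) * F (x / (real (d * (k div d))))) =
          (\<Sum>d | d dvd k. moebius_mu d * ln (x / k) * F (x / k) +
                          moebius_mu d * ln (real (k div d)) * F (x / k))"
    proof (rule sum.cong [OF refl])
      fix d assume "d \<in> {d. d dvd k}"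
      then obtain e where e: "k = d * e" by (auto elim: dvdE)
      with \<open>k > 0\<close> have "d > 0" "e > 0" by auto
      thus "moebius_mu d * ln (x / d) * F (x / (real (d * (k div d)))) =
            moebius_mu d * ln (x / k) * F (x / k) + moebius_mu d * ln (real (k div d)) * F (x / k)"
        using assms e by (simp add: ln_div ln_mult algebra_simps)
    qed
    also have "\<dots> = (\<Sum>d | d dvd k. moebius_mu d) * ln (x / k) * F (x / k) +
                   (\<Sum>d | d dvd k. moebius_mu d * ln (real (k div d))) * F (x / k)"
      by (simp add: sum.distrib sum_distrib_right)
    also have "\<dots> = (if k = 1 then F x * ln x else 0) + mangoldt k * F (x / k)"
      by (subst sum_moebius_ln[OF \<open>k > 0\<close>], subst sum_moebius_divisors[OF \<open>k > 0\<close>]) auto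
    finally show "(\<Sum>d | d dvd k. moebius_mu d * ln (x / d) * F (x / (real (d * (k div d))))) = \<dots>" .
  qed
  also have "\<dots> = F x * ln x + (\<Sum>k\<in>nats_le x. mangoldt k * F (x / k))"
    using assms by (simp add: sum.distrib sum.delta in_nats_le)
  finally show ?thesis .
qed

lemma sum_psi_eq_ln_sum: "(\<Sum>m\<in>nats_le x. psi (x / m)) = ln_sum x"
proof -
  have "ln_sum x = (\<Sum>n\<in>nats_le x. \<Sum>d | d dvd n. mangoldt (n div d))"
    unfolding ln_sum_def
  proof (rule sum.cong [OF refl])
    fix n assume "n \<in> nats_le x"
    hence "n > 0" by (auto simp: in_nats_le)
    thus "ln (real n) = (\<Sum>d | d dvd n. mangoldt (n div d))"
      using sum_divisors_flip[of n "\<lambda>d e. mangoldt e :: real"] mangoldt_sum[of n, where ?'a = real]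
      by simp
  qed
  also have "\<dots> = (\<Sum>d\<in>nats_le x. \<Sum>m\<in>nats_le (x / d). mangoldt m)"
    by (rule sum_nats_le_hyperbola)
  finally show ?thesis by (simp add: psi_def)
qed

text \<open>A discrete partial summation: ln (x / k) is at most the harmonic sum over m \<le> x / k,
  and after interchanging the sums \<open>psi_le\<close> leaves 14 x times the sum of 1 / m^2, which
  is at most 2.\<close>

lemma sum_mangoldt_ln_quotient_le:
  assumes "x \<ge> 1"
  shows "(\<Sum>k\<in>nats_le x. mangoldt k * ln (x / k)) \<le> 28 * x"
proof -
  have sq: "(\<Sum>m=1..N. 1 / (real m)^2) \<le> 2 - 1 / real N" if "N \<ge> 1" for N
    using that
  proof (induction N rule: dec_induct)
    case (step N)
    have "1 / (real N + 1)^2 \<le> 1 / (real N * (real N + 1))"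
      using step by (intro divide_left_mono) (auto simp: power2_eq_square)
    also have "\<dots> = 1 / real N - 1 / (real N + 1)" using step by (simp add: field_simps)
    finally show ?case using step by (simp add: add_ac)
  qed auto
  have "(\<Sum>k\<in>nats_le x. mangoldt k * ln (x / k)) \<le> (\<Sum>k\<in>nats_le x. mangoldt k * (\<Sum>m\<in>nats_le (x / k). 1 / m))"
  proof (intro sum_mono mult_left_mono mangoldt_nonneg)
    fix k assume k: "k \<in> nats_le x"
    define y where "y = x / k"
    have y: "y \<ge> 1" using k by (auto simp: y_def in_nats_le)
    have "ln y \<le> ln (real (nat \<lfloor>y\<rfloor>) + 1)" using y by (subst ln_le_cancel_iff) linarith+
    also have "\<dots> \<le> harm (nat \<lfloor>y\<rfloor>)" by (rule harm_ge_ln)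
    also have "\<dots> = (\<Sum>m\<in>nats_le y. 1 / m)" by (simp add: nats_le_def harm_def inverse_eq_divide)
    finally show "ln (x / k) \<le> (\<Sum>m\<in>nats_le (x / k). 1 / m)" by (simp add: y_def)
  qed
  also have "\<dots> = (\<Sum>k\<in>nats_le x. \<Sum>m\<in>nats_le (x / k). mangoldt k * (1 / m))"
    by (simp add: sum_distrib_left)
  also have "\<dots> = (\<Sum>n\<in>nats_le x. \<Sum>d | d dvd n. mangoldt d * (1 / real (n div d)))"
    by (rule sum_nats_le_hyperbola [symmetric])
  also have "\<dots> = (\<Sum>n\<in>nats_le x. \<Sum>d | d dvd n. (1 / real d) * mangoldt (n div d))"
  proof (rule sum.cong [OF refl])
    fix n assume "n \<in> nats_le x"
    hence "n > 0" by (auto simp: in_nats_le)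
    from sum_divisors_flip[OF this, of "\<lambda>d e. mangoldt d * (1 / real e)"]
    show "(\<Sum>d | d dvd n. mangoldt d * (1 / real (n div d))) =
          (\<Sum>d | d dvd n. (1 / real d) * mangoldt (n div d))" by (simp add: mult.commute)
  qed
  also have "\<dots> = (\<Sum>m\<in>nats_le x. \<Sum>k\<in>nats_le (x / m). (1 / real m) * mangoldt k)"
    by (rule sum_nats_le_hyperbola)
  also have "\<dots> = (\<Sum>m\<in>nats_le x. (1 / m) * psi (x / m))"
    by (simp add: psi_def sum_distrib_left)
  also have "\<dots> \<le> (\<Sum>m\<in>nats_le x. (1 / m) * (14 * (x / m)))"
    using assms by (intro sum_mono mult_left_mono psi_le) auto
  also have "\<dots> = 14 * x * (\<Sum>m\<in>nats_le x. 1 / (real m)^2)"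
    by (simp add: sum_distrib_left power2_eq_square)
  also have "\<dots> \<le> 14 * x * 2"
  proof (intro mult_left_mono)
    have "(\<Sum>m\<in>nats_le x. 1 / (real m)^2) \<le> 2 - 1 / real (nat \<lfloor>x\<rfloor>)"
      unfolding nats_le_def using assms by (intro sq) (auto simp: le_nat_iff)
    also have "\<dots> \<le> 2" by simp
    finally show "(\<Sum>m\<in>nats_le x. 1 / (real m)^2) \<le> 2" .
  qed (use assms in auto)
  finally show ?thesis by simp
qed

lemma sum_mangoldt2_eq:
  "(\<Sum>k\<in>nats_le x. mangoldt2 k) =
     (\<Sum>k\<in>nats_le x. mangoldt k * ln k) + (\<Sum>k\<in>nats_le x. mangoldt k * psi (x / k))"
proof -
  have "(\<Sum>k\<in>nats_le x. \<Sum>d | d dvd k. mangoldt d * mangoldt (k div d)) =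
        (\<Sum>d\<in>nats_le x. \<Sum>m\<in>nats_le (x / d). mangoldt d * mangoldt m :: real)"
    by (rule sum_nats_le_hyperbola)
  thus ?thesis by (simp add: mangoldt2_def sum.distrib psi_def sum_distrib_left)
qed

text \<open>The identity \<open>tatuzawa_iseki\<close> is applied to F y = psi y - y + \<gamma> + 1.
  The constant \<gamma> + 1 is the one for which the main terms of the sum of F (y / m) cancel and
  O(1 + ln y) remains; with the trivial bound for the Moebius function and square roots in place of
  logarithms, the sum over n is then O(x). Comparison with \<open>2 * ln_sum x\<close> rather than 2
  x ln x prepares a summation by parts in which \<open>mangoldt2 k\<close> is replaced by 2 ln k
  term by term.\<close>

theorem selberg_formula: "\<exists>C. C \<ge> 0 \<and> (\<forall>x\<ge>1. \<bar>(\<Sum>k\<in>nats_le x. mangoldt2 k) - 2 * ln_sum x\<bar> \<le> C * x)"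
proof -
  define \<gamma> where "\<gamma> = (euler_mascheroni :: real)"
  define F where "F = (\<lambda>y. psi y - y + (\<gamma> + 1))"
  define c where "c = 5 + \<bar>\<gamma> + 1\<bar>"
  define B where "B = 16 + 2 * c"
  have G: "\<bar>\<Sum>m\<in>nats_le y. F (y / m)\<bar> \<le> c + ln y" if y: "y \<ge> 1" for y
  proof -
    have "(\<Sum>m\<in>nats_le y. F (y / m)) =
          ln_sum y - y * (\<Sum>m\<in>nats_le y. 1 / m) + (\<gamma> + 1) * card (nats_le y)"
      by (simp add: F_def sum.distrib sum_subtractf sum_psi_eq_ln_sum sum_distrib_left)
    also have "\<dots> = (ln_sum y - (y * ln y - y)) - y * ((\<Sum>m\<in>nats_le y. 1 / m) - ln y - \<gamma>) +
                   (\<gamma> + 1) * (card (nats_le y) - y)"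
      by (simp add: algebra_simps)
    also have "\<bar>\<dots>\<bar> \<le> \<bar>ln_sum y - (y * ln y - y)\<bar> + \<bar>y * ((\<Sum>m\<in>nats_le y. 1 / m) - ln y - \<gamma>)\<bar> +
                   \<bar>(\<gamma> + 1) * (card (nats_le y) - y)\<bar>" by linarith
    also have "\<dots> \<le> (1 + ln y) + 3 + \<bar>\<gamma> + 1\<bar> * 1"
    proof (intro add_mono)
      show "\<bar>ln_sum y - (y * ln y - y)\<bar> \<le> 1 + ln y" by (rule ln_sum_approx[OF y])
      have "y * \<bar>(\<Sum>m\<in>nats_le y. 1 / m) - ln y - \<gamma>\<bar> \<le> y * (3 / y)"
        unfolding \<gamma>_def using y inverse_sum_approx[OF y] by (intro mult_left_mono) auto
      thus "\<bar>y * ((\<Sum>m\<in>nats_le y. 1 / m) - ln y - \<gamma>)\<bar> \<le> 3" using y by (simp add: abs_mult)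
      show "\<bar>(\<gamma> + 1) * (card (nats_le y) - y)\<bar> \<le> \<bar>\<gamma> + 1\<bar> * 1"
        unfolding abs_mult using card_nats_le_bounds[of y] y by (intro mult_left_mono) auto
    qed
    finally show ?thesis by (simp add: c_def)
  qed
  have main: "\<bar>F x * ln x + (\<Sum>k\<in>nats_le x. mangoldt k * F (x / k))\<bar> \<le> B * (2 * x)" if x: "x \<ge> 1" for x
  proof -
    have "\<bar>F x * ln x + (\<Sum>k\<in>nats_le x. mangoldt k * F (x / k))\<bar> =
          \<bar>\<Sum>n\<in>nats_le x. moebius_mu n * ln (x / n) * (\<Sum>m\<in>nats_le (x / n). F (x / n / m))\<bar>"
      by (subst tatuzawa_iseki[OF x]) simp
    also have "\<dots> \<le> (\<Sum>n\<in>nats_le x. B * sqrt (x / n))"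
    proof (intro sum_abs[THEN order_trans] sum_mono)
      fix n assume n: "n \<in> nats_le x"
      define y where "y = x / n"
      have y: "y \<ge> 1" using n by (auto simp: y_def in_nats_le)
      have "\<bar>moebius_mu n * ln y * (\<Sum>m\<in>nats_le y. F (y / m))\<bar> \<le> 1 * ln y * (c + ln y)"
        unfolding abs_mult using y G[OF y] abs_moebius_mu_le_1
        by (intro mult_mono) (auto simp: c_def)
      also have "\<dots> = (ln y)^2 + c * ln y" by (simp add: power2_eq_square algebra_simps)
      also have "\<dots> \<le> 16 * sqrt y + c * (2 * sqrt y)"
        using y by (intro add_mono mult_left_mono ln_squared_le_sqrt ln_le_sqrt) (auto simp: c_def)
      finally show "\<bar>moebius_mu n * ln (x / n) * (\<Sum>m\<in>nats_le (x / n). F (x / n / m))\<bar> \<le> B * sqrt (x / n)"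
        by (simp add: y_def B_def algebra_simps)
    qed
    also have "\<dots> = B * (\<Sum>n\<in>nats_le x. sqrt (x / n))" by (simp add: sum_distrib_left)
    also have "\<dots> \<le> B * (2 * x)"
      using x sum_sqrt_le[of x] by (intro mult_left_mono) (auto simp: B_def c_def)
    finally show ?thesis .
  qed
  define C where "C = 2 * B + 28 + 15 * \<bar>\<gamma> + 1\<bar> + 17 + 4"
  have "\<bar>(\<Sum>k\<in>nats_le x. mangoldt2 k) - 2 * ln_sum x\<bar> \<le> C * x" if x: "x \<ge> 1" for x
  proof -
    define M where "M = (\<Sum>k\<in>nats_le x. mangoldt k / k)"
    define R where "R = (\<Sum>k\<in>nats_le x. mangoldt k * ln (x / k))"
    define P where "P = (\<Sum>k\<in>nats_le x. mangoldt k * psi (x / k))"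
    define E where "E = F x * ln x + (\<Sum>k\<in>nats_le x. mangoldt k * F (x / k))"
    have R: "0 \<le> R" "R \<le> 28 * x" unfolding R_def
      using sum_mangoldt_ln_quotient_le[OF x]
      by (auto intro!: sum_nonneg mult_nonneg_nonneg mangoldt_nonneg simp: in_nats_le)
    have "(\<Sum>k\<in>nats_le x. mangoldt k * ln k) = psi x * ln x - R"
    proof -
      have "R = (\<Sum>k\<in>nats_le x. mangoldt k * ln x - mangoldt k * ln k)"
        unfolding R_def using x by (intro sum.cong refl) (auto simp: in_nats_le ln_div algebra_simps)
      thus ?thesis by (simp add: psi_def sum_subtractf sum_distrib_right)
    qed
    hence T: "(\<Sum>k\<in>nats_le x. mangoldt2 k) = psi x * ln x - R + P"
      by (simp add: sum_mangoldt2_eq P_def)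
    have "(\<Sum>k\<in>nats_le x. mangoldt k * F (x / k)) = P - x * M + (\<gamma> + 1) * psi x"
      unfolding P_def M_def F_def psi_def
      by (simp add: sum_distrib_left sum.distrib [symmetric] sum_subtractf [symmetric] algebra_simps)
    \<comment> \<open>\<open>E\<close> contains - x ln x from \<open>F x * ln x\<close> and - x M
      from the sum. As M is ln x up to O(1), the two account for the main term 2 x ln x; the summand
      2 x is the second term of Stirling's formula.\<close>
    hence "(\<Sum>k\<in>nats_le x. mangoldt2 k) - 2 * ln_sum x =
           E - R - (\<gamma> + 1) * ln x - (\<gamma> + 1) * psi x + x * (M - ln x) - 2 * (ln_sum x - (x * ln x - x)) + 2 * x"
      unfolding T E_def by (simp add: F_def algebra_simps)
    also have "\<bar>\<dots>\<bar> \<le> \<bar>E\<bar> + \<bar>R\<bar> + \<bar>(\<gamma> + 1) * ln x\<bar> + \<bar>(\<gamma> + 1) * psi x\<bar> + \<bar>x * (M - ln x)\<bar> +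
                     2 * \<bar>ln_sum x - (x * ln x - x)\<bar> + 2 * x"
  proof -
    have "\<bar>a1 - a2 - a3 - a4 + a5 - 2 * a6 + 2 * x\<bar> \<le> \<bar>a1\<bar> + \<bar>a2\<bar> + \<bar>a3\<bar> + \<bar>a4\<bar> + \<bar>a5\<bar> + 2 * \<bar>a6\<bar> + 2 * x"
      for a1 a2 a3 a4 a5 a6 :: real using x by linarith
    thus ?thesis .
  qed
    also have "\<dots> \<le> B * (2 * x) + 28 * x + \<bar>\<gamma> + 1\<bar> * x + \<bar>\<gamma> + 1\<bar> * (14 * x) + x * 17 + 2 * x + 2 * x"
    proof (intro add_mono)
      have lnx: "0 \<le> ln x" "ln x \<le> x - 1" using x by (auto intro: ln_le_minus_one)
      show "\<bar>E\<bar> \<le> B * (2 * x)" unfolding E_def by (rule main[OF x])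
      show "\<bar>R\<bar> \<le> 28 * x" using R by simp
      show "\<bar>(\<gamma> + 1) * ln x\<bar> \<le> \<bar>\<gamma> + 1\<bar> * x" unfolding abs_mult using lnx by (intro mult_left_mono) auto
      show "\<bar>(\<gamma> + 1) * psi x\<bar> \<le> \<bar>\<gamma> + 1\<bar> * (14 * x)"
        unfolding abs_mult using psi_le[of x] psi_nonneg[of x] x by (intro mult_left_mono) auto
      show "\<bar>x * (M - ln x)\<bar> \<le> x * 17"
        unfolding abs_mult M_def using mertens_mangoldt[OF x] x by (auto intro!: mult_mono)
      show "2 * \<bar>ln_sum x - (x * ln x - x)\<bar> \<le> 2 * x" using order_trans[OF ln_sum_approx[OF x], of x] lnx by simp
    qed auto
    finally show ?thesis by (simp add: C_def algebra_simps)
  qed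
  moreover have "C \<ge> 0" by (simp add: C_def B_def c_def)
  ultimately show ?thesis by blast
qed

section \<open>Prime powers in short multiplicative intervals\<close>

lemma exp_small_bounds:
  assumes "a \<le> (1/2 :: real)"
  shows "exp a \<le> 2" "exp (-a) \<ge> 1/2"
proof -
  have "exp a \<le> exp (1/2)" using assms by simp
  also have "exp (1/2 :: real) \<le> 1 + 1/2 + (1/2)^2" by (rule exp_bound) auto
  finally show "exp a \<le> 2" by (simp add: power2_eq_square)
  thus "exp (-a) \<ge> 1/2" by (simp add: exp_minus field_simps)
qed

lemma short_interval_subset:
  assumes "m > 0" "{n. n > 0 \<and> \<bar>ln (real n) - ln (real m)\<bar> < a} = A"
  shows "A \<subseteq> nats_le (m * exp a) - nats_le (m * exp (-a))"
proof
  fix n assume "n \<in> A"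
  hence n: "n > 0" "ln (real n) < ln (real m) + a" "ln (real n) > ln (real m) - a"
    using assms(2) by (auto simp: abs_less_iff)
  have "real n = exp (ln (real n))" using n by simp
  also have "\<dots> < exp (ln (real m) + a)" using n by (subst exp_less_cancel_iff)
  finally have *: "real n < m * exp a" using assms by (simp add: exp_add)
  have "m * exp (-a) = exp (ln (real m) - a)" using assms by (simp add: exp_diff exp_minus field_simps)
  also have "\<dots> < exp (ln (real n))" using n by (subst exp_less_cancel_iff)
  also have "\<dots> = real n" using n by simp
  finally show "n \<in> nats_le (m * exp a) - nats_le (m * exp (-a))"
    using * n by (auto simp: in_nats_le)
qed

lemma finite_short_interval:
  assumes "m > 0"
  shows "finite {n. n > 0 \<and> \<bar>ln (real n) - ln (real m)\<bar> < a}"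
  by (rule finite_subset[OF short_interval_subset[OF assms refl]]) auto

text \<open>Chebyshev's bound only, hence without a saving in a. It serves for m \<le> exp (1 / a),
  where the term 1 / ln m of \<open>mangoldt_short_interval\<close> is not below a.\<close>

lemma mangoldt_short_interval_trivial:
  assumes "m > 0" "0 < a" "a \<le> 1/2"
  shows "(\<Sum>n | n > 0 \<and> \<bar>ln (real n) - ln (real m)\<bar> < a. mangoldt n / n) \<le> 56"
proof -
  let ?A = "{n. n > 0 \<and> \<bar>ln (real n) - ln (real m)\<bar> < a}"
  have e: "exp a \<le> 2" "exp (-a) \<ge> 1/2" using exp_small_bounds assms by auto
  note sub = short_interval_subset[OF assms(1) refl, of a]
  have "(\<Sum>n\<in>?A. mangoldt n / n) \<le> (\<Sum>n\<in>?A. mangoldt n * (2 / m))"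
  proof (intro sum_mono)
    fix n assume "n \<in> ?A"
    with sub have "n > 0" "real n > m * exp (-a)" by (auto simp: in_nats_le)
    moreover have "real m * exp (-a) \<ge> m * (1/2)" using e by (intro mult_left_mono) auto
    ultimately have "real m / 2 \<le> real n" by linarith
    hence "1 / real n \<le> 2 / m" using assms \<open>n > 0\<close> by (simp add: field_simps)
    from mult_left_mono[OF this mangoldt_nonneg[of n]]
    show "mangoldt n / n \<le> mangoldt n * (2 / m)" by simp
  qed
  also have "\<dots> \<le> (\<Sum>n\<in>nats_le (m * exp a). mangoldt n * (2 / m))"
    using sub by (intro sum_mono2) (auto intro!: divide_nonneg_nonneg mangoldt_nonneg)
  also have "\<dots> = psi (m * exp a) * (2 / m)" by (simp add: psi_def sum_distrib_right del: times_divide_eq_right)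
  also have "\<dots> \<le> (14 * (m * exp a)) * (2 / m)" by (intro mult_right_mono psi_le) auto
  also have "\<dots> = 28 * exp a" using assms by simp
  also have "\<dots> \<le> 56" using e by simp
  finally show ?thesis .
qed

text \<open>An upper bound of Brun-Titchmarsh type. As \<open>mangoldt2\<close> is non-negative and
  dominates \<open>mangoldt n * ln n\<close>, the difference of Selberg's formula at m e^a and m
  e^(-a) bounds the sum. After division by m ln m, the main term 2 ln n over O(a m + 1) integers
  gives the a, and the error O(m) gives the 1 / ln m.\<close>

lemma mangoldt_short_interval:
  "\<exists>C. C \<ge> 0 \<and> (\<forall>m a. m \<ge> 4 \<longrightarrow> 0 < a \<longrightarrow> a \<le> 1/2 \<longrightarrow>
     (\<Sum>n | n > 0 \<and> \<bar>ln (real n) - ln (real m)\<bar> < a. mangoldt n / n) \<le> C * (a + 1 / ln m))"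
proof -
  obtain C where C: "C \<ge> 0" "\<And>x. x \<ge> 1 \<Longrightarrow> \<bar>(\<Sum>k\<in>nats_le x. mangoldt2 k) - 2 * ln_sum x\<bar> \<le> C * x"
    using selberg_formula by blast
  have "(\<Sum>n | n > 0 \<and> \<bar>ln (real n) - ln (real m)\<bar> < a. mangoldt n / n) \<le> (64 + 12 * C) * (a + 1 / ln m)"
    if m: "m \<ge> 4" and a: "0 < a" "a \<le> 1/2" for m :: nat and a :: real
  proof -
    let ?A = "{n. n > 0 \<and> \<bar>ln (real n) - ln (real m)\<bar> < a}"
    define Y where "Y = m * exp a"
    define Z where "Z = m * exp (-a)"
    have e: "exp a \<le> 2" "exp (-a) \<ge> 1/2" using exp_small_bounds a by auto
    have sub: "?A \<subseteq> nats_le Y - nats_le Z"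
      unfolding Y_def Z_def using m by (intro short_interval_subset) auto
    have Zm: "Z \<ge> m / 2" using e m unfolding Z_def by (simp add: field_simps)
    have Ym: "Y \<le> 2 * m" using e m unfolding Y_def by (simp add: field_simps)
    have ZY: "Z \<le> Y" unfolding Y_def Z_def using a by (intro mult_left_mono) auto
    have subZY: "nats_le Z \<subseteq> nats_le Y" by (rule nats_le_mono[OF ZY])
    have "ln 4 \<le> ln (real m)" using m by simp
    \<comment> \<open>This is where m \<ge> 4 enters: ln (m / 2) is then at least half of ln m,
      which keeps ln Z comparable with ln m.\<close>
    hence lnm: "ln m \<ge> 2 * ln 2" using ln_realpow[of 2 2] by simp
    have ln2: "ln (2::real) > 0" by simp
    have "ln Z \<ge> ln (m / 2)" using Zm m by (subst ln_le_cancel_iff) auto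
    hence lnZ: "ln Z \<ge> ln m / 2" "ln Z > 0"
      using lnm m ln2 ln_div[of "real m" 2] by (auto, linarith+)
    have "ln Y \<le> ln (2 * real m)" using Ym m unfolding Y_def by (subst ln_le_cancel_iff) auto
    also have "\<dots> = ln 2 + ln (real m)" using m by (simp add: ln_mult)
    finally have lnY: "ln Y \<le> 2 * ln m" using lnm ln2 by linarith
    have ea: "exp a - exp (-a) \<le> 3 * a"
    proof -
      have "exp a \<le> 1 + a + a^2" using a by (intro exp_bound) auto
      moreover have "exp (-a) \<ge> 1 + (-a)" by (rule exp_ge_add_one_self)
      moreover have "a^2 \<le> a * 1" unfolding power2_eq_square using a by (intro mult_left_mono) auto
      ultimately show ?thesis by linarith
    qed
    have "(\<Sum>n\<in>?A. mangoldt n / n) \<le> (\<Sum>n\<in>?A. mangoldt2 n * (1 / (Z * ln Z)))"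
    proof (intro sum_mono)
      fix n assume "n \<in> ?A"
      with sub have n: "n > 0" "real n > Z" by (auto simp: in_nats_le)
      have Z0: "Z > 0" using Zm m by simp
      have "ln n > ln Z" using n Z0 by simp
      hence ln_pos: "ln n > 0" using lnZ by linarith
      have "Z * ln Z \<le> real n * ln n" using n Z0 \<open>ln n > ln Z\<close> lnZ by (intro mult_mono) auto
      hence "1 / (n * ln n) \<le> 1 / (Z * ln Z)" using Z0 lnZ ln_pos n by (intro divide_left_mono mult_pos_pos) auto
      hence "mangoldt2 n * (1 / (n * ln n)) \<le> mangoldt2 n * (1 / (Z * ln Z))"
        by (intro mult_left_mono mangoldt2_nonneg)
      moreover have "mangoldt n * ln n * (1 / (n * ln n)) \<le> mangoldt2 n * (1 / (n * ln n))"
        using ln_pos by (intro mult_right_mono mangoldt_ln_le_mangoldt2) auto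
      ultimately show "mangoldt n / n \<le> mangoldt2 n * (1 / (Z * ln Z))" using ln_pos by simp
    qed
    also have "\<dots> \<le> (\<Sum>n\<in>nats_le Y - nats_le Z. mangoldt2 n * (1 / (Z * ln Z)))"
      using sub lnZ Zm m by (intro sum_mono2) (auto intro!: divide_nonneg_nonneg mangoldt2_nonneg)
    also have "\<dots> = ((\<Sum>n\<in>nats_le Y. mangoldt2 n) - (\<Sum>n\<in>nats_le Z. mangoldt2 n)) * (1 / (Z * ln Z))"
      using subZY by (simp add: sum_diff sum_distrib_right [symmetric] sum_divide_distrib [symmetric])
    also have "\<dots> \<le> (12 * a * m * ln m + 4 * ln m + 3 * C * m) * (4 / (m * ln m))"
    proof (intro mult_mono)
      have "(\<Sum>n\<in>nats_le Y. mangoldt2 n) - (\<Sum>n\<in>nats_le Z. mangoldt2 n) \<le>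
              2 * (ln_sum Y - ln_sum Z) + C * Y + C * Z"
        using C(2)[of Y] C(2)[of Z] Zm ZY m by (simp add: abs_le_iff)
      also have "ln_sum Y - ln_sum Z = (\<Sum>n\<in>nats_le Y - nats_le Z. ln (real n))"
        unfolding ln_sum_def using subZY by (simp add: sum_diff)
      also have "\<dots> \<le> (\<Sum>n\<in>nats_le Y - nats_le Z. ln Y)"
        by (intro sum_mono) (auto simp: in_nats_le)
      also have "\<dots> = (real (card (nats_le Y)) - real (card (nats_le Z))) * ln Y"
        using subZY card_mono[OF finite_nats_le subZY] by (simp add: card_Diff_subset of_nat_diff)
      also have "\<dots> \<le> (3 * a * m + 1) * (2 * ln m)"
      proof (intro mult_mono)
        have "Y - Z = m * (exp a - exp (-a))" by (simp add: Y_def Z_def algebra_simps)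
        also have "\<dots> \<le> m * (3 * a)" using ea by (intro mult_left_mono) auto
        finally show "real (card (nats_le Y)) - real (card (nats_le Z)) \<le> 3 * a * m + 1"
          using card_nats_le_bounds[of Y] card_nats_le_bounds[of Z] Zm ZY m by (simp add: mult_ac)
        show "0 \<le> ln Y" using lnZ ZY Zm m by (intro ln_ge_zero) auto
      qed (use lnY a m in auto)
      finally have "(\<Sum>n\<in>nats_le Y. mangoldt2 n) - (\<Sum>n\<in>nats_le Z. mangoldt2 n) \<le>
         2 * ((3 * a * m + 1) * (2 * ln m)) + C * Y + C * Z" by simp
      also have "C * Y + C * Z \<le> C * (2 * m) + C * m"
      proof (intro add_mono mult_left_mono)
        show "Z \<le> real m" unfolding Z_def using a m by (simp add: mult_le_cancel_left1)
      qed (use Ym C in auto)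
      ultimately show "(\<Sum>n\<in>nats_le Y. mangoldt2 n) - (\<Sum>n\<in>nats_le Z. mangoldt2 n) \<le>
         12 * a * m * ln m + 4 * ln m + 3 * C * m" by (simp add: algebra_simps)
      have "(m / 2) * (ln m / 2) \<le> Z * ln Z" using Zm lnZ m by (intro mult_mono) auto
      hence "1 / (Z * ln Z) \<le> 1 / ((m / 2) * (ln m / 2))"
        using m lnZ Zm by (intro divide_left_mono) auto
      thus "1 / (Z * ln Z) \<le> 4 / (m * ln m)" by simp
    qed (use C a m lnZ Zm in \<open>auto intro!: add_nonneg_nonneg\<close>)
    also have "\<dots> = 48 * a + 16 / m + 12 * C / ln m"
      using m lnm ln2 by (simp add: field_simps)
    also have "16 / m \<le> 64 / ln m"
    proof -
      have "ln (real m) \<le> real m - 1" using m by (intro ln_le_minus_one) auto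
      thus ?thesis using m lnm ln2 by (simp add: field_simps)
    qed
    also have "48 * a + 64 / ln m + 12 * C / ln m \<le> (64 + 12 * C) * (a + 1 / ln m)"
      using C(1) a by (simp add: algebra_simps)
    finally show ?thesis by simp
  qed
  moreover have "64 + 12 * C \<ge> 0" using C by simp
  ultimately show ?thesis by blast
qed

section \<open>Partial sums of bounded completely multiplicative functions\<close>

lemma completely_multiplicative_mult:
  "completely_multiplicative f \<Longrightarrow> m > 0 \<Longrightarrow> n > 0 \<Longrightarrow> f (m * n) = f m * f n"
  by (auto simp: completely_multiplicative_def)

lemma norm_psum_diff_le:
  assumes "\<And>n. n > 0 \<Longrightarrow> norm (f n) \<le> 1" "z \<le> y"
  shows "norm (psum f y - psum f z) \<le> real (card (nats_le y)) - real (card (nats_le z))"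
proof -
  have sub: "nats_le z \<subseteq> nats_le y" by (rule nats_le_mono[OF assms(2)])
  have "norm (psum f y - psum f z) = norm (\<Sum>n\<in>nats_le y - nats_le z. f n)"
    unfolding psum_altdef using sub by (simp add: sum_diff)
  also have "\<dots> \<le> (\<Sum>n\<in>nats_le y - nats_le z. 1)"
    by (intro sum_norm_le assms) (auto simp: in_nats_le)
  also have "\<dots> = real (card (nats_le y)) - real (card (nats_le z))"
    using sub card_mono[OF finite_nats_le sub] by (simp add: card_Diff_subset of_nat_diff)
  finally show ?thesis .
qed

lemma norm_psum_le:
  assumes "\<And>n. n > 0 \<Longrightarrow> norm (f n) \<le> 1"
  shows "norm (psum f y) \<le> real (card (nats_le y))"
  using norm_psum_diff_le[of f "min 0 y" y] assms by (simp add: psum_altdef nats_le_empty)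

lemma norm_psum_le':
  assumes "\<And>n. n > 0 \<Longrightarrow> norm (f n) \<le> 1" "y \<ge> 0"
  shows "norm (psum f y) \<le> y"
  using norm_psum_le[of f y, OF assms(1)] card_nats_le_bounds(1)[OF assms(2)] by linarith

lemma psum_ln_squared:
  fixes f :: "nat \<Rightarrow> complex"
  assumes f: "completely_multiplicative f"
  shows "(\<Sum>n\<in>nats_le x. f n * (ln (real n))^2) =
         (\<Sum>k\<in>nats_le x. mangoldt2 k * f k * psum f (x / k))"
proof -
  have "(\<Sum>n\<in>nats_le x. f n * (ln (real n))^2) =
        (\<Sum>n\<in>nats_le x. \<Sum>d | d dvd n. mangoldt2 d * f d * f (n div d))"
  proof (rule sum.cong [OF refl])
    fix n assume "n \<in> nats_le x"
    hence n: "n > 0" by (auto simp: in_nats_le)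
    have "f n * (ln (real n))^2 = f n * of_real (\<Sum>d | d dvd n. mangoldt2 d)"
      by (subst sum_mangoldt2_divisors[OF n]) simp
    also have "\<dots> = (\<Sum>d | d dvd n. mangoldt2 d * f n)" by (simp add: sum_distrib_left mult.commute)
    also have "\<dots> = (\<Sum>d | d dvd n. mangoldt2 d * f d * f (n div d))"
    proof (rule sum.cong [OF refl])
      fix d assume "d \<in> {d. d dvd n}"
      then obtain e where e: "n = d * e" by (auto elim: dvdE)
      with n have "d > 0" "e > 0" by auto
      thus "mangoldt2 d * f n = mangoldt2 d * f d * f (n div d)"
        using e completely_multiplicative_mult[OF f, of d e] by simp
    qed
    finally show "f n * (ln (real n))^2 = \<dots>" .
  qed
  also have "\<dots> = (\<Sum>k\<in>nats_le x. \<Sum>m\<in>nats_le (x / k). mangoldt2 k * f k * f m)"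
    by (rule sum_nats_le_hyperbola)
  finally show ?thesis by (simp add: psum_altdef sum_distrib_left)
qed

lemma abel_summation:
  fixes g \<phi> :: "nat \<Rightarrow> 'a::comm_ring"
  shows "(\<Sum>k=1..K. g k * \<phi> k) = (\<Sum>k=1..K. (\<Sum>j=1..k. g j) * (\<phi> k - \<phi> (Suc k))) + (\<Sum>j=1..K. g j) * \<phi> (Suc K)"
  by (induction K) (simp_all add: algebra_simps)

section \<open>Partial sums bounded by their logarithmic average\<close>

definition normalized_psum :: "(nat \<Rightarrow> complex) \<Rightarrow> real \<Rightarrow> real" where
  "normalized_psum f v = norm (psum f (exp v)) * exp (-v)"

lemma normalized_psum_bounds:
  assumes "\<And>n. n > 0 \<Longrightarrow> norm (f n) \<le> 1"
  shows "0 \<le> normalized_psum f v" "normalized_psum f v \<le> 1"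
proof -
  have "norm (psum f (exp v)) * exp (-v) \<le> exp v * exp (-v)"
    using assms by (intro mult_right_mono norm_psum_le') auto
  thus "normalized_psum f v \<le> 1" by (simp add: normalized_psum_def exp_minus)
qed (simp add: normalized_psum_def)

lemma normalized_psum_neg: "v < 0 \<Longrightarrow> normalized_psum f v = 0"
  by (simp add: normalized_psum_def psum_altdef nats_le_empty)

lemma measurable_psum_exp [measurable]: "(\<lambda>v. psum f (exp v)) \<in> borel_measurable borel"
proof -
  have "(\<lambda>v::real. nat \<lfloor>exp v\<rfloor>) \<in> borel \<rightarrow>\<^sub>M count_space UNIV" by measurable
  thus ?thesis unfolding psum_def
    by (rule measurable_compose[where g = "\<lambda>k. \<Sum>n\<in>{1..k}. f n"]) auto
qed

lemma measurable_normalized_psum [measurable]: "normalized_psum f \<in> borel_measurable borel"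
  unfolding normalized_psum_def by measurable

lemma set_integrable_normalized_psum:
  assumes "\<And>n. n > 0 \<Longrightarrow> norm (f n) \<le> 1" "A \<in> sets borel" "bounded A"
  shows "set_integrable lborel A (normalized_psum f)"
proof (rule set_integrable_bound[of lborel A "\<lambda>_. 1::real"])
  show "set_integrable lborel A (\<lambda>_. 1::real)"
    using assms(2) emeasure_bounded_finite[OF assms(3)]
    by (simp add: set_integrable_def)
  show "set_borel_measurable lborel A (normalized_psum f)"
    using assms(2) by (auto simp: set_borel_measurable_def)
qed (use normalized_psum_bounds[OF assms(1)] in auto)

lemma
  assumes "a \<le> b"
  shows set_integrable_exp_neg_Ioc: "set_integrable lborel {a<..b} (\<lambda>v. exp (-v) :: real)"
    and set_integral_exp_neg_Ioc: "(LINT v:{a<..b}|lborel. exp (-v)) = exp (-a) - exp (-b :: real)"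
proof -
  have "set_integrable lborel {a..b} (\<lambda>v. exp (-v) :: real)"
    by (intro borel_integrable_atLeastAtMost') (auto intro!: continuous_intros)
  thus "set_integrable lborel {a<..b} (\<lambda>v. exp (-v) :: real)"
    by (rule set_integrable_subset) auto
  have "(LINT v:{a<..b}|lborel. exp (-v)) = (\<integral>v. exp (-v) * indicator {a..b} v \<partial>lborel)"
    unfolding set_lebesgue_integral_def
    by (rule integral_discrete_difference[where X = "{a}"]) (auto simp: indicator_def)
  also have "\<dots> = (- exp (-b)) - (- exp (-a))"
    using assms by (intro integral_FTC_Icc_real) (auto intro!: derivative_eq_intros)
  finally show "(LINT v:{a<..b}|lborel. exp (-v)) = exp (-a) - exp (-b)" by simp
qed

text \<open>Between ln (x / (k + 1)) and ln (x / k) the integral of exp (-v) is exactly 1 / x, so |S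
  (x / k)| / x is the integral of |S (x / k)| exp (-v) there. Replacing S (x / k) by S (exp v) costs
  at most the number of integers in between, and these costs telescope to at most x.\<close>

lemma sum_norm_psum_quotients_le:
  assumes f: "\<And>n. n > 0 \<Longrightarrow> norm (f n) \<le> 1" and x: "x \<ge> 1"
  shows "(\<Sum>k\<in>nats_le x. norm (psum f (x / k))) \<le> x * (LINT v:{0..ln x}|lborel. normalized_psum f v) + x"
proof -
  let ?h = "normalized_psum f"
  define c where "c = (\<lambda>y. real (card (nats_le y)))"
  have int: "set_integrable lborel {a<..b} ?h" for a b
    using f by (intro set_integrable_normalized_psum) auto
  have "(\<Sum>k=1..K. norm (psum f (x / real k))) \<le>
          x * (LINT v:{ln (x / Suc K)<..ln x}|lborel. ?h v) + (c x - c (x / Suc K))" for K :: nat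
  proof (induction K)
    case (Suc K)
    define a where "a = x / Suc (Suc K)"
    define b where "b = x / Suc K"
    have ab: "0 < a" "a < b" "b \<le> x" using x by (auto simp: a_def b_def field_simps)
    hence lnab: "ln a < ln b" "ln b \<le> ln x" by auto
    have "1 / b = Suc K / x" "1 / a = Suc (Suc K) / x" using x by (auto simp: a_def b_def)
    hence inv: "1 / a - 1 / b = 1 / x" by (simp add: diff_divide_distrib [symmetric])
    define D where "D = norm (psum f b) - (c b - c a)"
    have "exp (- ln a) - exp (- ln b) = 1 / x" using ab inv by (simp add: exp_minus inverse_eq_divide)
    hence ei: "(LINT v:{ln a<..ln b}|lborel. exp (-v)) = 1 / x"
      using set_integral_exp_neg_Ioc[of "ln a" "ln b"] lnab by simp
    have si': "set_integrable lborel {ln a<..ln b} (\<lambda>v. exp (-v))"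
      using lnab by (intro set_integrable_exp_neg_Ioc) auto
    have "D / x = (LINT v:{ln a<..ln b}|lborel. D * exp (-v))"
      by (simp add: ei)
    also have "\<dots> \<le> (LINT v:{ln a<..ln b}|lborel. ?h v)"
    proof (rule set_integral_mono)
      show "set_integrable lborel {ln a<..ln b} (\<lambda>v. D * exp (-v))" using si' by simp
      fix v assume v: "v \<in> {ln a<..ln b}"
      have "exp v \<le> exp (ln b)" "exp (ln a) < exp v" using v by simp_all
      hence ev: "exp v \<le> b" "a < exp v" using ab by simp_all
      have "norm (psum f b) - norm (psum f (exp v)) \<le> norm (psum f b - psum f (exp v))"
        by (rule norm_triangle_ineq2)
      also have "\<dots> \<le> c b - c (exp v)" unfolding c_def using f ev by (intro norm_psum_diff_le) auto
      also have "c (exp v) \<ge> c a" unfolding c_def using ev by (intro of_nat_mono card_mono nats_le_mono) auto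
      hence "c b - c (exp v) \<le> c b - c a" by simp
      finally have "D \<le> norm (psum f (exp v))" by (simp add: D_def)
      thus "D * exp (-v) \<le> ?h v" unfolding normalized_psum_def by (intro mult_right_mono) auto
    qed (rule int)
    finally have "norm (psum f b) \<le> x * (LINT v:{ln a<..ln b}|lborel. ?h v) + (c b - c a)"
      using x by (simp add: D_def field_simps)
    moreover have "(LINT v:{ln a<..ln x}|lborel. ?h v) =
                   (LINT v:{ln a<..ln b}|lborel. ?h v) + (LINT v:{ln b<..ln x}|lborel. ?h v)"
    proof -
      have "{ln a<..ln x} = {ln a<..ln b} \<union> {ln b<..ln x}" using lnab by auto
      thus ?thesis by (simp only:) (rule set_integral_Un, use int in auto)
    qed
    moreover have "(\<Sum>k=1..Suc K. norm (psum f (x / real k))) =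
                   (\<Sum>k=1..K. norm (psum f (x / real k))) + norm (psum f b)"
      by (simp add: b_def)
    ultimately show ?case
      using Suc.IH unfolding a_def [symmetric] b_def [symmetric] by (simp add: distrib_left)
  qed (simp add: set_lebesgue_integral_def)
  from this[of "nat \<lfloor>x\<rfloor>"] have "(\<Sum>k\<in>nats_le x. norm (psum f (x / k))) \<le>
      x * (LINT v:{ln (x / Suc (nat \<lfloor>x\<rfloor>))<..ln x}|lborel. ?h v) + (c x - c (x / Suc (nat \<lfloor>x\<rfloor>)))"
    by (simp add: nats_le_def)
  \<comment> \<open>The range reaches slightly below 0, where the integrand vanishes because the
    partial sum is empty.\<close>
  also have "(LINT v:{ln (x / Suc (nat \<lfloor>x\<rfloor>))<..ln x}|lborel. ?h v) = (LINT v:{0..ln x}|lborel. ?h v)"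
  proof -
    have "x < real (Suc (nat \<lfloor>x\<rfloor>))" using x by linarith
    hence "ln (x / Suc (nat \<lfloor>x\<rfloor>)) < 0" using x by (intro ln_less_zero) auto
    thus ?thesis unfolding set_lebesgue_integral_def
      by (intro Bochner_Integration.integral_cong) (auto simp: indicator_def normalized_psum_neg not_le)
  qed
  also have "c x - c (x / Suc (nat \<lfloor>x\<rfloor>)) \<le> x"
    using card_nats_le_bounds(1)[of x] x by (simp add: c_def)
  finally show ?thesis by simp
qed

text \<open>S x ln^2 x differs from the sum of f n ln^2 n by O(x ln x), and the latter is at most
  the sum of \<open>mangoldt2 k\<close> times |S (x / k)|. Replacing \<open>mangoldt2 k\<close> by 2
  ln k takes a summation by parts in k. There |S (x / k)| need not be monotone, but its increments
  are bounded by those of the monotone count c k of the integers up to x / k; undoing the summation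
  by parts for c leaves C times the sum of c k, that is O(x (1 + ln x)).\<close>

theorem psum_le_average:
  "\<exists>C\<ge>0. \<forall>f x. completely_multiplicative f \<longrightarrow> (\<forall>n>0. norm (f n) \<le> 1) \<longrightarrow> x \<ge> 1 \<longrightarrow>
     norm (psum f x) * (ln x)^2 \<le>
       2 * x * ln x * (LINT v:{0..ln x}|lborel. normalized_psum f v) + C * x * (1 + ln x)"
proof -
  obtain C where C: "C \<ge> 0" "\<And>x. x \<ge> 1 \<Longrightarrow> \<bar>(\<Sum>k\<in>nats_le x. mangoldt2 k) - 2 * ln_sum x\<bar> \<le> C * x"
    using selberg_formula by blast
  define \<gamma> where "\<gamma> = (euler_mascheroni :: real)"
  have \<gamma>: "\<gamma> > 0" unfolding \<gamma>_def by (rule euler_mascheroni_pos)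
  define C' where "C' = 10 + C * (\<gamma> + 3)"
  have C': "C' \<ge> 0" unfolding C'_def using C \<gamma> by simp
  have "norm (psum f x) * (ln x)^2 \<le>
       2 * x * ln x * (LINT v:{0..ln x}|lborel. normalized_psum f v) + C' * x * (1 + ln x)"
    if cm: "completely_multiplicative f" and f: "\<And>n. n > 0 \<Longrightarrow> norm (f n) \<le> 1" and x: "x \<ge> 1" for f x
  proof -
    define I where "I = (LINT v:{0..ln x}|lborel. normalized_psum f v)"
    define \<phi> where "\<phi> = (\<lambda>k::nat. norm (psum f (x / k)))"
    define c where "c = (\<lambda>k::nat. real (card (nats_le (x / k))))"
    define g where "g = (\<lambda>k::nat. mangoldt2 k - 2 * ln (real k))"
    define K where "K = nat \<lfloor>x\<rfloor>"
    have K: "nats_le x = {1..K}" by (simp add: nats_le_def K_def)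
    have lnx: "ln x \<ge> 0" using x by simp
    have "x < real (Suc K)" using x unfolding K_def by linarith
    hence zero: "x / Suc K < 1" by simp
    have cK: "c (Suc K) = 0" unfolding c_def using zero by (simp add: nats_le_empty)
    have \<phi>K: "\<phi> (Suc K) = 0" unfolding \<phi>_def using zero by (simp add: psum_altdef nats_le_empty)
    have split: "psum f x * of_real ((ln x)^2) =
          (\<Sum>n\<in>nats_le x. f n * (ln (real n))^2) + (\<Sum>n\<in>nats_le x. f n * of_real ((ln x)^2 - (ln (real n))^2))"
      unfolding psum_altdef by (simp add: sum_distrib_right sum.distrib [symmetric] algebra_simps)
    have "norm (psum f x) * (ln x)^2 = norm (psum f x * of_real ((ln x)^2))"
      by (simp add: norm_mult norm_power)
    also have "\<dots> \<le> norm (\<Sum>n\<in>nats_le x. f n * (ln (real n))^2) +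
                   norm (\<Sum>n\<in>nats_le x. f n * of_real ((ln x)^2 - (ln (real n))^2))"
      unfolding split by (rule norm_triangle_ineq)
    also have "norm (\<Sum>n\<in>nats_le x. f n * of_real ((ln x)^2 - (ln (real n))^2)) \<le> 8 * x * ln x"
    proof -
      have "norm (\<Sum>n\<in>nats_le x. f n * of_real ((ln x)^2 - (ln (real n))^2)) \<le>
            (\<Sum>n\<in>nats_le x. 2 * ln x * ln (x / n))"
      proof (rule sum_norm_le)
        fix n assume n: "n \<in> nats_le x"
        hence n1: "n \<ge> 1" "real n \<le> x" by (auto simp: in_nats_le)
        hence lnn: "0 \<le> ln (real n)" "ln (real n) \<le> ln x" by auto
        have "(ln x)^2 - (ln (real n))^2 = (ln x - ln n) * (ln x + ln n)" 
          by (simp add: power2_eq_square algebra_simps)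
        hence eq: "\<bar>(ln x)^2 - (ln (real n))^2\<bar> = (ln x - ln n) * (ln x + ln n)"
          using lnn by (simp add: abs_mult)
        have "norm (f n * of_real ((ln x)^2 - (ln (real n))^2)) \<le> 1 * ((ln x - ln n) * (ln x + ln n))"
          unfolding norm_mult norm_of_real eq using n1 lnn by (intro mult_right_mono f) auto
        also have "\<dots> \<le> 1 * ((ln x - ln n) * (2 * ln x))"
          using lnn by (intro mult_left_mono) auto
        also have "\<dots> = 2 * ln x * ln (x / n)" using n1 by (simp add: ln_div)
        finally show "norm (f n * of_real ((ln x)^2 - (ln (real n))^2)) \<le> 2 * ln x * ln (x / n)" .
      qed
      also have "\<dots> = 2 * ln x * (\<Sum>n\<in>nats_le x. ln (x / n))" by (simp add: sum_distrib_left)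
      also have "\<dots> \<le> 2 * ln x * (4 * x)"
        using sum_ln_quotient_le[of x] x by (intro mult_left_mono) auto
      finally show ?thesis by (simp add: mult_ac)
    qed
    also have "norm (\<Sum>n\<in>nats_le x. f n * (ln (real n))^2) \<le> (\<Sum>k\<in>nats_le x. mangoldt2 k * \<phi> k)"
      unfolding psum_ln_squared[OF cm]
    proof (rule sum_norm_le)
      fix k assume "k \<in> nats_le x"
      hence "norm (f k) \<le> 1" by (intro f) (auto simp: in_nats_le)
      hence "mangoldt2 k * norm (f k) * \<phi> k \<le> mangoldt2 k * 1 * \<phi> k"
        by (intro mult_right_mono mult_left_mono mangoldt2_nonneg) (auto simp: \<phi>_def)
      thus "norm (mangoldt2 k * f k * psum f (x / k)) \<le> mangoldt2 k * \<phi> k"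
        using mangoldt2_nonneg[of k] by (simp add: norm_mult \<phi>_def)
    qed
    also have "(\<Sum>k\<in>nats_le x. mangoldt2 k * \<phi> k) =
               (\<Sum>k\<in>nats_le x. 2 * ln (real k) * \<phi> k) + (\<Sum>k=1..K. g k * \<phi> k)"
      unfolding K g_def by (simp add: sum.distrib [symmetric] algebra_simps)
    also have "(\<Sum>k\<in>nats_le x. 2 * ln (real k) * \<phi> k) \<le> (\<Sum>k\<in>nats_le x. 2 * ln x * \<phi> k)"
      by (intro sum_mono mult_right_mono) (auto simp: in_nats_le \<phi>_def)
    also have "(\<Sum>k\<in>nats_le x. 2 * ln x * \<phi> k) = 2 * ln x * (\<Sum>k\<in>nats_le x. \<phi> k)"
      by (simp add: sum_distrib_left)
    also have "\<dots> \<le> 2 * ln x * (x * I + x)"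
      unfolding \<phi>_def I_def using lnx sum_norm_psum_quotients_le[of f x] f x by (intro mult_left_mono) auto
    also have "(\<Sum>k=1..K. g k * \<phi> k) = (\<Sum>k=1..K. (\<Sum>j=1..k. g j) * (\<phi> k - \<phi> (Suc k)))"
      using abel_summation[of g \<phi> K] \<phi>K by simp
    also have "\<dots> \<le> (\<Sum>k=1..K. (\<Sum>j=1..k. C) * (c k - c (Suc k)))"
    proof (intro sum_mono)
      fix k assume "k \<in> {1..K}"
      hence k: "k \<ge> 1" by simp
      have "\<bar>\<Sum>j=1..k. g j\<bar> \<le> C * k"
        using C(2)[of "real k"] k
        by (simp add: g_def nats_le_def ln_sum_def sum_subtractf sum_distrib_left)
      moreover have "\<bar>\<phi> k - \<phi> (Suc k)\<bar> \<le> c k - c (Suc k)"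
      proof -
        have "\<bar>\<phi> k - \<phi> (Suc k)\<bar> \<le> norm (psum f (x / k) - psum f (x / Suc k))"
          unfolding \<phi>_def by (rule norm_triangle_ineq3)
        also have "\<dots> \<le> c k - c (Suc k)"
          unfolding c_def using f x k by (intro norm_psum_diff_le) (auto simp: field_simps)
        finally show ?thesis .
      qed
      ultimately have "\<bar>(\<Sum>j=1..k. g j) * (\<phi> k - \<phi> (Suc k))\<bar> \<le> (C * k) * (c k - c (Suc k))"
        unfolding abs_mult by (intro mult_mono) (use C in auto)
      thus "(\<Sum>j=1..k. g j) * (\<phi> k - \<phi> (Suc k)) \<le> (\<Sum>j=1..k. C) * (c k - c (Suc k))"
        by (simp add: mult_ac)
    qed
    also have "\<dots> = (\<Sum>k=1..K. C * c k)"
      using abel_summation[of "\<lambda>_. C" c K] cK by simp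
    also have "\<dots> \<le> (\<Sum>k=1..K. C * (x / k))"
      unfolding c_def using C x by (intro sum_mono mult_left_mono card_nats_le_bounds) auto
    also have "\<dots> = C * x * (\<Sum>k\<in>nats_le x. 1 / k)"
      unfolding K by (simp add: sum_distrib_left)
    also have "\<dots> \<le> C * x * (ln x + \<gamma> + 3)"
    proof (intro mult_left_mono)
      have "3 / x \<le> 3" using x by (simp add: field_simps)
      thus "(\<Sum>k\<in>nats_le x. 1 / real k) \<le> ln x + \<gamma> + 3"
        using inverse_sum_approx[OF x] unfolding \<gamma>_def by (simp add: abs_le_iff)
    qed (use C x in auto)
    finally have "norm (psum f x) * (ln x)^2 \<le>
        2 * ln x * (x * I + x) + C * x * (ln x + \<gamma> + 3) + 8 * x * ln x" by simp
    also have "\<dots> \<le> 2 * ln x * (x * I + x) + C * x * ((\<gamma> + 3) * (1 + ln x)) + 8 * x * (1 + ln x)"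
      using x lnx C \<gamma> by (intro add_mono mult_left_mono) (auto simp: algebra_simps)
    also have "\<dots> \<le> 2 * x * ln x * I + C' * x * (1 + ln x)"
      using x lnx by (simp add: C'_def algebra_simps)
    finally show ?thesis unfolding I_def .
  qed
  with C' show ?thesis by blast
qed

section \<open>Fourier transforms and the Fejer kernel\<close>

lemma
  assumes "\<sigma> > 0"
  shows set_integrable_exp_tail: "set_integrable lborel {c..} (\<lambda>v. exp (-\<sigma> * v) :: real)"
    and set_integral_exp_tail: "(LINT v:{c..}|lborel. exp (-\<sigma> * v)) = exp (-\<sigma> * c) / \<sigma>"
proof -
  have hi: "((\<lambda>v. exp (-\<sigma> * v)) has_integral exp (-\<sigma> * c) / \<sigma>) {c..}"
    using has_integral_exp_minus_to_infinity[OF assms, of c] by simp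
  have "(\<lambda>v. exp (-\<sigma> * v)) absolutely_integrable_on {c..}"
    using hi by (intro nonnegative_absolutely_integrable_1) (auto simp: integrable_on_def)
  thus *: "set_integrable lborel {c..} (\<lambda>v. exp (-\<sigma> * v) :: real)"
    unfolding set_integrable_def by (subst (asm) integrable_completion) auto
  show "(LINT v:{c..}|lborel. exp (-\<sigma> * v)) = exp (-\<sigma> * c) / \<sigma>"
    using set_borel_integral_eq_integral(2)[OF *] hi by (simp add: integral_unique)
qed

lemma
  fixes s :: complex
  assumes "Re s > 0"
  shows set_integrable_cexp_tail: "set_integrable lborel {c..} (\<lambda>v. exp (-s * of_real v))"
    and set_integral_cexp_tail: "(LINT v:{c..}|lborel. exp (-s * of_real v)) = exp (-s * of_real c) / s"
proof -
  have s: "s \<noteq> 0" using assms by auto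
  show *: "set_integrable lborel {c..} (\<lambda>v. exp (-s * of_real v))"
  proof (rule set_integrable_bound[OF set_integrable_exp_tail[OF assms]])
    have "(\<lambda>v. exp (-s * complex_of_real v)) \<in> borel_measurable borel"
      by (intro borel_measurable_continuous_onI continuous_intros)
    hence "(\<lambda>v. exp (-s * complex_of_real v)) \<in> borel_measurable lborel" by simp
    thus "set_borel_measurable lborel {c..} (\<lambda>v. exp (-s * complex_of_real v))"
      unfolding set_borel_measurable_def by measurable
  qed auto
  have **: "set_integrable lborel (einterval (ereal c) \<infinity>) (\<lambda>v. exp (-s * of_real v))"
    by (rule set_integrable_subset[OF *]) (auto simp: einterval_def)
  have "(LBINT v=ereal c..\<infinity>. exp (-s * of_real v)) = 0 - (- exp (-s * of_real c) / s)"
  proof (rule interval_integral_FTC_integrable[where F = "\<lambda>v. - exp (-s * of_real v) / s"])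
    show "((\<lambda>v. - exp (-s * of_real v) / s) has_vector_derivative exp (-s * of_real x)) (at x)" for x
    proof -
      have "((\<lambda>v. - exp (-s * v) / s) has_field_derivative exp (-s * of_real x)) (at (of_real x))"
        using s by (auto intro!: derivative_eq_intros)
      thus ?thesis by (rule has_vector_derivative_real_field)
    qed
    have "((\<lambda>v. - exp (-s * of_real v) / s) \<longlongrightarrow> - exp (-s * of_real c) / s) (at_right c)"
      using s by (intro tendsto_intros) auto
    thus "(((\<lambda>v. - exp (-s * of_real v) / s) \<circ> real_of_ereal) \<longlongrightarrow> - exp (-s * of_real c) / s) (at_right (ereal c))"
      unfolding ereal_tendsto_simps .
    have "((\<lambda>v. exp (- Re s * v)) \<longlongrightarrow> 0) at_top" using assms by real_asymp
    hence "((\<lambda>v. norm (exp (-s * complex_of_real v))) \<longlongrightarrow> 0) at_top" by simp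
    hence "((\<lambda>v. exp (-s * complex_of_real v)) \<longlongrightarrow> 0) at_top" by (rule tendsto_norm_zero_cancel)
    hence "((\<lambda>v. - exp (-s * complex_of_real v) / s) \<longlongrightarrow> - 0 / s) at_top"
      using s by (intro tendsto_intros) auto
    thus "(((\<lambda>v. - exp (-s * of_real v) / s) \<circ> real_of_ereal) \<longlongrightarrow> 0) (at_left \<infinity>)"
      unfolding ereal_tendsto_simps by simp
  qed (use ** in \<open>auto intro!: continuous_intros\<close>)
  also have "(LBINT v=ereal c..\<infinity>. exp (-s * of_real v)) = (LINT v:{c..}|lborel. exp (-s * of_real v))"
    unfolding interval_integral_to_infinity_eq set_lebesgue_integral_def
    by (rule integral_discrete_difference[where X = "{c}"]) (auto simp: indicator_def)
  finally show "(LINT v:{c..}|lborel. exp (-s * of_real v)) = exp (-s * of_real c) / s" by simp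
qed

definition dirichlet :: "(nat \<Rightarrow> complex) \<Rightarrow> complex \<Rightarrow> complex" where
  "dirichlet a s = (\<Sum>n. a n * exp (-s * of_real (ln (real n))))"

text \<open>\<open>psum a (exp v)\<close> is a superposition of steps starting at ln n, each
  contributing a n n^(-s) / s to the transform; absolute convergence permits termwise integration.
  Since ln 0 = 0, a non-zero a 0 would enter the series but not the partial sums. The half-plane is
  Re s > 0 because the lemma is also applied to \<open>mangoldt n / n\<close> at small s.\<close>

lemma
  assumes a0: "a 0 = 0" and s: "Re s > 0"
  assumes sum: "summable (\<lambda>n. norm (a n) * exp (- Re s * ln (real n)))"
  shows integrable_psum_exp: "integrable lborel (\<lambda>v. psum a (exp v) * exp (-s * of_real v))"
    and integral_psum_exp: "(\<integral>v. psum a (exp v) * exp (-s * of_real v) \<partial>lborel) = dirichlet a s / s"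
proof -
  define u where "u = (\<lambda>n v. indicator {ln (real n)..} v *\<^sub>R (a n * exp (-s * of_real v)))"
  have int: "integrable lborel (u n)" for n
    unfolding u_def using set_integrable_cexp_tail[OF s, of "ln n"]
    by (intro set_integrable_mult_right[unfolded set_integrable_def]) (simp add: set_integrable_def)
  have eq: "(\<Sum>n. u n v) = psum a (exp v) * exp (-s * of_real v)" and fin: "finite {n. u n v \<noteq> 0}" for v
  proof -
    have sub: "{n. u n v \<noteq> 0} \<subseteq> nats_le (exp v)"
    proof
      fix n assume "n \<in> {n. u n v \<noteq> 0}"
      hence n: "n \<noteq> 0" "ln (real n) \<le> v" using a0 by (auto simp: u_def indicator_def split: if_splits intro: ccontr)
      hence "exp (ln (real n)) \<le> exp v" by (subst exp_le_cancel_iff)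
      with n show "n \<in> nats_le (exp v)" by (auto simp: in_nats_le)
    qed
    thus "finite {n. u n v \<noteq> 0}" by (rule finite_subset) auto
    have "(\<Sum>n. u n v) = (\<Sum>n\<in>nats_le (exp v). u n v)" using sub by (intro suminf_finite) auto
    also have "\<dots> = (\<Sum>n\<in>nats_le (exp v). a n * exp (-s * of_real v))"
    proof (rule sum.cong [OF refl])
      fix n assume "n \<in> nats_le (exp v)"
      hence "ln (real n) \<le> ln (exp v)" by (subst ln_le_cancel_iff) (auto simp: in_nats_le)
      thus "u n v = a n * exp (-s * of_real v)" by (simp add: u_def)
    qed
    finally show "(\<Sum>n. u n v) = psum a (exp v) * exp (-s * of_real v)"
      by (simp add: psum_altdef sum_distrib_right)
  qed
  have nrm: "(\<integral>v. norm (u n v) \<partial>lborel) = norm (a n) * exp (- Re s * ln (real n)) / Re s" for n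
  proof -
    have "(\<integral>v. norm (u n v) \<partial>lborel) = (\<integral>v. norm (a n) * (indicator {ln (real n)..} v *\<^sub>R exp (- Re s * v)) \<partial>lborel)"
      by (intro Bochner_Integration.integral_cong) (auto simp: u_def norm_mult indicator_def)
    also have "\<dots> = norm (a n) * (LINT v:{ln (real n)..}|lborel. exp (- Re s * v))"
      by (simp add: set_lebesgue_integral_def)
    finally show ?thesis using set_integral_exp_tail[OF s, of "ln n"] by simp
  qed
  have summ: "summable (\<lambda>n. norm (u n v))" for v
    by (rule summable_finite[OF fin[of v]]) auto
  have summ2: "summable (\<lambda>n. \<integral>v. norm (u n v) \<partial>lborel)"
    unfolding nrm by (intro summable_divide sum)
  have "integrable lborel (\<lambda>v. \<Sum>n. u n v)"
    using int summ summ2 by (intro integrable_suminf) auto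
  thus "integrable lborel (\<lambda>v. psum a (exp v) * exp (-s * of_real v))" unfolding eq .
  have "(\<integral>v. (\<Sum>n. u n v) \<partial>lborel) = (\<Sum>n. \<integral>v. u n v \<partial>lborel)"
    using int summ summ2 by (intro integral_suminf) auto
  also have "(\<lambda>n. \<integral>v. u n v \<partial>lborel) = (\<lambda>n. a n * exp (-s * of_real (ln (real n))) / s)"
  proof
    fix n
    have "(\<integral>v. u n v \<partial>lborel) = a n * (LINT v:{ln (real n)..}|lborel. exp (-s * of_real v))"
      unfolding u_def set_lebesgue_integral_def
      by (subst integral_mult_right_zero [symmetric]) (intro Bochner_Integration.integral_cong, auto)
    thus "(\<integral>v. u n v \<partial>lborel) = a n * exp (-s * of_real (ln (real n))) / s"
      using set_integral_cexp_tail[OF s, of "ln n"] by simp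
  qed
  also have "(\<Sum>n. a n * exp (-s * of_real (ln (real n))) / s) = dirichlet a s / s"
    unfolding dirichlet_def
  proof (rule suminf_divide)
    show "summable (\<lambda>n. a n * exp (- s * of_real (ln (real n))))"
      by (rule summable_norm_cancel) (use sum in \<open>simp add: norm_mult\<close>)
  qed
  finally show "(\<integral>v. psum a (exp v) * exp (-s * of_real v) \<partial>lborel) = dirichlet a s / s" unfolding eq .
qed

text \<open>The unnormalised Fejer kernel 2 sin^2 (a t / 2) / t^2. Division by zero gives it the
  value 0 at t = 0 instead of a^2 / 2, which integrals do not see. The parameter may be negative, as
  in \<open>fejer (a - v)\<close>.\<close>

definition fejer :: "real \<Rightarrow> real \<Rightarrow> real" where
  "fejer a t = (1 - cos (a * t)) / t^2"

text \<open>This is the number pi. It stands on both sides of the comparison in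
  \<open>log_profile_mean_square\<close> and, being positive, is cancelled there.\<close>

definition fejer_const :: real where
  "fejer_const = (\<integral>t. fejer 1 t \<partial>lborel)"

lemma fejer_nonneg: "fejer a t \<ge> 0"
  by (simp add: fejer_def)

lemma measurable_fejer [measurable]: "fejer a \<in> borel_measurable borel"
  unfolding fejer_def by measurable

lemma integrable_fejer_1: "integrable lborel (fejer 1)"
proof (rule Bochner_Integration.integrable_bound)
  \<comment> \<open>The numerator is at most t^2 / 2 and at most 2, so (1 - cos t) (1 + t^2) \<le>
    (1 / 2 + 2) t^2.\<close>
  show "integrable lborel (\<lambda>t. 3 * inverse (1 + t^2) :: real)"
    using integrable_inverse_1_plus_square by (simp add: set_integrable_def einterval_def)
  show "AE t in lborel. norm (fejer 1 t) \<le> norm (3 * inverse (1 + t^2) :: real)"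
  proof (rule AE_I2)
    fix t :: real
    show "norm (fejer 1 t) \<le> norm (3 * inverse (1 + t^2))"
    proof (cases "t = 0")
      case False
      have "1 - cos t = 2 * (sin (t / 2))^2" using cos_double_sin[of "t / 2"] by simp
      also have "(sin (t / 2))^2 \<le> (t / 2)^2"
        using abs_sin_x_le_abs_x[of "t / 2"] by (simp only: abs_le_square_iff)
      finally have 1: "1 - cos t \<le> t^2 / 2" by (simp add: power_divide)
      have 2: "t^2 * (1 - cos t) \<le> t^2 * 2"
        by (intro mult_left_mono) (use cos_ge_minus_one[of t] in auto)
      have 3: "t^2 > 0" using False by simp
      have "(1 - cos t) * (1 + t^2) = (1 - cos t) + t^2 * (1 - cos t)" by (simp add: algebra_simps)
      also have "\<dots> \<le> 3 * t^2" using 1 2 3 by linarith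
      finally have "(1 - cos t) / t^2 \<le> 3 / (1 + t^2)"
        using 3 by (simp add: pos_divide_le_eq pos_le_divide_eq add_pos_pos)
      thus ?thesis using fejer_nonneg[of 1 t] by (simp add: fejer_def inverse_eq_divide)
    qed (simp add: fejer_def)
  qed
qed auto

lemma fejer_scale: "a \<noteq> 0 \<Longrightarrow> fejer a t = a^2 * fejer 1 (a * t)"
  by (simp add: fejer_def power_mult_distrib)

lemma
  shows integrable_fejer: "integrable lborel (fejer a)"
    and integral_fejer: "(\<integral>t. fejer a t \<partial>lborel) = \<bar>a\<bar> * fejer_const"
proof -
  have "integrable lborel (fejer a) \<and> (\<integral>t. fejer a t \<partial>lborel) = \<bar>a\<bar> * fejer_const"
  proof (cases "a = 0")
    case True
    thus ?thesis by (simp add: fejer_def [abs_def])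
  next
    case False
    have "integrable lborel (\<lambda>t. fejer 1 (0 + a * t))"
      by (rule lborel_integrable_real_affine[OF integrable_fejer_1 False])
    moreover have "fejer_const = \<bar>a\<bar> * (\<integral>t. fejer 1 (0 + a * t) \<partial>lborel)"
      unfolding fejer_const_def using lborel_integral_real_affine[OF False, of "fejer 1" 0] by simp
    moreover have "fejer a = (\<lambda>t. a^2 * fejer 1 (a * t))" using fejer_scale[OF False] by blast
    moreover have "a^2 * X = \<bar>a\<bar> * (\<bar>a\<bar> * X)" for X
      by (simp add: power2_eq_square mult.assoc [symmetric])
    ultimately show ?thesis by simp
  qed
  thus "integrable lborel (fejer a)" "(\<integral>t. fejer a t \<partial>lborel) = \<bar>a\<bar> * fejer_const" by auto
qed

lemma fejer_const_pos: "fejer_const > 0"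
proof -
  define c :: real where "c = (1 - cos 1) / 4"
  have "cos 1 < cos (0::real)" using pi_gt3 by (intro cos_monotone_0_pi) auto
  hence "c > 0" by (simp add: c_def)
  have "c = (\<integral>t. c * indicator {1..2} (t::real) \<partial>lborel)" by simp
  also have "\<dots> \<le> fejer_const" unfolding fejer_const_def
  proof (rule integral_mono)
    fix t :: real
    show "c * indicator {1..2} t \<le> fejer 1 t"
    proof (cases "t \<in> {1..2}")
      case True
      have "cos t \<le> cos 1" using True pi_gt3 by (intro cos_monotone_0_pi_le) auto
      moreover have "t^2 \<le> 2^2" using True by (intro power_mono) auto
      ultimately have "(1 - cos 1) / 4 \<le> (1 - cos t) / t^2"
        using True by (intro frac_le) auto
      thus ?thesis using True by (simp add: c_def fejer_def)
    qed (simp add: fejer_nonneg)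
  qed (auto simp: integrable_fejer_1)
  finally show ?thesis using \<open>c > 0\<close> by simp
qed

text \<open>The transform of the kernel is a triangle on [-a, a]. By the product formula for
  cosines, \<open>fejer a t * cos (t * v)\<close> is a combination of the kernels with parameters a
  + v, a - v and v; each has the integral |parameter| times \<open>fejer_const\<close>, and the same
  combination of absolute values is the triangle. The imaginary part vanishes by the substitution t
  to -t.\<close>

lemma
  assumes "a > 0"
  shows integrable_fejer_cis: "integrable lborel (\<lambda>t. fejer a t *\<^sub>R cis (-t * v))"
    and integral_fejer_cis:
      "(\<integral>t. fejer a t *\<^sub>R cis (-t * v) \<partial>lborel) = of_real (fejer_const * max (a - \<bar>v\<bar>) 0)"
proof -
  have meas: "(\<lambda>t. cis (-t * v)) \<in> borel_measurable borel"
    by (intro borel_measurable_continuous_onI continuous_intros)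
  show int: "integrable lborel (\<lambda>t. fejer a t *\<^sub>R cis (-t * v))"
    by (rule Bochner_Integration.integrable_bound[OF integrable_fejer[of a]])
       (use meas in \<open>auto simp: fejer_nonneg\<close>)
  have "Re (\<integral>t. fejer a t *\<^sub>R cis (-t * v) \<partial>lborel) = (\<integral>t. fejer a t * cos (t * v) \<partial>lborel)"
    using integral_Re[OF int] by simp
  also have "(\<lambda>t. fejer a t * cos (t * v)) =
             (\<lambda>t. (1/2) * fejer (a + v) t + (1/2) * fejer (a - v) t - fejer v t)"
  proof
    fix t
    have "cos ((a + v) * t) + cos ((a - v) * t) = 2 * cos (a * t) * cos (v * t)"
      by (simp add: distrib_right left_diff_distrib cos_add cos_diff)
    hence eq: "(1 - cos (a * t)) * cos (t * v) =
          (1/2) * (1 - cos ((a + v) * t)) + (1/2) * (1 - cos ((a - v) * t)) - (1 - cos (v * t))"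
      by (simp add: algebra_simps)
    have "fejer a t * cos (t * v) = ((1 - cos (a * t)) * cos (t * v)) / t^2" by (simp add: fejer_def)
    also have "\<dots> = (1/2) * fejer (a + v) t + (1/2) * fejer (a - v) t - fejer v t"
      unfolding eq by (simp add: fejer_def add_divide_distrib diff_divide_distrib)
    finally show "fejer a t * cos (t * v) = \<dots>" .
  qed
  also have "(\<integral>t. (1/2) * fejer (a + v) t + (1/2) * fejer (a - v) t - fejer v t \<partial>lborel) =
             (1/2) * (\<bar>a + v\<bar> * fejer_const) + (1/2) * (\<bar>a - v\<bar> * fejer_const) - \<bar>v\<bar> * fejer_const"
    by (simp add: integrable_fejer integral_fejer)
  also have "\<dots> = fejer_const * ((1/2) * \<bar>a + v\<bar> + (1/2) * \<bar>a - v\<bar> - \<bar>v\<bar>)" by (simp add: algebra_simps)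
  also have "(1/2) * \<bar>a + v\<bar> + (1/2) * \<bar>a - v\<bar> - \<bar>v\<bar> = max (a - \<bar>v\<bar>) 0" using assms by (auto simp: max_def abs_if field_simps)
  finally have re: "Re (\<integral>t. fejer a t *\<^sub>R cis (-t * v) \<partial>lborel) = fejer_const * max (a - \<bar>v\<bar>) 0" .
  have "Im (\<integral>t. fejer a t *\<^sub>R cis (-t * v) \<partial>lborel) = (\<integral>t. - (fejer a t * sin (t * v)) \<partial>lborel)"
    using integral_Im[OF int] by simp
  moreover have "(\<integral>t. - (fejer a t * sin (t * v)) \<partial>lborel) = (\<integral>t. fejer a t * sin (t * v) \<partial>lborel)"
    by (subst lborel_integral_real_affine[of "-1" _ 0]) (auto simp: fejer_def)
  ultimately have im: "Im (\<integral>t. fejer a t *\<^sub>R cis (-t * v) \<partial>lborel) = 0" by simp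
  show "(\<integral>t. fejer a t *\<^sub>R cis (-t * v) \<partial>lborel) = of_real (fejer_const * max (a - \<bar>v\<bar>) 0)"
    using re im by (simp add: complex_eq_iff)
qed

section \<open>Fejer-weighted mean squares as quadratic forms\<close>

lemma (in pair_sigma_finite)
  fixes f :: "'a \<Rightarrow> complex" and g :: "'b \<Rightarrow> complex"
  assumes f: "integrable M1 f" and g: "integrable M2 g"
  shows integrable_pair_mult: "integrable (M1 \<Otimes>\<^sub>M M2) (\<lambda>p. f (fst p) * g (snd p))"
    and integral_pair_mult: "(\<integral>p. f (fst p) * g (snd p) \<partial>(M1 \<Otimes>\<^sub>M M2)) = (\<integral>x. f x \<partial>M1) * (\<integral>y. g y \<partial>M2)"
proof -
  have [measurable]: "f \<in> borel_measurable M1" "g \<in> borel_measurable M2" using f g by auto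
  show *: "integrable (M1 \<Otimes>\<^sub>M M2) (\<lambda>p. f (fst p) * g (snd p))"
  proof (rule Fubini_integrable)
    show "integrable M1 (\<lambda>x. \<integral>y. norm (f (fst (x, y)) * g (snd (x, y))) \<partial>M2)"
      using f by (simp add: norm_mult)
    show "AE x in M1. integrable M2 (\<lambda>y. f (fst (x, y)) * g (snd (x, y)))"
      using g by auto
  qed measurable
  show "(\<integral>p. f (fst p) * g (snd p) \<partial>(M1 \<Otimes>\<^sub>M M2)) = (\<integral>x. f x \<partial>M1) * (\<integral>y. g y \<partial>M2)"
    using integral_fst'[OF *] by simp
qed

text \<open>Expand |B t|^2 as a double integral and integrate over t: the kernel leaves only the
  pairs with |\<theta> y - \<theta> z| < a. The measure is general because the formula is applied
  twice, to counting measure with \<theta> = ln for the logarithmic derivative and to Lebesgue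
  measure with \<theta> the identity for \<open>log_profile\<close>.\<close>

lemma
  fixes b :: "'a \<Rightarrow> complex" and \<theta> :: "'a \<Rightarrow> real"
  assumes M: "sigma_finite_measure M" and b: "integrable M b" and \<theta>: "\<theta> \<in> borel_measurable M" and a: "a > 0"
  defines "B \<equiv> (\<lambda>t. \<integral>y. b y * cis (-t * \<theta> y) \<partial>M)"
  shows integrable_fejer_quadratic: "integrable lborel (\<lambda>t. fejer a t * (norm (B t))^2)"
    and integral_fejer_quadratic:
      "of_real (\<integral>t. fejer a t * (norm (B t))^2 \<partial>lborel) =
         of_real fejer_const * (\<integral>y. (\<integral>z. b y * cnj (b z) * of_real (max (a - \<bar>\<theta> y - \<theta> z\<bar>) 0) \<partial>M) \<partial>M)"
    and integrable_fejer_form: "integrable M (\<lambda>y. \<integral>z. b y * cnj (b z) * of_real (max (a - \<bar>\<theta> y - \<theta> z\<bar>) 0) \<partial>M)"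
proof -
  interpret sigma_finite_measure M by (rule M)
  interpret P: pair_sigma_finite M M ..
  interpret PS: sigma_finite_measure "M \<Otimes>\<^sub>M M" by (intro sigma_finite_pair_measure M)
  interpret Q: pair_sigma_finite "M \<Otimes>\<^sub>M M" lborel ..
  note [measurable] = \<theta> borel_measurable_integrable[OF b]
  have [measurable]: "cis \<in> borel_measurable borel"
    by (intro borel_measurable_continuous_onI continuous_intros)
  define h where "h = (\<lambda>p. b (fst p) * cnj (b (snd p)))"
  have h: "integrable (M \<Otimes>\<^sub>M M) h"
    unfolding h_def using b by (intro P.integrable_pair_mult) auto
  hence [measurable]: "h \<in> borel_measurable (M \<Otimes>\<^sub>M M)" by auto
  define v where "v = (\<lambda>p. \<theta> (fst p) - \<theta> (snd p))"
  have [measurable]: "v \<in> borel_measurable (M \<Otimes>\<^sub>M M)" unfolding v_def by measurable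
  define g where "g = (\<lambda>p t. h p * (fejer a t *\<^sub>R cis (-t * v p)))"
  have g: "integrable ((M \<Otimes>\<^sub>M M) \<Otimes>\<^sub>M lborel) (case_prod g)"
  proof (rule Q.Fubini_integrable)
    show "integrable (M \<Otimes>\<^sub>M M) (\<lambda>p. \<integral>t. norm (case_prod g (p, t)) \<partial>lborel)"
      using h by (simp add: g_def norm_mult fejer_nonneg)
    show "AE p in M \<Otimes>\<^sub>M M. integrable lborel (\<lambda>t. case_prod g (p, t))"
      unfolding g_def case_prod_conv
      by (intro AE_I2 integrable_mult_right integrable_fejer_cis[OF a])
  qed (unfold g_def, measurable)
  have inner1: "(\<integral>p. g p t \<partial>(M \<Otimes>\<^sub>M M)) = of_real (fejer a t * (norm (B t))^2)" for t
  proof -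
    have bt: "integrable M (\<lambda>y. b y * cis (-t * \<theta> y))"
      by (rule Bochner_Integration.integrable_bound[OF b]) (auto simp: norm_mult)
    hence bt': "integrable M (\<lambda>y. cnj (b y * cis (-t * \<theta> y)))" by (intro integrable_cnj)
    have "(\<lambda>p. g p t) = (\<lambda>p. of_real (fejer a t) *
            ((b (fst p) * cis (-t * \<theta> (fst p))) * cnj (b (snd p) * cis (-t * \<theta> (snd p)))))"
    proof
      fix p
      have "cis (-t * v p) = cis (-t * \<theta> (fst p)) * cnj (cis (-t * \<theta> (snd p)))"
        by (simp add: v_def cis_cnj cis_mult algebra_simps)
      thus "g p t = of_real (fejer a t) *
              ((b (fst p) * cis (-t * \<theta> (fst p))) * cnj (b (snd p) * cis (-t * \<theta> (snd p))))"
        by (simp only: g_def h_def scaleR_conv_of_real complex_cnj_mult mult_ac)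
    qed
    hence "(\<integral>p. g p t \<partial>(M \<Otimes>\<^sub>M M)) = of_real (fejer a t) * (B t * cnj (B t))"
      by (simp only: integral_mult_right_zero P.integral_pair_mult[OF bt bt'] Bochner_Integration.integral_cnj B_def)
    thus ?thesis by (simp only: of_real_mult complex_norm_square)
  qed
  have "integrable lborel (\<lambda>t. \<integral>p. g p t \<partial>(M \<Otimes>\<^sub>M M))" by (rule Q.integrable_snd[OF g])
  thus "integrable lborel (\<lambda>t. fejer a t * (norm (B t))^2)"
    unfolding inner1 by (simp only: complex_of_real_integrable_eq)
  have hm: "integrable (M \<Otimes>\<^sub>M M) (\<lambda>p. h p * of_real (max (a - \<bar>v p\<bar>) 0))"
  proof (rule Bochner_Integration.integrable_bound)
    show "integrable (M \<Otimes>\<^sub>M M) (\<lambda>p. of_real a * h p)" using h by simp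
    show "AE p in M \<Otimes>\<^sub>M M. norm (h p * of_real (max (a - \<bar>v p\<bar>) 0)) \<le> norm (of_real a * h p)"
    proof (rule AE_I2)
      fix p
      have "norm (h p) * max (a - \<bar>v p\<bar>) 0 \<le> norm (h p) * a" using a by (intro mult_left_mono) auto
      thus "norm (h p * of_real (max (a - \<bar>v p\<bar>) 0)) \<le> norm (of_real a * h p)"
        using a by (simp add: norm_mult mult.commute)
    qed
  qed measurable
  show "integrable M (\<lambda>y. \<integral>z. b y * cnj (b z) * of_real (max (a - \<bar>\<theta> y - \<theta> z\<bar>) 0) \<partial>M)"
    using P.integrable_fst'[OF hm] by (simp add: h_def v_def)
  have "of_real (\<integral>t. fejer a t * (norm (B t))^2 \<partial>lborel) = (\<integral>t. (\<integral>p. g p t \<partial>(M \<Otimes>\<^sub>M M)) \<partial>lborel)"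
    unfolding inner1 by (rule integral_complex_of_real [symmetric])
  also have "\<dots> = (\<integral>p. (\<integral>t. g p t \<partial>lborel) \<partial>(M \<Otimes>\<^sub>M M))" by (rule Q.Fubini_integral[OF g])
  also have "\<dots> = (\<integral>p. of_real fejer_const * (h p * of_real (max (a - \<bar>v p\<bar>) 0)) \<partial>(M \<Otimes>\<^sub>M M))"
  proof -
    have "(\<integral>t. g p t \<partial>lborel) = of_real fejer_const * (h p * of_real (max (a - \<bar>v p\<bar>) 0))" for p
      by (simp only: g_def integral_mult_right_zero integral_fejer_cis[OF a] of_real_mult mult_ac)
    thus ?thesis by simp
  qed
  also have "\<dots> = of_real fejer_const * (\<integral>p. h p * of_real (max (a - \<bar>v p\<bar>) 0) \<partial>(M \<Otimes>\<^sub>M M))" by simp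
  also have "(\<integral>p. h p * of_real (max (a - \<bar>v p\<bar>) 0) \<partial>(M \<Otimes>\<^sub>M M)) =
             (\<integral>y. (\<integral>z. b y * cnj (b z) * of_real (max (a - \<bar>\<theta> y - \<theta> z\<bar>) 0) \<partial>M) \<partial>M)"
    using P.integral_fst'[OF hm] by (simp add: h_def v_def)
  finally show "of_real (\<integral>t. fejer a t * (norm (B t))^2 \<partial>lborel) =
         of_real fejer_const * (\<integral>y. (\<integral>z. b y * cnj (b z) * of_real (max (a - \<bar>\<theta> y - \<theta> z\<bar>) 0) \<partial>M) \<partial>M)" .
qed

section \<open>Euler products\<close>

text \<open>
  Since \<^term>\<open>ln 0 = (0::real)\<close>, the term of index \<open>0\<close> of a Dirichlet series written with
  \<^term>\<open>\<lambda>n. exp (-s * of_real (ln (real n)))\<close> does not vanish by itself; hence the normalisation of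
  the value at \<open>0\<close>.
\<close>
definition bounded_cm :: "(nat \<Rightarrow> complex) \<Rightarrow> bool" where
  "bounded_cm f \<longleftrightarrow> completely_multiplicative f \<and> f 0 = 0 \<and> (\<forall>n. norm (f n) \<le> 1)"

definition dterm :: "(nat \<Rightarrow> complex) \<Rightarrow> complex \<Rightarrow> nat \<Rightarrow> complex" where
  "dterm f s n = f n * exp (-s * of_real (ln (real n)))"

lemma dirichlet_eq_dterm: "dirichlet f s = (\<Sum>n. dterm f s n)"
  by (simp add: dirichlet_def dterm_def)

lemma norm_dterm: "norm (dterm f s n) = norm (f n) * exp (- Re s * ln (real n))"
  by (simp add: dterm_def norm_mult)

lemma bounded_cm_0: "bounded_cm f \<Longrightarrow> f 0 = 0"
  and bounded_cm_norm: "bounded_cm f \<Longrightarrow> norm (f n) \<le> 1"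
  and bounded_cm_1: "bounded_cm f \<Longrightarrow> f 1 = 1"
  and bounded_cm_mult: "bounded_cm f \<Longrightarrow> f (m * n) = f m * f n"
  by (cases "m = 0"; cases "n = 0"; auto simp: bounded_cm_def completely_multiplicative_def)+

lemma dterm_0: "bounded_cm f \<Longrightarrow> dterm f s 0 = 0"
  by (simp add: dterm_def bounded_cm_0)

lemma dterm_1: "bounded_cm f \<Longrightarrow> dterm f s 1 = 1"
  by (simp add: dterm_def bounded_cm_1 bounded_cm_1[simplified])

lemma dterm_mult: "bounded_cm f \<Longrightarrow> dterm f s (m * n) = dterm f s m * dterm f s n"
  by (cases "m = 0"; cases "n = 0")
     (auto simp: dterm_def bounded_cm_0 bounded_cm_mult ln_mult distrib_left exp_add[symmetric] algebra_simps
           simp flip: exp_add)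

lemma norm_dterm_le:
  assumes "bounded_cm f"
  shows "norm (dterm f s n) \<le> real n powr (- Re s)"
proof (cases "n = 0")
  case False
  have "norm (f n) * exp (- Re s * ln (real n)) \<le> 1 * exp (- Re s * ln (real n))"
    using assms by (intro mult_right_mono bounded_cm_norm) auto
  thus ?thesis using False by (simp add: norm_dterm powr_def)
qed (simp add: dterm_0[OF assms])

lemma summable_norm_dterm:
  assumes "bounded_cm f" "Re s > 1"
  shows "summable (\<lambda>n. norm (dterm f s n))"
  by (rule summable_comparison_test'[where N = 0 and g = "\<lambda>n. real n powr (- Re s)"])
     (use assms in \<open>auto simp: summable_real_powr_iff norm_dterm_le\<close>)

lemma infsum_eq_suminf:
  fixes f :: "nat \<Rightarrow> 'a::banach"
  assumes "summable (\<lambda>n. norm (f n))"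
  shows "infsum f UNIV = suminf f"
  using norm_summable_imp_has_sum[OF assms summable_sums[OF summable_norm_cancel[OF assms]]]
  by (rule infsumI)

lemma dterm_abs_summable_on:
  assumes "bounded_cm f" "Re s > 1"
  shows "(\<lambda>n. norm (dterm f s n)) summable_on A"
proof -
  have "(\<lambda>n. norm (dterm f s n)) summable_on UNIV"
    using summable_norm_dterm[OF assms] by (intro norm_summable_imp_summable_on) auto
  thus ?thesis by (rule summable_on_subset_banach) auto
qed

text \<open>Euler's sieve, one prime at a time. If X is the sum over the integers free of P and Y
  its part prime to p, complete multiplicativity gives X = Y + f p p^(-s) X, so the factor 1 - f p
  p^(-s) removes the multiples of p.\<close>

lemma dirichlet_times_euler_factors:
  assumes f: "bounded_cm f" and s: "Re s > 1" and P: "finite P" "\<And>p. p \<in> P \<Longrightarrow> prime p"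
  shows "dirichlet f s * (\<Prod>p\<in>P. 1 - dterm f s p) = infsum (dterm f s) {n. \<forall>p\<in>P. \<not> p dvd n}"
  using P
proof (induction P rule: finite_induct)
  case empty
  show ?case using infsum_eq_suminf[OF summable_norm_dterm[OF f s]] by (simp add: dirichlet_eq_dterm)
next
  case (insert p P)
  define A where "A = {n. \<forall>q\<in>P. \<not> q dvd n}"
  have p: "prime p" using insert by simp
  have summ: "dterm f s summable_on B" for B
    by (rule abs_summable_summable[OF dterm_abs_summable_on[OF f s]])
  have "infsum (dterm f s) A = infsum (dterm f s) ({n\<in>A. \<not> p dvd n} \<union> {n\<in>A. p dvd n})"
    by (rule arg_cong[where f = "infsum _"]) auto
  also have "\<dots> = infsum (dterm f s) {n\<in>A. \<not> p dvd n} + infsum (dterm f s) {n\<in>A. p dvd n}"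
    by (rule infsum_Un_disjoint) (auto intro: summ)
  also have "infsum (dterm f s) {n\<in>A. p dvd n} = infsum (\<lambda>n. dterm f s p * dterm f s n) A"
  proof (rule infsum_reindex_bij_witness[of _ "\<lambda>n. p * n" "\<lambda>n. n div p"])
    fix n assume "n \<in> A"
    moreover have "\<not> q dvd p" if "q \<in> P" for q
      using primes_dvd_imp_eq[of q p] that insert.hyps insert.prems p by auto
    ultimately show "p * n \<in> {n\<in>A. p dvd n}"
      using insert.prems by (auto simp: A_def prime_dvd_mult_iff)
  next
    fix n assume n: "n \<in> {n\<in>A. p dvd n}"
    then obtain k where k: "n = p * k" by (auto elim: dvdE)
    thus "n div p \<in> A" using n p by (auto simp: A_def prime_gt_0_nat)
    show "dterm f s p * dterm f s (n div p) = dterm f s n"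
      using k p by (simp add: dterm_mult[OF f] prime_gt_0_nat)
  qed (use p in \<open>auto simp: prime_gt_0_nat\<close>)
  also have "\<dots> = dterm f s p * infsum (dterm f s) A" by (rule infsum_cmult_right) (auto intro: summ)
  finally have *: "infsum (dterm f s) A =
      infsum (dterm f s) {n\<in>A. \<not> p dvd n} + dterm f s p * infsum (dterm f s) A" .
  have "y = x * (1 - d)" if "x = y + d * x" for x y d :: complex
  proof -
    have "y = x - d * x" using that by (rule eq_diff_eq[THEN iffD2, OF sym])
    thus ?thesis by (simp add: right_diff_distrib mult.commute)
  qed
  from this[OF *] have "infsum (dterm f s) {n\<in>A. \<not> p dvd n} = infsum (dterm f s) A * (1 - dterm f s p)" .
  moreover have "{n. \<forall>q\<in>insert p P. \<not> q dvd n} = {n\<in>A. \<not> p dvd n}" by (auto simp: A_def)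
  ultimately show ?case using insert by (simp add: A_def mult_ac)
qed

text \<open>Surviving positive integers other than 1 exceed N, so the error is a tail of the
  absolutely convergent series. The product formula has the form "series times finite product tends
  to 1" that \<open>limit_comparison\<close> takes.\<close>

lemma euler_product_tendsto:
  assumes f: "bounded_cm f" and s: "Re s > 1"
  shows "(\<lambda>N. dirichlet f s * (\<Prod>p | prime p \<and> p \<le> N. 1 - dterm f s p)) \<longlonglongrightarrow> 1"
proof -
  define T where "T = (\<lambda>N. \<Sum>n. norm (dterm f s (n + N)))"
  note sm = summable_norm_dterm[OF f s]
  have bound: "norm (dirichlet f s * (\<Prod>p | prime p \<and> p \<le> N. 1 - dterm f s p) - 1) \<le> T (Suc N)" for N
  proof -
    define A where "A = {n. \<forall>p\<in>{p. prime p \<and> p \<le> N}. \<not> p dvd n}"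
    have fin: "finite {p. prime p \<and> p \<le> N}" by (rule finite_subset[of _ "{..N}"]) auto
    have A1: "1 \<in> A" by (auto simp: A_def)
    have A2: "n > N" if "n \<in> A - {0,1}" for n
    proof (rule ccontr)
      assume "\<not> n > N"
      have "n \<noteq> 1" using that by simp
      then obtain p where "prime p" "p dvd n" using prime_factor_nat by blast
      moreover have "p \<le> n" using \<open>p dvd n\<close> that by (intro dvd_imp_le) auto
      ultimately show False using that \<open>\<not> n > N\<close> by (auto simp: A_def)
    qed
    have summ: "dterm f s summable_on B" for B
      by (rule abs_summable_summable[OF dterm_abs_summable_on[OF f s]])
    have "infsum (dterm f s) A = infsum (dterm f s) ({1} \<union> (A - {1}))"
      using A1 by (intro arg_cong[where f = "infsum _"]) auto
    also have "\<dots> = infsum (dterm f s) {1} + infsum (dterm f s) (A - {1})"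
      by (rule infsum_Un_disjoint) (auto intro: summ)
    also have "infsum (dterm f s) (A - {1}) = infsum (dterm f s) (A - {0,1})"
      by (rule infsum_cong_neutral) (auto simp: dterm_0[OF f])
    finally have "infsum (dterm f s) A - 1 = infsum (dterm f s) (A - {0,1})"
      by (simp add: dterm_1[OF f, simplified])
    also have "norm \<dots> \<le> infsum (\<lambda>n. norm (dterm f s n)) (A - {0,1})"
      by (rule norm_infsum_bound[OF dterm_abs_summable_on[OF f s]])
    also have "\<dots> \<le> infsum (\<lambda>n. norm (dterm f s n)) {N<..}"
      using A2 by (intro infsum_mono_neutral dterm_abs_summable_on[OF f s]) auto
    also have "\<dots> = infsum (\<lambda>n. norm (dterm f s (n + Suc N))) UNIV"
      by (rule infsum_reindex_bij_witness[of _ "\<lambda>n. n + Suc N" "\<lambda>n. n - Suc N"]) auto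
    also have "\<dots> = T (Suc N)"
      unfolding T_def using summable_ignore_initial_segment[OF sm, of "Suc N"]
      by (intro infsum_eq_suminf) (simp only: real_norm_def abs_norm_cancel)
    finally show ?thesis
      using dirichlet_times_euler_factors[OF f s fin] by (simp add: A_def)
  qed
  have "T \<longlonglongrightarrow> 0" unfolding T_def by (rule suminf_exist_split2[OF sm])
  hence "(\<lambda>N. T (Suc N)) \<longlonglongrightarrow> 0" by (rule LIMSEQ_Suc)
  hence "(\<lambda>N. dirichlet f s * (\<Prod>p | prime p \<and> p \<le> N. 1 - dterm f s p) - 1) \<longlonglongrightarrow> 0"
    by (rule Lim_null_comparison[rotated]) (use bound in auto)
  thus ?thesis by (simp add: LIM_zero_iff)
qed

text \<open>c and d are the reciprocals of the limits of A and B, so an inequality between finite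
  products is reversed for the series: c d B \<le> d c A, and the two sides tend to c and d.\<close>

lemma limit_comparison:
  fixes A B :: "nat \<Rightarrow> real"
  assumes "(\<lambda>N. c * A N) \<longlonglongrightarrow> 1" "(\<lambda>N. d * B N) \<longlonglongrightarrow> 1" "\<And>N. B N \<le> A N" "c \<ge> 0" "d \<ge> 0"
  shows "c \<le> d"
proof -
  have "(\<lambda>N. c * (d * B N)) \<longlonglongrightarrow> c * 1" by (intro tendsto_intros assms)
  moreover have "(\<lambda>N. d * (c * A N)) \<longlonglongrightarrow> d * 1" by (intro tendsto_intros assms)
  moreover have "c * (d * B N) \<le> d * (c * A N)" for N
    using mult_left_mono[OF assms(3)[of N], of "c * d"] assms by (simp add: mult_ac)
  ultimately have "c * 1 \<le> d * 1" by (intro LIMSEQ_le) auto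
  thus ?thesis by simp
qed

section \<open>Comparison of Euler factors\<close>

lemma norm_one_minus_pos: "norm (u :: complex) < 1 \<Longrightarrow> norm (1 - u) > 0"
  by (cases "u = 1") auto

lemma norm_one_minus_of_real: "x \<le> 1 \<Longrightarrow> norm (1 - complex_of_real x) = 1 - x"
  using norm_of_real[of "1 - x", where ?'a = complex] by simp

text \<open>Real part of the logarithmic series; its term k = 0 is 0 through division by
  zero.\<close>

lemma sums_ln_norm_one_minus:
  fixes u :: complex
  assumes "norm u < 1"
  shows "(\<lambda>k. - (Re (u ^ k) / real k)) sums ln (norm (1 - u))"
proof -
  have "u \<noteq> 1" using assms by auto
  have eq: "(-1) ^ Suc k / of_nat k * (-u) ^ k = - (u ^ k / of_nat k)" for k
    by (simp add: uminus_power_if)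
  have "(\<lambda>k. (-1) ^ Suc k / of_nat k * (-u) ^ k) sums ln (1 + (-u))"
    using assms by (intro Ln_series) auto
  hence "(\<lambda>k. - (u ^ k / of_nat k)) sums ln (1 - u)" unfolding eq by simp
  from sums_Re[OF this] show ?thesis
    using \<open>u \<noteq> 1\<close> by (simp add: Re_divide_of_nat)
qed

text \<open>After taking logarithms and expanding, the inequality holds coefficient by coefficient:
  the k-th one is \<open>pt\<close> for z^k and w^k, multiplied by q^k / k.\<close>

lemma euler_factor_triangle:
  fixes z w :: complex
  assumes z: "norm z \<le> 1" and w: "norm w \<le> 1" and q: "0 \<le> q" "q < 1"
  shows "(1 - q) ^ 3 * norm (1 - z * w * of_real q) \<le>
         norm (1 - z * of_real q) ^ 2 * norm (1 - w * of_real q) ^ 2"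
proof -
  have nz: "norm (z * of_real q) < 1" "norm (w * of_real q) < 1" "norm (z * w * of_real q) < 1" "norm (complex_of_real q) < 1"
    using z w q mult_le_one[of "norm z" "norm w"] mult_right_mono[of "norm z" 1 q] mult_right_mono[of "norm w" 1 q]
      mult_right_mono[of "norm z * norm w" 1 q]
    by (auto simp: norm_mult)
  \<comment> \<open>Bounding Im x Im y by the mean of the squares, and these by 1 - (Re x)^2 and 1 -
    (Re y)^2, shows that twice the difference of the sides is at least (Re x + Re y - 2)^2.\<close>
  have pt: "2 * Re x + 2 * Re y \<le> 3 + Re (x * y)" if "norm x \<le> 1" "norm y \<le> 1" for x y
  proof -
    have "(Re x)^2 + (Im x)^2 \<le> 1" "(Re y)^2 + (Im y)^2 \<le> 1"
      using that power_mono[of "norm x" 1 2] power_mono[of "norm y" 1 2] by (auto simp: cmod_power2)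
    moreover have "2 * (Im x * Im y) \<le> (Im x)^2 + (Im y)^2" using sum_squares_bound[of "Im x" "Im y"] by simp
    moreover have "(Re x + Re y - 2)^2 \<ge> 0" by simp
    ultimately show ?thesis by (simp add: power2_eq_square algebra_simps)
  qed
  have "3 * ln (norm (1 - complex_of_real q)) + ln (norm (1 - z * w * of_real q)) \<le>
        2 * ln (norm (1 - z * of_real q)) + 2 * ln (norm (1 - w * of_real q))"
  proof (rule sums_le)
    show "(\<lambda>k. 3 * - (Re (of_real q ^ k) / real k) + - (Re ((z * w * of_real q) ^ k) / real k)) sums
             (3 * ln (norm (1 - complex_of_real q)) + ln (norm (1 - z * w * of_real q)))"
      by (intro sums_add sums_mult sums_ln_norm_one_minus nz)
    show "(\<lambda>k. 2 * - (Re ((z * of_real q) ^ k) / real k) + 2 * - (Re ((w * of_real q) ^ k) / real k)) sums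
             (2 * ln (norm (1 - z * of_real q)) + 2 * ln (norm (1 - w * of_real q)))"
      by (intro sums_add sums_mult sums_ln_norm_one_minus nz)
    fix k :: nat
    define A B C where "A = Re (z ^ k)" and "B = Re (w ^ k)" and "C = Re ((z * w) ^ k)"
    have "2 * A + 2 * B \<le> 3 + C"
      unfolding A_def B_def C_def power_mult_distrib using z w
      by (intro pt) (auto simp: norm_power power_le_one)
    from mult_right_mono[OF this, of "q ^ k / k"]
    have "(2 * A + 2 * B) * (q ^ k / k) \<le> (3 + C) * (q ^ k / k)"
      using q by simp
    moreover have e: "Re ((x * of_real q) ^ k) = Re (x ^ k) * q ^ k" for x
      by (simp add: power_mult_distrib flip: of_real_power)
    moreover have e': "Re (complex_of_real q ^ k) = q ^ k" by (simp flip: of_real_power)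
    ultimately show "3 * - (Re (of_real q ^ k) / real k) + - (Re ((z * w * of_real q) ^ k) / real k) \<le>
      2 * - (Re ((z * of_real q) ^ k) / real k) + 2 * - (Re ((w * of_real q) ^ k) / real k)"
      unfolding e e' A_def [symmetric] B_def [symmetric] C_def [symmetric]
      by (simp add: algebra_simps add_divide_distrib)
  qed
  moreover have pos: "norm (1 - z * of_real q) > 0" "norm (1 - w * of_real q) > 0"
       "norm (1 - z * w * of_real q) > 0" "norm (1 - complex_of_real q) > 0"
    using norm_one_minus_pos nz by auto
  ultimately have "ln (norm (1 - complex_of_real q) ^ 3 * norm (1 - z * w * of_real q)) \<le>
        ln (norm (1 - z * of_real q) ^ 2 * norm (1 - w * of_real q) ^ 2)"
    by (simp add: ln_mult ln_realpow)
  hence "norm (1 - complex_of_real q) ^ 3 * norm (1 - z * w * of_real q) \<le>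
        norm (1 - z * of_real q) ^ 2 * norm (1 - w * of_real q) ^ 2"
    using pos by (subst (asm) ln_le_cancel_iff) auto
  thus ?thesis using q by (simp add: norm_one_minus_of_real)
qed

text \<open>The difference of the logarithmic series has the coefficients (r^k - q^k) (1 - Re (z^k))
  / k, all non-negative. With r = p^(-\<tau>) and q = p^(-\<sigma>) this says that the local factor
  of |F / \<zeta>| does not decrease with the abscissa.\<close>

lemma euler_factor_mono:
  fixes z :: complex
  assumes z: "norm z \<le> 1" and q: "0 \<le> q" "q \<le> r" "r < 1"
  shows "(1 - r) * norm (1 - z * of_real q) \<le> (1 - q) * norm (1 - z * of_real r)"
proof -
  have nz: "norm (z * of_real q) < 1" "norm (z * of_real r) < 1" "norm (complex_of_real q) < 1" "norm (complex_of_real r) < 1"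
    using z q mult_right_mono[of "norm z" 1 q] mult_right_mono[of "norm z" 1 r]
    by (auto simp: norm_mult)
  have "ln (norm (1 - complex_of_real r)) + ln (norm (1 - z * of_real q)) \<le>
        ln (norm (1 - complex_of_real q)) + ln (norm (1 - z * of_real r))"
  proof (rule sums_le)
    show "(\<lambda>k. - (Re (of_real r ^ k) / real k) + - (Re ((z * of_real q) ^ k) / real k)) sums
             (ln (norm (1 - complex_of_real r)) + ln (norm (1 - z * of_real q)))"
      by (intro sums_add sums_ln_norm_one_minus nz)
    show "(\<lambda>k. - (Re (of_real q ^ k) / real k) + - (Re ((z * of_real r) ^ k) / real k)) sums
             (ln (norm (1 - complex_of_real q)) + ln (norm (1 - z * of_real r)))"
      by (intro sums_add sums_ln_norm_one_minus nz)
    fix k :: nat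
    have "Re (z ^ k) \<le> norm (z ^ k)" by (rule complex_Re_le_cmod)
    also have "\<dots> \<le> 1" using z by (simp add: norm_power power_le_one)
    finally have "(r ^ k - q ^ k) * (1 - Re (z ^ k)) \<ge> 0"
      using q by (intro mult_nonneg_nonneg) (auto intro!: power_mono)
    hence "(r ^ k - q ^ k) * (1 - Re (z ^ k)) / k \<ge> 0" by simp
    moreover have "Re ((z * of_real x) ^ k) = Re (z ^ k) * x ^ k" for x
      by (simp add: power_mult_distrib flip: of_real_power)
    moreover have "Re (complex_of_real x ^ k) = x ^ k" for x by (simp flip: of_real_power)
    ultimately show "- (Re (of_real r ^ k) / real k) + - (Re ((z * of_real q) ^ k) / real k) \<le>
                     - (Re (of_real q ^ k) / real k) + - (Re ((z * of_real r) ^ k) / real k)"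
      by (simp add: algebra_simps add_divide_distrib diff_divide_distrib)
  qed
  moreover have pos: "norm (1 - z * of_real q) > 0" "norm (1 - z * of_real r) > 0"
       "norm (1 - complex_of_real r) > 0" "norm (1 - complex_of_real q) > 0"
    using norm_one_minus_pos nz by auto
  ultimately have "ln (norm (1 - complex_of_real r) * norm (1 - z * of_real q)) \<le>
        ln (norm (1 - complex_of_real q) * norm (1 - z * of_real r))"
    by (simp add: ln_mult)
  hence "norm (1 - complex_of_real r) * norm (1 - z * of_real q) \<le>
        norm (1 - complex_of_real q) * norm (1 - z * of_real r)"
    using pos by (subst (asm) ln_le_cancel_iff) auto
  thus ?thesis using q by (simp add: norm_one_minus_of_real)
qed

text \<open>Its Dirichlet series is the Riemann zeta function.\<close>

definition one_fn :: "nat \<Rightarrow> complex" where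
  "one_fn n = (if n = 0 then 0 else 1)"

lemma bounded_cm_one_fn: "bounded_cm one_fn"
  by (auto simp: bounded_cm_def completely_multiplicative_def one_fn_def)

lemma bounded_cm_times:
  assumes "bounded_cm f" "bounded_cm g"
  shows "bounded_cm (\<lambda>n. f n * g n)"
  using assms mult_le_one[of "norm (f n)" "norm (g n)" for n]
  by (auto simp: bounded_cm_def completely_multiplicative_def norm_mult mult_ac)

text \<open>The number z carries f p and the ordinate, so one z serves all abscissas, as the
  comparisons of Euler factors require.\<close>

lemma dterm_polar:
  assumes "bounded_cm f"
  shows "\<exists>z. norm z \<le> 1 \<and> (\<forall>\<sigma>. dterm f (Complex \<sigma> t) p = z * of_real (exp (-\<sigma> * ln (real p))))"
proof (intro exI conjI allI)
  show "norm (f p * cis (- t * ln (real p))) \<le> 1"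
    using bounded_cm_norm[OF assms] by (simp add: norm_mult)
  show "dterm f (Complex \<sigma> t) p = f p * cis (- t * ln (real p)) * of_real (exp (-\<sigma> * ln (real p)))" for \<sigma>
    by (simp add: dterm_def exp_eq_polar mult_ac)
qed

lemma exp_neg_ln_bounds:
  assumes "\<sigma> > 0" "p \<ge> 2"
  shows "exp (-\<sigma> * ln (real p)) \<ge> 0" "exp (-\<sigma> * ln (real p)) < 1"
  using assms by auto

lemma norm_euler_product_tendsto:
  assumes "bounded_cm f" "Re s > 1"
  shows "(\<lambda>N. norm (dirichlet f s) * (\<Prod>p | prime p \<and> p \<le> N. norm (1 - dterm f s p))) \<longlonglongrightarrow> 1"
  using tendsto_norm[OF euler_product_tendsto[OF assms]] by (simp add: norm_mult prod_norm)

text \<open>Prime by prime this is \<open>euler_factor_triangle\<close> with q = p^(-\<sigma>), z =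
  f p p^(-i t) and w = g p p^(-i u), and z w carries the ordinate t + u. The inequality turns round
  in the limit because Euler factors are reciprocals.\<close>

lemma dirichlet_triangle:
  assumes f: "bounded_cm f" and g: "bounded_cm g" and \<sigma>: "\<sigma> > 1"
  shows "norm (dirichlet f (Complex \<sigma> t)) ^ 2 * norm (dirichlet g (Complex \<sigma> u)) ^ 2 \<le>
         norm (dirichlet one_fn (of_real \<sigma>)) ^ 3 * norm (dirichlet (\<lambda>n. f n * g n) (Complex \<sigma> (t + u)))"
proof -
  let ?F = "\<lambda>N f s. \<Prod>p | prime p \<and> p \<le> N. norm (1 - dterm f s p)"
  define h where "h = (\<lambda>n. f n * g n)"
  have h: "bounded_cm h" unfolding h_def by (rule bounded_cm_times[OF f g])
  show ?thesis unfolding h_def [symmetric]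
  proof (rule limit_comparison)
    have "(\<lambda>N. (norm (dirichlet f (Complex \<sigma> t)) * ?F N f (Complex \<sigma> t)) ^ 2 *
                  (norm (dirichlet g (Complex \<sigma> u)) * ?F N g (Complex \<sigma> u)) ^ 2) \<longlonglongrightarrow> 1 ^ 2 * 1 ^ 2"
      using \<sigma> by (intro tendsto_mult tendsto_power norm_euler_product_tendsto f g) auto
    thus "(\<lambda>N. norm (dirichlet f (Complex \<sigma> t)) ^ 2 * norm (dirichlet g (Complex \<sigma> u)) ^ 2 *
             (?F N f (Complex \<sigma> t) ^ 2 * ?F N g (Complex \<sigma> u) ^ 2)) \<longlonglongrightarrow> 1"
      by (simp add: power_mult_distrib mult_ac)
    have "(\<lambda>N. (norm (dirichlet one_fn (of_real \<sigma>)) * ?F N one_fn (of_real \<sigma>)) ^ 3 *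
                  (norm (dirichlet h (Complex \<sigma> (t + u))) * ?F N h (Complex \<sigma> (t + u)))) \<longlonglongrightarrow> 1 ^ 3 * 1"
      using \<sigma> by (intro tendsto_mult tendsto_power norm_euler_product_tendsto h bounded_cm_one_fn) auto
    thus "(\<lambda>N. norm (dirichlet one_fn (of_real \<sigma>)) ^ 3 * norm (dirichlet h (Complex \<sigma> (t + u))) *
             (?F N one_fn (of_real \<sigma>) ^ 3 * ?F N h (Complex \<sigma> (t + u)))) \<longlonglongrightarrow> 1"
      by (simp add: power_mult_distrib mult_ac)
    show "?F N one_fn (of_real \<sigma>) ^ 3 * ?F N h (Complex \<sigma> (t + u)) \<le>
          ?F N f (Complex \<sigma> t) ^ 2 * ?F N g (Complex \<sigma> u) ^ 2" for N
      unfolding prod_power_distrib prod.distrib [symmetric]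
    proof (rule prod_mono, rule conjI)
      fix p assume "p \<in> {p. prime p \<and> p \<le> N}"
      hence p: "p \<ge> 2" by (auto dest: prime_ge_2_nat)
      obtain z where z: "norm z \<le> 1" "\<And>\<sigma>. dterm f (Complex \<sigma> t) p = z * of_real (exp (-\<sigma> * ln (real p)))"
        using dterm_polar[OF f, of t p] by blast
      obtain w where w: "norm w \<le> 1" "\<And>\<sigma>. dterm g (Complex \<sigma> u) p = w * of_real (exp (-\<sigma> * ln (real p)))"
        using dterm_polar[OF g, of u p] by blast
      define q where "q = exp (-\<sigma> * ln (real p))"
      have q: "0 \<le> q" "q < 1" using exp_neg_ln_bounds[of \<sigma> p] p \<sigma> by (auto simp: q_def)
      have 1: "dterm one_fn (of_real \<sigma>) p = of_real q"
        using p by (simp add: dterm_def one_fn_def q_def exp_of_real[symmetric] del: exp_of_real)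
      \<comment> \<open>The product of the two terms contains q twice, the term of h at the same
        abscissa only once; the extra q is cancelled afterwards.\<close>
      have "dterm h (Complex \<sigma> (t + u)) p * of_real q = dterm f (Complex \<sigma> t) p * dterm g (Complex \<sigma> u) p"
      proof -
        define l where "l = complex_of_real (ln (real p))"
        have "- Complex \<sigma> (t + u) * l + - of_real \<sigma> * l = - Complex \<sigma> t * l + - Complex \<sigma> u * l"
          by (simp add: complex_eq_iff l_def algebra_simps)
        hence "exp (- Complex \<sigma> (t + u) * l) * exp (- of_real \<sigma> * l) =
               exp (- Complex \<sigma> t * l) * exp (- Complex \<sigma> u * l)"
          by (simp only: exp_add [symmetric])
        moreover have "of_real q = exp (- of_real \<sigma> * l)" by (simp add: q_def l_def flip: exp_of_real)
        ultimately show ?thesis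
          unfolding dterm_def h_def l_def [symmetric] by (simp only: mult_ac)
      qed
      also have "\<dots> = z * w * of_real q * of_real q" by (simp add: z w q_def)
      finally have 2: "dterm h (Complex \<sigma> (t + u)) p = z * w * of_real q"
        by (simp add: q_def)
      show "norm (1 - dterm one_fn (of_real \<sigma>) p) ^ 3 * norm (1 - dterm h (Complex \<sigma> (t + u)) p) \<le>
            norm (1 - dterm f (Complex \<sigma> t) p) ^ 2 * norm (1 - dterm g (Complex \<sigma> u) p) ^ 2"
        unfolding 1 2 z w q_def[symmetric] using euler_factor_triangle[OF z(1) w(1) q] q
        by (simp add: norm_one_minus_of_real)
    qed simp
  qed auto
qed

text \<open>Prime by prime this is \<open>euler_factor_mono\<close>: on a horizontal line |F /
  \<zeta>| does not decrease to the right. A lower bound for F thus moves away from Re s = 1 with no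
  greater relative loss than that of zeta.\<close>

lemma dirichlet_zeta_ratio_mono:
  assumes f: "bounded_cm f" and \<tau>: "1 < \<tau>" "\<tau> \<le> \<sigma>"
  shows "norm (dirichlet f (Complex \<tau> t)) * norm (dirichlet one_fn (of_real \<sigma>)) \<le>
         norm (dirichlet f (Complex \<sigma> t)) * norm (dirichlet one_fn (of_real \<tau>))"
proof -
  let ?F = "\<lambda>N f s. \<Prod>p | prime p \<and> p \<le> N. norm (1 - dterm f s p)"
  show ?thesis
  proof (rule limit_comparison)
    have lim: "(\<lambda>N. (norm (dirichlet f (Complex a t)) * ?F N f (Complex a t)) *
                  (norm (dirichlet one_fn (of_real b)) * ?F N one_fn (of_real b))) \<longlonglongrightarrow> 1 * 1"
      if "a > 1" "b > 1" for a b
      using that by (intro tendsto_mult norm_euler_product_tendsto f bounded_cm_one_fn) auto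
    show "(\<lambda>N. norm (dirichlet f (Complex \<tau> t)) * norm (dirichlet one_fn (of_real \<sigma>)) *
             (?F N f (Complex \<tau> t) * ?F N one_fn (of_real \<sigma>))) \<longlonglongrightarrow> 1"
      using lim[of \<tau> \<sigma>] \<tau> by (simp add: mult_ac)
    show "(\<lambda>N. norm (dirichlet f (Complex \<sigma> t)) * norm (dirichlet one_fn (of_real \<tau>)) *
             (?F N f (Complex \<sigma> t) * ?F N one_fn (of_real \<tau>))) \<longlonglongrightarrow> 1"
      using lim[of \<sigma> \<tau>] \<tau> by (simp add: mult_ac)
    show "?F N f (Complex \<sigma> t) * ?F N one_fn (of_real \<tau>) \<le> ?F N f (Complex \<tau> t) * ?F N one_fn (of_real \<sigma>)" for N
      unfolding prod.distrib [symmetric]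
    proof (rule prod_mono, rule conjI)
      fix p assume "p \<in> {p. prime p \<and> p \<le> N}"
      hence p: "p \<ge> 2" by (auto dest: prime_ge_2_nat)
      obtain z where z: "norm z \<le> 1" "\<And>\<sigma>. dterm f (Complex \<sigma> t) p = z * of_real (exp (-\<sigma> * ln (real p)))"
        using dterm_polar[OF f, of t p] by blast
      define q where "q = (\<lambda>\<sigma>. exp (-\<sigma> * ln (real p)))"
      have q: "0 \<le> q \<sigma>" "q \<sigma> \<le> q \<tau>" "q \<tau> < 1"
        using exp_neg_ln_bounds[of \<tau> p] p \<tau> by (auto simp: q_def)
      have 1: "dterm one_fn (of_real a) p = of_real (q a)" for a
        using p by (simp add: dterm_def one_fn_def q_def exp_of_real[symmetric] del: exp_of_real)
      have "norm (1 - dterm f (Complex \<sigma> t) p) * norm (1 - dterm one_fn (of_real \<tau>) p) =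
            (1 - q \<tau>) * norm (1 - z * of_real (q \<sigma>))"
        unfolding 1 z q_def[symmetric] using q by (simp add: norm_one_minus_of_real q_def)
      also have "\<dots> \<le> (1 - q \<sigma>) * norm (1 - z * of_real (q \<tau>))"
        by (rule euler_factor_mono[OF z(1) q])
      also have "\<dots> = norm (1 - dterm f (Complex \<tau> t) p) * norm (1 - dterm one_fn (of_real \<sigma>) p)"
        unfolding 1 z q_def[symmetric] using q by (simp add: norm_one_minus_of_real q_def)
      finally show "norm (1 - dterm f (Complex \<sigma> t) p) * norm (1 - dterm one_fn (of_real \<tau>) p) \<le>
                    norm (1 - dterm f (Complex \<tau> t) p) * norm (1 - dterm one_fn (of_real \<sigma>) p)" .
    qed simp
  qed auto
qed

section \<open>Bounds from the integral representation\<close>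

lemma
  assumes f: "bounded_cm f" and s: "Re s > 1"
  shows integrable_bounded_cm_psum_exp: "integrable lborel (\<lambda>v. psum f (exp v) * exp (-s * of_real v))"
    and dirichlet_eq_integral: "dirichlet f s = s * (\<integral>v. psum f (exp v) * exp (-s * of_real v) \<partial>lborel)"
proof -
  have sm: "summable (\<lambda>n. norm (f n) * exp (- Re s * ln (real n)))"
    using summable_norm_dterm[OF f s] by (simp add: norm_dterm)
  have "s \<noteq> 0" using s by auto
  show "integrable lborel (\<lambda>v. psum f (exp v) * exp (-s * of_real v))"
    using s by (intro integrable_psum_exp bounded_cm_0 f sm) auto
  show "dirichlet f s = s * (\<integral>v. psum f (exp v) * exp (-s * of_real v) \<partial>lborel)"
    using integral_psum_exp[OF bounded_cm_0[OF f] _ sm] s \<open>s \<noteq> 0\<close> by simp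
qed

lemma psum_exp_neg: "v < 0 \<Longrightarrow> psum f (exp v) = 0"
  by (simp add: psum_altdef nats_le_empty)

text \<open>In \<open>dirichlet_eq_integral\<close> the integrand is at most \<xi> exp (-\<delta> v)
  beyond Y, and for 0 \<le> v \<le> Y the trivial bound for the partial sums makes it at most
  1.\<close>

lemma norm_dirichlet_le:
  assumes f: "bounded_cm f" and \<delta>: "\<delta> > 0" "Re s = 1 + \<delta>" and Y: "Y \<ge> 0" "\<xi> \<ge> 0"
  assumes small: "\<And>x. x \<ge> exp Y \<Longrightarrow> norm (psum f x) \<le> \<xi> * x"
  shows "norm (dirichlet f s) \<le> norm s * (Y + \<xi> / \<delta>)"
proof -
  have s: "Re s > 1" using \<delta> by simp
  have i1: "integrable lborel (\<lambda>v. indicator {0..Y} v :: real)" using Y by simp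
  have i2: "integrable lborel (\<lambda>v. \<xi> * (indicator {0..} v *\<^sub>R exp (-\<delta> * v)))"
    using set_integrable_exp_tail[OF \<delta>(1), of 0] by (simp add: set_integrable_def)
  have "norm (\<integral>v. psum f (exp v) * exp (-s * of_real v) \<partial>lborel) \<le>
        (\<integral>v. indicator {0..Y} v + \<xi> * (indicator {0..} v *\<^sub>R exp (-\<delta> * v)) \<partial>lborel)"
  proof (rule order_trans[OF Bochner_Integration.integral_norm_bound], rule integral_mono)
    show "norm (psum f (exp v) * exp (-s * of_real v)) \<le>
          indicator {0..Y} v + \<xi> * (indicator {0..} v *\<^sub>R exp (-\<delta> * v))" for v
    proof (cases "v < 0")
      case False
      have eq: "exp v * exp (- Re s * v) = exp (-\<delta> * v)"
        using \<delta> by (simp add: algebra_simps flip: exp_add)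
      have "norm (psum f (exp v) * exp (-s * of_real v)) = norm (psum f (exp v)) * exp (- Re s * v)"
        by (simp add: norm_mult)
      also have "\<dots> \<le> (indicator {0..Y} v + \<xi>) * exp v * exp (- Re s * v)"
      proof (intro mult_right_mono)
        show "norm (psum f (exp v)) \<le> (indicator {0..Y} v + \<xi>) * exp v"
        proof (cases "v \<le> Y")
          case True
          have "norm (psum f (exp v)) \<le> exp v" using bounded_cm_norm[OF f] by (intro norm_psum_le') auto
          also have "\<dots> \<le> (1 + \<xi>) * exp v" using Y by simp
          finally show ?thesis using True False by simp
        qed (use small[of "exp v"] in auto)
      qed auto
      also have "\<dots> = (indicator {0..Y} v + \<xi>) * exp (-\<delta> * v)" by (simp only: mult.assoc eq)
      also have "\<dots> \<le> indicator {0..Y} v * 1 + \<xi> * exp (-\<delta> * v)"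
        using False \<delta> Y unfolding distrib_right by (intro add_mono mult_left_mono) auto
      finally show ?thesis using False by simp
    qed (use Y in \<open>auto simp: psum_exp_neg\<close>)
  qed (use i1 i2 integrable_bounded_cm_psum_exp[OF f s] in auto)
  also have "\<dots> = Y + \<xi> / \<delta>"
    using i1 i2 Y set_integral_exp_tail[OF \<delta>(1), of 0]
    by (simp add: set_lebesgue_integral_def)
  finally show ?thesis
    unfolding dirichlet_eq_integral[OF f s] norm_mult by (intro mult_left_mono) auto
qed

lemma zeta_upper:
  assumes "\<delta> > 0"
  shows "norm (dirichlet one_fn (of_real (1 + \<delta>))) \<le> (1 + \<delta>) / \<delta>"
proof -
  have "norm (psum one_fn x) \<le> 1 * x" if "x \<ge> exp 0" for x
    using that bounded_cm_norm[OF bounded_cm_one_fn] order_trans[of 0 1 x] by (simp, intro norm_psum_le') auto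
  hence "norm (dirichlet one_fn (of_real (1 + \<delta>))) \<le> norm (of_real (1 + \<delta>) :: complex) * (0 + 1 / \<delta>)"
    using assms by (intro norm_dirichlet_le bounded_cm_one_fn) auto
  thus ?thesis using assms unfolding norm_of_real by simp
qed

text \<open>There are more than exp v - 1 integers up to exp v, which bounds the transform below by
  1 / \<delta> - 1 / (1 + \<delta>); multiplication by s = 1 + \<delta> turns this into exactly 1 /
  \<delta>.\<close>

lemma zeta_lower:
  assumes "\<delta> > 0"
  shows "norm (dirichlet one_fn (of_real (1 + \<delta>))) \<ge> 1 / \<delta>"
proof -
  define s where "s = complex_of_real (1 + \<delta>)"
  have s: "Re s > 1" "Re s = 1 + \<delta>" using assms by (auto simp: s_def)
  have i1: "integrable lborel (\<lambda>v. indicator {0..} v *\<^sub>R exp (-\<delta> * v))"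
    using set_integrable_exp_tail[OF assms, of 0] by (simp add: set_integrable_def)
  have i2: "integrable lborel (\<lambda>v. indicator {0..} v *\<^sub>R exp (-(1 + \<delta>) * v))"
    using set_integrable_exp_tail[of "1 + \<delta>" 0] assms by (simp add: set_integrable_def)
  note int = integrable_bounded_cm_psum_exp[OF bounded_cm_one_fn s(1)]
  have "1 / \<delta> - 1 / (1 + \<delta>) = (\<integral>v. indicator {0..} v *\<^sub>R exp (-\<delta> * v) - indicator {0..} v *\<^sub>R exp (-(1 + \<delta>) * v) \<partial>lborel)"
    using i1 i2 set_integral_exp_tail[OF assms, of 0] set_integral_exp_tail[of "1 + \<delta>" 0] assms
    by (simp add: set_lebesgue_integral_def)
  also have "\<dots> \<le> (\<integral>v. Re (psum one_fn (exp v) * exp (-s * of_real v)) \<partial>lborel)"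
  proof (rule integral_mono)
    show "indicator {0..} v *\<^sub>R exp (-\<delta> * v) - indicator {0..} v *\<^sub>R exp (-(1 + \<delta>) * v) \<le>
          Re (psum one_fn (exp v) * exp (-s * of_real v))" for v
    proof (cases "v < 0")
      case False
      have "psum one_fn (exp v) = of_real (real (card (nats_le (exp v))))"
        by (simp add: psum_altdef one_fn_def in_nats_le)
      hence eq: "Re (psum one_fn (exp v) * exp (-s * of_real v)) = card (nats_le (exp v)) * exp (-(1 + \<delta>) * v)"
      proof -
        have "-s * of_real v = of_real (-(1 + \<delta>) * v)" by (simp add: s_def)
        hence "exp (-s * of_real v) = of_real (exp (-(1 + \<delta>) * v))" by (simp only: exp_of_real)
        thus ?thesis using \<open>psum one_fn (exp v) = _\<close> by (simp flip: of_real_mult)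
      qed
      have "(exp v - 1) * exp (-(1 + \<delta>) * v) \<le> card (nats_le (exp v)) * exp (-(1 + \<delta>) * v)"
        using card_nats_le_bounds(2)[of "exp v"] by (intro mult_right_mono) auto
      moreover have "exp v * exp (-(1 + \<delta>) * v) = exp (-\<delta> * v)" by (simp add: algebra_simps flip: exp_add)
      ultimately show ?thesis unfolding eq using False by (simp add: left_diff_distrib)
    qed (auto simp: psum_exp_neg)
    show "integrable lborel (\<lambda>v. Re (psum one_fn (exp v) * exp (-s * of_real v)))"
      by (rule integrable_Re[OF int])
  qed (intro Bochner_Integration.integrable_diff i1 i2)
  also have "\<dots> = Re (\<integral>v. psum one_fn (exp v) * exp (-s * of_real v) \<partial>lborel)"
    by (rule integral_Re[OF int])
  also have "\<dots> \<le> norm (\<integral>v. psum one_fn (exp v) * exp (-s * of_real v) \<partial>lborel)"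
    by (rule complex_Re_le_cmod)
  finally have "(1 + \<delta>) * (1 / \<delta> - 1 / (1 + \<delta>)) \<le> norm (dirichlet one_fn s)"
    unfolding dirichlet_eq_integral[OF bounded_cm_one_fn s(1)] norm_mult
    using assms by (simp add: s_def norm_of_real del: of_real_add)
  moreover have "(1 + \<delta>) * (1 / \<delta> - 1 / (1 + \<delta>)) = 1 / \<delta>"
    using assms by (simp add: right_diff_distrib add_divide_distrib)
  ultimately show ?thesis by (simp add: s_def)
qed

section \<open>Mean squares on a vertical line\<close>

lemma ln_le_powr:
  fixes \<epsilon> x :: real
  assumes "\<epsilon> > 0" "x \<ge> 1"
  shows "ln x \<le> (1 / \<epsilon>) * x powr \<epsilon>"
proof -
  have "\<epsilon> * ln x = ln (x powr \<epsilon>)" using assms by (simp add: powr_def)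
  also have "\<dots> \<le> x powr \<epsilon> - 1" using assms by (intro ln_le_minus_one) auto
  finally show ?thesis using assms by (simp add: field_simps)
qed

lemma summable_ln_powr:
  assumes "\<sigma> > 1"
  shows "summable (\<lambda>n. ln (real n) * real n powr (-\<sigma>))"
proof (rule summable_comparison_test'[where N = 0])
  define \<epsilon> where "\<epsilon> = (\<sigma> - 1) / 2"
  have \<epsilon>: "\<epsilon> > 0" using assms by (simp add: \<epsilon>_def)
  show "summable (\<lambda>n. (1 / \<epsilon>) * real n powr (\<epsilon> - \<sigma>))"
    using assms by (intro summable_mult) (simp add: summable_real_powr_iff \<epsilon>_def field_simps)
  fix n :: nat
  show "norm (ln (real n) * real n powr (-\<sigma>)) \<le> (1 / \<epsilon>) * real n powr (\<epsilon> - \<sigma>)"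
  proof (cases "n = 0")
    case False
    have "ln (real n) * real n powr (-\<sigma>) \<le> (1 / \<epsilon>) * real n powr \<epsilon> * real n powr (-\<sigma>)"
      using False \<epsilon> by (intro mult_right_mono ln_le_powr) auto
    thus ?thesis using False by (simp add: mult.assoc flip: powr_add)
  qed simp
qed

lemma norm_dterm_mult_real:
  assumes "bounded_cm f" "n > 0"
  shows "norm (dterm f s n * of_real r) \<le> \<bar>r\<bar> * real n powr (- Re s)"
  using mult_right_mono[OF norm_dterm_le[OF assms(1), of s n], of "\<bar>r\<bar>"] by (simp add: norm_mult mult.commute)

lemma summable_dterm_ln:
  assumes "bounded_cm f" "Re s > 1"
  shows "summable (\<lambda>n. norm (dterm f s n * of_real (ln (real n))))"
proof (rule summable_comparison_test'[OF summable_ln_powr[OF assms(2)], where N = 0])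
  fix n :: nat
  show "norm (norm (dterm f s n * of_real (ln (real n)))) \<le> ln (real n) * real n powr (- Re s)"
    using norm_dterm_mult_real[OF assms(1), of n s "ln (real n)"] by (cases "n = 0") auto
qed

lemma summable_dterm_mangoldt:
  assumes "bounded_cm f" "Re s > 1"
  shows "summable (\<lambda>n. norm (dterm f s n * of_real (mangoldt n)))"
proof (rule summable_comparison_test'[OF summable_ln_powr[OF assms(2)], where N = 0])
  fix n :: nat
  show "norm (norm (dterm f s n * of_real (mangoldt n))) \<le> ln (real n) * real n powr (- Re s)"
  proof (cases "n = 0")
    case False
    have "mangoldt n * real n powr (- Re s) \<le> ln (real n) * real n powr (- Re s)"
      using False by (intro mult_right_mono mangoldt_le) auto
    with norm_dterm_mult_real[OF assms(1), of n s "mangoldt n"] False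
    have "norm (dterm f s n * of_real (mangoldt n)) \<le> ln (real n) * real n powr (- Re s)"
      by (simp only: abs_mangoldt) linarith
    thus ?thesis by (simp del: of_real_mangoldt)
  qed simp
qed

text \<open>The relation F' = F (F' / F) without signs: by complete multiplicativity f ln is the
  convolution of f with f Lambda, and the absolutely convergent double series may be rearranged
  along n = d m.\<close>

lemma dirichlet_mult_mangoldt:
  assumes f: "bounded_cm f" and s: "Re s > 1"
  shows "dirichlet f s * dirichlet (\<lambda>n. f n * of_real (mangoldt n)) s =
         dirichlet (\<lambda>n. f n * of_real (ln (real n))) s"
proof -
  define A where "A = dterm f s"
  define B where "B = (\<lambda>n. A n * of_real (mangoldt n))"
  define x where "x = (\<lambda>(d,m). B d * A m)"
  define g where "g = (\<lambda>(n::nat,d). A n * complex_of_real (mangoldt d))"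
  have A: "summable (\<lambda>n. norm (A n))" and B: "summable (\<lambda>n. norm (B n))"
    unfolding A_def B_def by (intro summable_norm_dterm summable_dterm_mangoldt f s)+
  have A_on: "(\<lambda>n. norm (A n)) summable_on UNIV" and B_on: "(\<lambda>n. norm (B n)) summable_on UNIV"
    using A B by (auto intro!: norm_summable_imp_summable_on)
  have A0: "A 0 = 0" and B0: "B 0 = 0" by (auto simp: A_def B_def dterm_0[OF f])
  have "(\<lambda>p. norm (x p)) summable_on UNIV \<times> UNIV"
  proof (subst Infinite_Sum.abs_summable_on_Sigma_iff, intro conjI ballI)
    show "(\<lambda>y. norm (x (d, y))) summable_on UNIV" for d
      unfolding x_def by (simp add: norm_mult) (intro summable_on_cmult_right A_on)
    have "(\<lambda>d. infsum (\<lambda>m. norm (x (d, m))) UNIV) = (\<lambda>d. norm (B d) * infsum (\<lambda>m. norm (A m)) UNIV)"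
      unfolding x_def by (simp add: norm_mult infsum_cmult_right A_on)
    hence eq: "(\<lambda>d. norm (infsum (\<lambda>m. norm (x (d, m))) UNIV)) =
               (\<lambda>d. norm (B d) * \<bar>infsum (\<lambda>m. norm (A m)) UNIV\<bar>)"
      by (metis abs_mult abs_norm_cancel real_norm_def)
    show "(\<lambda>d. norm (infsum (\<lambda>m. norm (x (d, m))) UNIV)) summable_on UNIV"
      unfolding eq by (intro summable_on_cmult_left B_on)
  qed
  hence x: "x summable_on UNIV \<times> UNIV" by (rule Infinite_Sum.abs_summable_summable)
  \<comment> \<open>Every number divides 0, so the rearrangement takes place on positive indices;
    terms with an index 0 vanish.\<close>
  have x': "x summable_on {0<..} \<times> {0<..}" by (rule summable_on_subset_banach[OF x]) auto
  have bij: "x p = g (fst p * snd p, fst p)" if "p \<in> {0<..} \<times> {0<..}" for p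
    by (auto simp: x_def g_def B_def A_def dterm_mult[OF f] split: prod.splits)
  have g: "g summable_on (SIGMA n:{0<..}. {d. d dvd n})"
    using x'
    by (subst summable_on_reindex_bij_witness[where T = "{0<..} \<times> {0<..}" and j = "\<lambda>(n,d). (d, n div d)"
          and i = "\<lambda>(d,m). (d * m, d)" and h = x])
       (auto simp: x_def g_def B_def A_def dterm_mult[OF f, symmetric] elim!: dvdE)
  have eq: "infsum g (SIGMA n:{0<..}. {d. d dvd n}) = infsum x ({0<..} \<times> {0<..})"
    by (rule infsum_reindex_bij_witness[where j = "\<lambda>(n,d). (d, n div d)" and i = "\<lambda>(d,m). (d * m, d)"])
       (auto simp: x_def g_def B_def A_def dterm_mult[OF f, symmetric] elim!: dvdE)
  have "dirichlet (\<lambda>n. f n * of_real (ln (real n))) s = (\<Sum>n. A n * of_real (ln (real n)))"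
    by (simp add: dirichlet_def A_def dterm_def mult_ac)
  also have "\<dots> = infsum (\<lambda>n. A n * of_real (ln (real n))) UNIV"
    unfolding A_def using infsum_eq_suminf[OF summable_dterm_ln[OF f s]] by simp
  also have "\<dots> = infsum (\<lambda>n. A n * of_real (ln (real n))) {0<..}"
    by (rule infsum_cong_neutral) (auto simp: A0)
  also have "\<dots> = infsum (\<lambda>n. infsum (\<lambda>d. g (n, d)) {d. d dvd n}) {0<..}"
  proof (rule infsum_cong)
    fix n :: nat assume "n \<in> {0<..}"
    hence n: "n > 0" by simp
    have "infsum (\<lambda>d. g (n, d)) {d. d dvd n} = (\<Sum>d | d dvd n. A n * complex_of_real (mangoldt d))"
      using n by (subst infsum_finite) (auto simp: g_def)
    also have "\<dots> = A n * of_real (\<Sum>d | d dvd n. mangoldt d)"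
      unfolding of_real_sum by (rule sum_distrib_left [symmetric])
    also have "(\<Sum>d | d dvd n. mangoldt d :: real) = ln (real n)"
      using mangoldt_sum[of n, where ?'a = real] n by simp
    finally show "A n * of_real (ln (real n)) = infsum (\<lambda>d. g (n, d)) {d. d dvd n}" ..
  qed
  also have "\<dots> = infsum x ({0<..} \<times> {0<..})"
    using infsum_Sigma_banach[OF g] eq by simp
  also have "\<dots> = infsum x (UNIV \<times> UNIV)"
    by (rule infsum_cong_neutral) (auto simp: x_def A0 B0 intro!: Nat.gr0I)
  also have "\<dots> = infsum (\<lambda>d. infsum (\<lambda>m. x (d, m)) UNIV) UNIV"
    by (rule infsum_Sigma_banach [OF x, symmetric])
  also have "\<dots> = infsum (\<lambda>d. B d * infsum A UNIV) UNIV"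
    unfolding x_def using abs_summable_summable[OF A_on] by (simp add: infsum_cmult_right)
  also have "\<dots> = infsum B UNIV * infsum A UNIV"
    using abs_summable_summable[OF B_on] by (intro infsum_cmult_left) auto
  also have "infsum A UNIV = dirichlet f s"
    using infsum_eq_suminf[OF A] by (simp add: A_def dirichlet_eq_dterm)
  also have "infsum B UNIV = dirichlet (\<lambda>n. f n * of_real (mangoldt n)) s"
    using infsum_eq_suminf[OF B] by (simp add: A_def B_def dirichlet_def dterm_def mult_ac)
  finally show ?thesis by (simp add: mult.commute)
qed

text \<open>A bound for - \<zeta>' / \<zeta> at 1 + \<delta>. The series is \<delta> times the
  transform at \<delta> of the partial sums of \<open>mangoldt n / n\<close>, which
  \<open>mertens_mangoldt\<close> bounds by v + 17. This is at most 17 / \<delta> times exp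
  (\<delta> v / 2), and the other half of the decay is left for the integral: \<delta> (17 /
  \<delta>) (2 / \<delta>) = 34 / \<delta>.\<close>

lemma
  assumes \<delta>: "0 < \<delta>" "\<delta> \<le> 1"
  shows summable_mangoldt_exp: "summable (\<lambda>n. mangoldt n * exp (- (1 + \<delta>) * ln (real n)))"
    and suminf_mangoldt_exp_le: "(\<Sum>n. mangoldt n * exp (- (1 + \<delta>) * ln (real n))) \<le> 34 / \<delta>"
proof -
  define a where "a = (\<lambda>n. complex_of_real (mangoldt n / real n))"
  have eq: "mangoldt n * exp (- (1 + \<delta>) * ln (real n)) = mangoldt n / real n * exp (- \<delta> * ln (real n))" for n
  proof (cases "n = 0")
    case False
    have "- (1 + \<delta>) * ln (real n) = - ln (real n) + - \<delta> * ln (real n)" by (simp add: algebra_simps)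
    hence "exp (- (1 + \<delta>) * ln (real n)) = exp (- ln (real n)) * exp (- \<delta> * ln (real n))"
      by (simp only: exp_add)
    thus ?thesis using False by (simp add: exp_minus inverse_eq_divide)
  qed simp
  have "summable (\<lambda>n. norm (dterm one_fn (of_real (1 + \<delta>)) n * of_real (mangoldt n)))"
    using \<delta> by (intro summable_dterm_mangoldt bounded_cm_one_fn) auto
  moreover have "norm (dterm one_fn (of_real (1 + \<delta>)) n * of_real (mangoldt n)) =
                 mangoldt n * exp (- (1 + \<delta>) * ln (real n))" for n
    by (simp add: norm_mult norm_dterm one_fn_def)
  ultimately show sm: "summable (\<lambda>n. mangoldt n * exp (- (1 + \<delta>) * ln (real n)))" by simp
  have sm': "summable (\<lambda>n. norm (a n) * exp (- Re (of_real \<delta>) * ln (real n)))"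
    using sm unfolding eq by (simp add: a_def norm_divide)
  have a0: "a 0 = 0" by (simp add: a_def)
  have tail: "integrable lborel (\<lambda>v. 17 / \<delta> * (indicator {0..} v *\<^sub>R exp (- (\<delta> / 2) * v)))"
    using set_integrable_exp_tail[of "\<delta> / 2" 0] \<delta> by (simp add: set_integrable_def)
  have "complex_of_real (mangoldt n * exp (- (1 + \<delta>) * ln (real n))) =
        a n * exp (- of_real \<delta> * of_real (ln (real n)))" for n
    unfolding eq a_def by (simp flip: exp_of_real)
  hence "complex_of_real (\<Sum>n. mangoldt n * exp (- (1 + \<delta>) * ln (real n))) = dirichlet a (of_real \<delta>)"
    unfolding dirichlet_def using sums_of_real[OF summable_sums[OF sm], where ?'a = complex]
    by (simp only:) (rule sums_unique)
  also have "\<dots> = of_real \<delta> * (\<integral>v. psum a (exp v) * exp (- of_real \<delta> * of_real v) \<partial>lborel)"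
    using integral_psum_exp[OF a0 _ sm'] \<delta> by simp
  finally have "(\<Sum>n. mangoldt n * exp (- (1 + \<delta>) * ln (real n))) \<le>
                  norm (of_real \<delta> * (\<integral>v. psum a (exp v) * exp (- of_real \<delta> * of_real v) \<partial>lborel))"
    by (metis abs_ge_self norm_of_real)
  also have "\<dots> = \<delta> * norm (\<integral>v. psum a (exp v) * exp (- of_real \<delta> * of_real v) \<partial>lborel)"
    using \<delta> by (simp add: norm_mult)
  also have "\<dots> \<le> \<delta> * (\<integral>v. 17 / \<delta> * (indicator {0..} v *\<^sub>R exp (- (\<delta> / 2) * v)) \<partial>lborel)"
  proof (intro mult_left_mono order_trans[OF Bochner_Integration.integral_norm_bound] integral_mono' tail)
    fix v :: real
    show "norm (psum a (exp v) * exp (- of_real \<delta> * of_real v)) \<le>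
          17 / \<delta> * (indicator {0..} v *\<^sub>R exp (- (\<delta> / 2) * v))"
    proof (cases "v < 0")
      case False
      have "psum a (exp v) = of_real (\<Sum>k\<in>nats_le (exp v). mangoldt k / k)"
        unfolding psum_altdef a_def of_real_sum ..
      hence "norm (psum a (exp v)) = \<bar>\<Sum>k\<in>nats_le (exp v). mangoldt k / k\<bar>" by (simp only: norm_of_real)
      also have "\<dots> \<le> v + 17" using mertens_mangoldt[of "exp v"] False by (simp add: abs_le_iff)
      also have "\<dots> \<le> 17 / \<delta> * (1 + \<delta> / 2 * v)"
      proof -
        have eq: "17 / \<delta> * (1 + \<delta> / 2 * v) = 17 / \<delta> + 17 / 2 * v" using \<delta> by (simp add: distrib_left)
        have "17 / \<delta> \<ge> 17" using \<delta> by (simp add: field_simps)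
        thus ?thesis unfolding eq using False by linarith
      qed
      also have "\<dots> \<le> 17 / \<delta> * exp (\<delta> / 2 * v)" using \<delta> by (intro mult_left_mono exp_ge_add_one_self) auto
      finally have "norm (psum a (exp v)) * exp (- \<delta> * v) \<le> 17 / \<delta> * exp (\<delta> / 2 * v) * exp (- \<delta> * v)"
        by (intro mult_right_mono) auto
      also have "\<dots> = 17 / \<delta> * exp (- (\<delta> / 2) * v)" by (simp add: mult.assoc flip: exp_add)
      finally show ?thesis using False by (simp add: norm_mult)
    qed (auto simp: psum_exp_neg)
  qed (use \<delta> in auto)
  also have "\<dots> = 34 / \<delta>"
    using set_integral_exp_tail[of "\<delta> / 2" 0] \<delta> by (simp add: set_lebesgue_integral_def)
  finally show "(\<Sum>n. mangoldt n * exp (- (1 + \<delta>) * ln (real n))) \<le> 34 / \<delta>" .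
qed

text \<open>By \<open>integral_fejer_quadratic\<close> the integral is a form over pairs with |ln y
  - ln z| < a, of weight at most a. For y > exp (1 / a) the sum over z is O(a) by
  \<open>mangoldt_short_interval\<close>; with the weight this gives a^2 times a series of order 1 /
  \<delta>. The smaller y contribute O(1), which \<delta> \<le> a^2 absorbs. Chebyshev's bound alone
  would give only a / \<delta>, whereas a^2 matches the mass of the triangle that the lower bound
  for the form produces.\<close>

lemma mangoldt_mean_square:
  "\<exists>C. C \<ge> 0 \<and> (\<forall>f \<delta> a. bounded_cm f \<longrightarrow> 0 < \<delta> \<longrightarrow> \<delta> \<le> 1 \<longrightarrow> 0 < a \<longrightarrow> a \<le> 1/2 \<longrightarrow> \<delta> \<le> a^2 \<longrightarrow>
     integrable lborel (\<lambda>t. fejer a t * norm (dirichlet (\<lambda>n. f n * of_real (mangoldt n)) (Complex (1 + \<delta>) t)) ^ 2) \<and>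
     (\<integral>t. fejer a t * norm (dirichlet (\<lambda>n. f n * of_real (mangoldt n)) (Complex (1 + \<delta>) t)) ^ 2 \<partial>lborel) \<le>
       fejer_const * (C * a^2 / \<delta>))"
proof -
  obtain C where C: "C \<ge> 0" "\<And>m a. m \<ge> 4 \<Longrightarrow> 0 < a \<Longrightarrow> a \<le> 1/2 \<Longrightarrow>
     (\<Sum>n | n > 0 \<and> \<bar>ln (real n) - ln (real m)\<bar> < a. mangoldt n / n) \<le> C * (a + 1 / ln m)"
    using mangoldt_short_interval by blast
  \<comment> \<open>68 C is 2 C from the short intervals times 34 from the series; 532 bounds 56 (1
    + 17 a) for a \<le> 1 / 2.\<close>
  define C' where "C' = 68 * C + 532"
  have "C' \<ge> 0" using C by (simp add: C'_def)
  moreover have "integrable lborel (\<lambda>t. fejer a t * norm (dirichlet (\<lambda>n. f n * of_real (mangoldt n)) (Complex (1 + \<delta>) t)) ^ 2) \<and>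
     (\<integral>t. fejer a t * norm (dirichlet (\<lambda>n. f n * of_real (mangoldt n)) (Complex (1 + \<delta>) t)) ^ 2 \<partial>lborel) \<le>
       fejer_const * (C' * a^2 / \<delta>)"
    if f: "bounded_cm f" and \<delta>: "0 < \<delta>" "\<delta> \<le> 1" and a: "0 < a" "a \<le> 1/2" "\<delta> \<le> a^2" for f \<delta> a
  proof -
    define b where "b = (\<lambda>n. dterm f (of_real (1 + \<delta>)) n * of_real (mangoldt n))"
    define \<beta> where "\<beta> = (\<lambda>n. mangoldt n * exp (- (1 + \<delta>) * ln (real n)))"
    define S where "S = (\<lambda>y::nat. {z. z > 0 \<and> \<bar>ln (real z) - ln (real y)\<bar> < a})"
    define R where "R = (\<lambda>y. \<Sum>z\<in>S y. mangoldt z / z)"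
    let ?N = "count_space (UNIV :: nat set)"
    let ?w = "\<lambda>y z. complex_of_real (max (a - \<bar>ln (real y) - ln (real z)\<bar>) 0)"
    have \<beta>0: "\<beta> n \<ge> 0" for n by (simp add: \<beta>_def mangoldt_nonneg)
    have b0: "b 0 = 0" by (simp add: b_def)
    have b\<beta>: "norm (b n) \<le> \<beta> n" for n
    proof -
      have "norm (f n) * exp (- (1 + \<delta>) * ln (real n)) * mangoldt n \<le> 1 * exp (- (1 + \<delta>) * ln (real n)) * mangoldt n"
        using bounded_cm_norm[OF f] by (intro mult_right_mono mangoldt_nonneg) auto
      thus ?thesis by (simp add: b_def \<beta>_def norm_mult norm_dterm mult_ac)
    qed
    have \<beta>n: "\<beta> n \<le> mangoldt n / n" if "n > 0" for n
    proof -
      have "exp (- (1 + \<delta>) * ln (real n)) \<le> exp (- ln (real n))"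
        using that \<delta> by (simp add: algebra_simps)
      also have "\<dots> = 1 / n" using that by (simp add: exp_minus inverse_eq_divide)
      finally show ?thesis
        unfolding \<beta>_def using mult_left_mono[OF _ mangoldt_nonneg[of n], of _ "1 / n"] by simp
    qed
    have bsum: "summable (\<lambda>n. norm (b n))"
      unfolding b_def using \<delta> by (intro summable_dterm_mangoldt f) auto
    hence bint: "integrable ?N b" by (simp add: integrable_count_space_nat_iff)
    have P: "(\<integral>y. b y * cis (-t * ln (real y)) \<partial>?N) =
             dirichlet (\<lambda>n. f n * of_real (mangoldt n)) (Complex (1 + \<delta>) t)" for t
    proof -
      have "integrable ?N (\<lambda>y. b y * cis (-t * ln (real y)))"
        using bsum by (simp add: integrable_count_space_nat_iff norm_mult)
      hence "(\<integral>y. b y * cis (-t * ln (real y)) \<partial>?N) = (\<Sum>y. b y * cis (-t * ln (real y)))"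
        by (rule integral_count_space_nat)
      also have "\<dots> = dirichlet (\<lambda>n. f n * of_real (mangoldt n)) (Complex (1 + \<delta>) t)"
        unfolding dirichlet_def
      proof (rule suminf_cong)
        fix n
        have "exp (- Complex (1 + \<delta>) t * of_real (ln (real n))) =
              exp (- of_real (1 + \<delta>) * of_real (ln (real n))) * cis (-t * ln (real n))"
          by (simp add: exp_eq_polar left_diff_distrib distrib_right)
        thus "b n * cis (-t * ln (real n)) =
              f n * of_real (mangoldt n) * exp (- Complex (1 + \<delta>) t * of_real (ln (real n)))"
          by (simp only: b_def dterm_def mult_ac)
      qed
      finally show ?thesis .
    qed
    have Sfin: "finite (S y)" if "y > 0" for y
      unfolding S_def using that by (rule finite_short_interval)
    have R0: "R y \<ge> 0" for y unfolding R_def by (intro sum_nonneg divide_nonneg_nonneg mangoldt_nonneg) auto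
    have inner: "norm (\<integral>z. b y * cnj (b z) * ?w y z \<partial>?N) \<le> \<beta> y * (a * R y)" for y
    proof (cases "y = 0")
      case False
      define h where "h = (\<lambda>z. a * (mangoldt z / z) * indicator (S y) z)"
      have hfin: "z \<notin> S y \<Longrightarrow> h z = 0" for z by (simp add: h_def)
      have hsum: "summable (\<lambda>z. norm (h z))" using Sfin[of y] False hfin by (intro summable_finite[of "S y"]) auto
      hence hint: "integrable ?N h" by (simp add: integrable_count_space_nat_iff)
      have "(\<integral>z. b y * cnj (b z) * ?w y z \<partial>?N) = b y * (\<integral>z. cnj (b z) * ?w y z \<partial>?N)"
        by (subst integral_mult_right_zero [symmetric]) (simp add: mult.assoc)
      also have "norm \<dots> \<le> \<beta> y * (\<integral>z. h z \<partial>?N)"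
        unfolding norm_mult
      proof (intro mult_mono b\<beta> order_trans[OF Bochner_Integration.integral_norm_bound] integral_mono' hint)
        fix z
        show "h z \<ge> 0" using a by (simp add: h_def mangoldt_nonneg)
        show "norm (cnj (b z) * ?w y z) \<le> h z"
        proof (cases "z \<in> S y")
          case True
          have "norm (b z) * max (a - \<bar>ln (real y) - ln (real z)\<bar>) 0 \<le> (mangoldt z / z) * a"
            using True a b\<beta>[of z] \<beta>n[of z] mangoldt_nonneg[of z]
            by (intro mult_mono) (auto simp: S_def)
          thus ?thesis using True by (simp add: norm_mult h_def mult.commute)
        next
          case False
          hence "z = 0 \<or> max (a - \<bar>ln (real y) - ln (real z)\<bar>) 0 = 0"
            unfolding S_def by (auto simp: abs_minus_commute)
          thus ?thesis using b0 False by (auto simp: h_def)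
        qed
      qed (use \<beta>0 in auto)
      also have "(\<integral>z. h z \<partial>?N) = (\<Sum>z. h z)" by (rule integral_count_space_nat[OF hint])
      also have "\<dots> = (\<Sum>z\<in>S y. h z)" using Sfin[of y] False hfin by (intro suminf_finite) auto
      also have "\<dots> = a * R y" by (simp add: h_def R_def sum_distrib_left)
      finally show ?thesis .
    qed (simp add: b0 \<beta>_def)
    \<comment> \<open>\<open>g\<close> collects the y \<le> exp (1 / a), which are given the bound
      56; Mertens' estimate bounds its sum by 1 / a + 17.\<close>
    define g where "g = (\<lambda>y. if y \<in> nats_le (exp (1 / a)) then mangoldt y / real y else 0)"
    have \<beta>R: "\<beta> y * (a * R y) \<le> a * (2 * C * a * \<beta> y + 56 * g y)" for y
    proof (cases "y = 0")
      case False
      show ?thesis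
      proof (cases "y \<in> nats_le (exp (1 / a))")
        case True
        have "\<beta> y * R y \<le> (mangoldt y / y) * 56"
          using False a \<beta>n[of y] R0[of y] mangoldt_short_interval_trivial[of y a] mangoldt_nonneg[of y]
          unfolding R_def S_def by (intro mult_mono) auto
        also have "\<dots> \<le> 2 * C * a * \<beta> y + 56 * g y"
        proof -
          have "2 * C * a * \<beta> y \<ge> 0" using C(1) a \<beta>0[of y] by (intro mult_nonneg_nonneg) auto
          moreover have "mangoldt y / y * 56 = 56 * g y" using True by (simp add: g_def)
          ultimately show ?thesis by linarith
        qed
        finally have "a * (\<beta> y * R y) \<le> a * (2 * C * a * \<beta> y + 56 * g y)"
          using a by (intro mult_left_mono) auto
        thus ?thesis by (simp only: mult_ac)
      next
        case big: False
        hence y: "real y > exp (1 / a)" using False by (auto simp: in_nats_le)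
        have "1 / a \<ge> 2" using a by (simp add: field_simps)
        hence "exp (1 / a) \<ge> exp 2" by simp
        moreover have "exp 2 \<ge> (5::real)" using exp_lower_Taylor_quadratic[of "2::real"] by simp
        ultimately have "real y > 4" using y by linarith
        hence y4: "y \<ge> 4" by simp
        have "ln (real y) > ln (exp (1 / a))" using y y4 by (subst ln_less_cancel_iff) auto
        hence "ln (real y) > 1 / a" by simp
        moreover from this have "ln (real y) > 0" using a by (meson order.strict_trans divide_pos_pos zero_less_one)
        ultimately have "1 / ln (real y) \<le> a" using a by (simp add: pos_divide_le_eq pos_divide_less_eq mult.commute)
        hence "R y \<le> C * (a + a)"
          using C(2)[OF y4 a(1,2)] C(1) mult_left_mono[of "a + 1 / ln (real y)" "a + a" C]
          unfolding R_def S_def by simp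
        hence "\<beta> y * R y \<le> \<beta> y * (2 * C * a)" using \<beta>0 by (intro mult_left_mono) auto
        hence "a * (\<beta> y * R y) \<le> a * (2 * C * a * \<beta> y + 56 * g y)"
          using a big by (intro mult_left_mono) (auto simp: g_def mult.commute)
        thus ?thesis by (simp only: mult_ac)
      qed
    qed (simp add: \<beta>_def g_def in_nats_le)
    have \<beta>sum: "summable \<beta>" unfolding \<beta>_def using \<delta> by (rule summable_mangoldt_exp)
    have gsum: "summable g" by (rule summable_finite[of "nats_le (exp (1 / a))"]) (auto simp: g_def)
    have g0: "g y \<ge> 0" for y by (simp add: g_def mangoldt_nonneg)
    have Hsum: "summable (\<lambda>y. a * (2 * C * a * \<beta> y + 56 * g y))"
      by (intro summable_mult summable_add \<beta>sum gsum)
    have H0: "a * (2 * C * a * \<beta> y + 56 * g y) \<ge> 0" for y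
      using a C \<beta>0[of y] g0[of y] by (intro mult_nonneg_nonneg add_nonneg_nonneg) auto
    hence Hint: "integrable ?N (\<lambda>y. a * (2 * C * a * \<beta> y + 56 * g y))"
      unfolding integrable_count_space_nat_iff real_norm_def using Hsum by (simp only: abs_of_nonneg)
    have M: "sigma_finite_measure ?N" by (rule sigma_finite_measure_count_space_countable) auto
    have \<theta>: "(\<lambda>y. ln (real y)) \<in> borel_measurable ?N" by simp
    note quad = integrable_fejer_quadratic[OF M bint \<theta> a(1)] integral_fejer_quadratic[OF M bint \<theta> a(1)]
    let ?J = "\<integral>t. fejer a t * norm (dirichlet (\<lambda>n. f n * of_real (mangoldt n)) (Complex (1 + \<delta>) t)) ^ 2 \<partial>lborel"
    have "?J \<le> norm (complex_of_real ?J)" by simp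
    also have "\<dots> = fejer_const * norm (\<integral>y. (\<integral>z. b y * cnj (b z) * ?w y z \<partial>?N) \<partial>?N)"
      using quad(2) fejer_const_pos unfolding P by (simp add: norm_mult)
    also have "\<dots> \<le> fejer_const * (\<integral>y. a * (2 * C * a * \<beta> y + 56 * g y) \<partial>?N)"
    proof (rule mult_left_mono, rule order_trans[OF Bochner_Integration.integral_norm_bound], rule integral_mono'[OF Hint])
      show "norm (\<integral>z. b y * cnj (b z) * ?w y z \<partial>?N) \<le> a * (2 * C * a * \<beta> y + 56 * g y)" for y
        using inner[of y] \<beta>R[of y] by linarith
    qed (use fejer_const_pos H0 in auto)
    also have "(\<integral>y. a * (2 * C * a * \<beta> y + 56 * g y) \<partial>?N) = (\<Sum>y. a * (2 * C * a * \<beta> y + 56 * g y))"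
      by (rule integral_count_space_nat[OF Hint])
    also have "\<dots> = a * (2 * C * a * (\<Sum>y. \<beta> y) + 56 * (\<Sum>y. g y))"
      by (rule sums_unique [symmetric]) (intro sums_mult sums_add summable_sums \<beta>sum gsum)
    also have "\<dots> \<le> C' * a^2 / \<delta>"
    proof -
      have "(\<Sum>y. \<beta> y) \<le> 34 / \<delta>" unfolding \<beta>_def using \<delta> by (rule suminf_mangoldt_exp_le)
      hence "2 * C * a * (\<Sum>y. \<beta> y) \<le> 2 * C * a * (34 / \<delta>)" using C a by (intro mult_left_mono) auto
      moreover have "(\<Sum>y. g y) \<le> 1 / a + 17"
      proof -
        have "(\<Sum>y. g y) = (\<Sum>y\<in>nats_le (exp (1 / a)). mangoldt y / y)"
          by (subst suminf_finite[of "nats_le (exp (1 / a))"]) (auto simp: g_def)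
        thus ?thesis using mertens_mangoldt[of "exp (1 / a)"] a by (simp add: abs_le_iff)
      qed
      ultimately have "2 * C * a * (\<Sum>y. \<beta> y) + 56 * (\<Sum>y. g y) \<le> 2 * C * a * (34 / \<delta>) + 56 * (1 / a + 17)"
        by (intro add_mono mult_left_mono [where c = "56 :: real"]) simp_all
      hence "a * (2 * C * a * (\<Sum>y. \<beta> y) + 56 * (\<Sum>y. g y)) \<le> a * (2 * C * a * (34 / \<delta>) + 56 * (1 / a + 17))"
        using a by (intro mult_left_mono) auto
      also have "\<dots> = 68 * C * a^2 / \<delta> + 56 * (1 + 17 * a)"
        using a by (simp add: field_simps power2_eq_square)
      also have "56 * (1 + 17 * a) \<le> 532 * 1" using a by simp
      also have "\<dots> \<le> 532 * (a^2 / \<delta>)" using a \<delta> by (intro mult_left_mono) (auto simp: field_simps)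
      finally show ?thesis by (simp add: C'_def add_divide_distrib distrib_right)
    qed
    finally have "?J \<le> fejer_const * (C' * a^2 / \<delta>)" using fejer_const_pos by (simp add: mult_left_mono)
    thus ?thesis using quad(1) unfolding P by simp
  qed
  ultimately show ?thesis by blast
qed

section \<open>Partial sums weighted by the logarithm\<close>

definition log_twist :: "(nat \<Rightarrow> complex) \<Rightarrow> nat \<Rightarrow> complex" where
  "log_twist f n = f n * of_real (ln (real n))"

definition log_profile :: "(nat \<Rightarrow> complex) \<Rightarrow> real \<Rightarrow> real \<Rightarrow> complex" where
  "log_profile f \<sigma> v = psum (log_twist f) (exp v) * of_real (exp (-\<sigma> * v))"

lemma norm_psum_log_twist_diff_le:
  assumes f: "bounded_cm f" and u: "u \<le> w" "w \<ge> 0"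
  shows "norm (psum (log_twist f) (exp w) - psum (log_twist f) (exp u)) \<le>
         w * (real (card (nats_le (exp w))) - real (card (nats_le (exp u))))"
proof -
  have sub: "nats_le (exp u) \<subseteq> nats_le (exp w)" using u by (intro nats_le_mono) auto
  have "norm (psum (log_twist f) (exp w) - psum (log_twist f) (exp u)) =
        norm (\<Sum>n\<in>nats_le (exp w) - nats_le (exp u). log_twist f n)"
    unfolding psum_altdef using sub by (simp add: sum_diff)
  also have "\<dots> \<le> (\<Sum>n\<in>nats_le (exp w) - nats_le (exp u). w)"
  proof (rule sum_norm_le)
    fix n assume "n \<in> nats_le (exp w) - nats_le (exp u)"
    hence n: "1 \<le> n" "real n \<le> exp w" by (auto simp: in_nats_le)
    hence "ln (real n) \<le> ln (exp w)" by (subst ln_le_cancel_iff) auto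
    hence "norm (f n) * ln (real n) \<le> 1 * w"
      using n u bounded_cm_norm[OF f] by (intro mult_mono) auto
    thus "norm (log_twist f n) \<le> w" using n by (simp add: log_twist_def norm_mult)
  qed
  also have "\<dots> = w * (real (card (nats_le (exp w))) - real (card (nats_le (exp u))))"
    using sub card_mono[OF finite_nats_le sub] by (simp add: card_Diff_subset of_nat_diff mult.commute)
  finally show ?thesis .
qed

lemma norm_psum_log_twist_le:
  assumes f: "bounded_cm f"
  shows "norm (psum (log_twist f) (exp v)) \<le> max v 0 * exp v"
proof (cases "v < 0")
  case False
  have "norm (psum (log_twist f) (exp v)) \<le> v * real (card (nats_le (exp v)))"
    using norm_psum_log_twist_diff_le[OF f, of "-1" v] False
    by (simp add: psum_exp_neg nats_le_empty)
  also have "\<dots> \<le> v * exp v"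
    using card_nats_le_bounds(1)[of "exp v"] False by (intro mult_left_mono) auto
  finally show ?thesis using False by simp
qed (simp add: psum_exp_neg)

lemma log_profile_neg: "v < 0 \<Longrightarrow> log_profile f \<sigma> v = 0"
  by (simp add: log_profile_def psum_exp_neg)

text \<open>Product rule: the sum changes by at most hi per integer between exp lo and exp hi, and
  the exponential weight by a relative 2 a at most. The count of these integers is known up to 1,
  and this 1 produces the term exp (-hi) beside a.\<close>

lemma log_profile_diff_ordered:
  assumes f: "bounded_cm f" and \<delta>: "0 < \<delta>" "\<delta> \<le> 1" and a: "0 < a" and le: "lo \<le> hi" "hi \<le> lo + a" "hi \<ge> 0"
  shows "norm (log_profile f (1 + \<delta>) hi - log_profile f (1 + \<delta>) lo) \<le>
         hi * exp (-\<delta> * hi) * (a + exp (-hi)) + 2 * a * max lo 0 * exp (-\<delta> * lo)"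
proof -
  let ?A = "\<lambda>v. psum (log_twist f) (exp v)" and ?e = "\<lambda>v. exp (-(1 + \<delta>) * v)"
  have "log_profile f (1 + \<delta>) hi - log_profile f (1 + \<delta>) lo =
        (?A hi - ?A lo) * of_real (?e hi) + ?A lo * of_real (?e hi - ?e lo)"
    by (simp add: log_profile_def algebra_simps)
  also have "norm \<dots> \<le> norm (?A hi - ?A lo) * ?e hi + norm (?A lo) * \<bar>?e hi - ?e lo\<bar>"
    by (rule order_trans[OF norm_triangle_ineq]) (simp only: norm_mult norm_of_real abs_exp_cancel)
  also have "\<dots> \<le> hi * exp (-\<delta> * hi) * (a + exp (-hi)) + 2 * a * max lo 0 * exp (-\<delta> * lo)"
  proof (rule add_mono)
    have "exp (lo - hi) \<ge> 1 - a" using exp_ge_add_one_self[of "lo - hi"] le by linarith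
    hence "exp hi * exp (lo - hi) \<ge> exp hi * (1 - a)" by (intro mult_left_mono) auto
    moreover have "exp hi * exp (lo - hi) = exp lo" by (simp flip: exp_add)
    ultimately have "exp hi - exp lo + 1 \<le> a * exp hi + 1" by (simp add: algebra_simps)
    hence "hi * (exp hi - exp lo + 1) \<le> hi * (a * exp hi + 1)" using le by (intro mult_left_mono) auto
    moreover have "norm (?A hi - ?A lo) \<le> hi * (exp hi - exp lo + 1)"
      using card_nats_le_bounds[of "exp hi"] card_nats_le_bounds[of "exp lo"] le
      by (intro order_trans[OF norm_psum_log_twist_diff_le[OF f le(1,3)]] mult_left_mono) auto
    ultimately have "norm (?A hi - ?A lo) * ?e hi \<le> hi * (a * exp hi + 1) * ?e hi"
      by (intro mult_right_mono) auto
    also have "\<dots> = hi * exp (-\<delta> * hi) * (a + exp (-hi))"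
    proof -
      have "?e hi = exp (-\<delta> * hi) * exp (-hi)" by (simp add: algebra_simps flip: exp_add)
      thus ?thesis by (simp add: algebra_simps exp_minus)
    qed
    finally show "norm (?A hi - ?A lo) * ?e hi \<le> hi * exp (-\<delta> * hi) * (a + exp (-hi))" .
    have "\<bar>?e hi - ?e lo\<bar> \<le> 2 * a * ?e lo"
    proof -
      define X where "X = (1 + \<delta>) * (hi - lo)"
      have "X \<le> 2 * a" unfolding X_def using \<delta> le a by (intro mult_mono) auto
      hence "exp (- X) \<ge> 1 - 2 * a" using exp_ge_add_one_self[of "- X"] by linarith
      hence "?e lo * (1 - 2 * a) \<le> ?e lo * exp (- X)" by (intro mult_left_mono) auto
      also have "\<dots> = ?e hi" by (simp add: X_def algebra_simps flip: exp_add)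
      finally have "?e hi \<ge> ?e lo * (1 - 2 * a)" .
      moreover have "?e hi \<le> ?e lo" using le \<delta> by (simp add: mult_left_mono)
      ultimately show ?thesis by (simp add: algebra_simps)
    qed
    hence "norm (?A lo) * \<bar>?e hi - ?e lo\<bar> \<le> (max lo 0 * exp lo) * (2 * a * ?e lo)"
      by (intro mult_mono norm_psum_log_twist_le f) auto
    also have "\<dots> = 2 * a * max lo 0 * exp (-\<delta> * lo)"
      by (simp add: algebra_simps flip: exp_add)
    finally show "norm (?A lo) * \<bar>?e hi - ?e lo\<bar> \<le> 2 * a * max lo 0 * exp (-\<delta> * lo)" .
  qed
  finally show ?thesis .
qed

text \<open>The ordered version with everything expressed at v: exp (-\<delta> lo) is at most twice
  exp (-\<delta> v), whence 5 a = a + 4 a. The part exp (-v) does not shrink with a, but it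
  contributes only a bounded amount to the mean square.\<close>

lemma log_profile_modulus:
  assumes f: "bounded_cm f" and \<delta>: "0 < \<delta>" "\<delta> \<le> 1" and a: "0 < a" "a \<le> 1/2" and v: "v \<ge> 0" and w: "\<bar>v - w\<bar> < a"
  shows "norm (log_profile f (1 + \<delta>) v - log_profile f (1 + \<delta>) w) \<le> (v + 1) * exp (-\<delta> * v) * (5 * a + exp (-v))"
proof -
  define lo hi where "lo = min v w" and "hi = max v w"
  have lh: "lo \<le> hi" "hi \<le> lo + a" "hi \<ge> 0" "v \<le> hi" "lo \<le> v" "hi \<le> v + a" "v - a \<le> lo"
    using w v a by (auto simp: lo_def hi_def)
  have "norm (log_profile f (1 + \<delta>) v - log_profile f (1 + \<delta>) w) =
        norm (log_profile f (1 + \<delta>) hi - log_profile f (1 + \<delta>) lo)"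
    by (auto simp: lo_def hi_def min_def max_def norm_minus_commute)
  also have "\<dots> \<le> hi * exp (-\<delta> * hi) * (a + exp (-hi)) + 2 * a * max lo 0 * exp (-\<delta> * lo)"
    by (rule log_profile_diff_ordered[OF f \<delta> a(1) lh(1-3)])
  also have "\<dots> \<le> (v + 1) * exp (-\<delta> * v) * (a + exp (-v)) + 2 * a * (v + 1) * (2 * exp (-\<delta> * v))"
  proof (intro add_mono mult_mono)
    have "exp (-\<delta> * lo) \<le> exp (-\<delta> * v + 1/2)"
    proof -
      have "\<delta> * (v - lo) \<le> 1 * (1/2)" using \<delta> lh a by (intro mult_mono) auto
      thus ?thesis by (simp add: algebra_simps)
    qed
    also have "\<dots> = exp (1/2) * exp (-\<delta> * v)" by (simp only: exp_add mult.commute)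
    also have "\<dots> \<le> 2 * exp (-\<delta> * v)" using exp_small_bounds(1)[of "1/2"] by (intro mult_right_mono) auto
    finally show "exp (-\<delta> * lo) \<le> 2 * exp (-\<delta> * v)" .
  qed (use lh a \<delta> v in auto)
  also have "\<dots> = (v + 1) * exp (-\<delta> * v) * (5 * a + exp (-v))" by (simp add: algebra_simps)
  finally show ?thesis .
qed

text \<open>The uniform bound through which integrability of the profile yields integrability of its
  square.\<close>

lemma norm_log_profile_le:
  assumes f: "bounded_cm f" and \<delta>: "0 < \<delta>"
  shows "norm (log_profile f (1 + \<delta>) v) \<le> 1 / \<delta>"
proof (cases "v < 0")
  case False
  have "norm (log_profile f (1 + \<delta>) v) \<le> (max v 0 * exp v) * exp (-(1 + \<delta>) * v)"
    unfolding log_profile_def norm_mult norm_of_real abs_exp_cancel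
    by (intro mult_right_mono norm_psum_log_twist_le f) auto
  also have "\<dots> = v * exp (-\<delta> * v)" using False by (simp add: algebra_simps flip: exp_add)
  also have "\<dots> \<le> 1 / \<delta>"
  proof -
    have "\<delta> * v \<le> exp (\<delta> * v)" using exp_ge_add_one_self[of "\<delta> * v"] by linarith
    thus ?thesis using \<delta> by (simp add: exp_minus field_simps)
  qed
  finally show ?thesis .
qed (use \<delta> in \<open>simp add: log_profile_neg\<close>)

lemma
  assumes f: "bounded_cm f" and \<delta>: "0 < \<delta>"
  shows integrable_log_profile: "integrable lborel (log_profile f (1 + \<delta>))"
    and integrable_norm_log_profile_sq: "integrable lborel (\<lambda>v. norm (log_profile f (1 + \<delta>) v) ^ 2)"
    and fourier_log_profile:
      "(\<integral>v. log_profile f (1 + \<delta>) v * cis (-t * v) \<partial>lborel) =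
         dirichlet (log_twist f) (Complex (1 + \<delta>) t) / Complex (1 + \<delta>) t"
proof -
  have sm: "summable (\<lambda>n. norm (log_twist f n) * exp (- (1 + \<delta>) * ln (real n)))"
  proof -
    have "norm (dterm f (of_real (1 + \<delta>)) n * of_real (ln (real n))) =
          norm (log_twist f n) * exp (- (1 + \<delta>) * ln (real n))" for n
      by (simp add: norm_mult norm_dterm log_twist_def mult_ac)
    thus ?thesis using summable_dterm_ln[OF f, of "of_real (1 + \<delta>)"] \<delta> by simp
  qed
  have l0: "log_twist f 0 = 0" by (simp add: log_twist_def)
  have eq: "psum (log_twist f) (exp v) * exp (- Complex (1 + \<delta>) t * of_real v) =
            log_profile f (1 + \<delta>) v * cis (-t * v)" for v t
    by (simp add: log_profile_def exp_eq_polar left_diff_distrib distrib_right mult.assoc)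
  have "integrable lborel (\<lambda>v. psum (log_twist f) (exp v) * exp (- Complex (1 + \<delta>) 0 * of_real v))"
    using l0 \<delta> sm by (intro integrable_psum_exp) auto
  thus int: "integrable lborel (log_profile f (1 + \<delta>))" unfolding eq by simp
  show "(\<integral>v. log_profile f (1 + \<delta>) v * cis (-t * v) \<partial>lborel) =
         dirichlet (log_twist f) (Complex (1 + \<delta>) t) / Complex (1 + \<delta>) t"
    unfolding eq [symmetric] using l0 \<delta> sm by (intro integral_psum_exp) auto
  have "integrable lborel (\<lambda>v. (1 / \<delta>) * norm (log_profile f (1 + \<delta>) v))"
    using int by simp
  thus "integrable lborel (\<lambda>v. norm (log_profile f (1 + \<delta>) v) ^ 2)"
  proof (rule Bochner_Integration.integrable_bound)
    show "(\<lambda>v. (norm (log_profile f (1 + \<delta>) v))\<^sup>2) \<in> borel_measurable lborel"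
      using borel_measurable_integrable[OF int] by measurable
    show "AE v in lborel. norm ((norm (log_profile f (1 + \<delta>) v))\<^sup>2) \<le> norm ((1 / \<delta>) * norm (log_profile f (1 + \<delta>) v))"
    proof (rule AE_I2)
      fix v
      have "norm (log_profile f (1 + \<delta>) v) * norm (log_profile f (1 + \<delta>) v) \<le>
            (1 / \<delta>) * norm (log_profile f (1 + \<delta>) v)"
        by (intro mult_right_mono norm_log_profile_le[OF f \<delta>]) auto
      thus "norm ((norm (log_profile f (1 + \<delta>) v))\<^sup>2) \<le> norm ((1 / \<delta>) * norm (log_profile f (1 + \<delta>) v))"
        using \<delta> by (simp add: power2_eq_square abs_mult)
    qed
  qed
qed

text \<open>The last bound comes from the rectangle of height a / 2 over [-a / 2, a / 2], which lies
  below the triangle.\<close>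

lemma triangle_kernel:
  fixes v :: real
  assumes "a > 0"
  shows "integrable lborel (\<lambda>w. max (a - \<bar>v - w\<bar>) 0)"
    and "(\<integral>w. max (a - \<bar>v - w\<bar>) 0 \<partial>lborel) = (\<integral>w. max (a - \<bar>w\<bar>) 0 \<partial>lborel)"
    and "(\<integral>w. max (a - \<bar>w\<bar>) 0 \<partial>lborel) \<ge> a^2 / 2"
proof -
  have int: "integrable lborel (\<lambda>w. max (a - \<bar>v - w\<bar>) 0)" for v
  proof (rule Bochner_Integration.integrable_bound)
    show "integrable lborel (\<lambda>w. a * indicator {v - a..v + a} w :: real)" using assms by simp
    show "AE w in lborel. norm (max (a - \<bar>v - w\<bar>) 0) \<le> norm (a * indicator {v - a..v + a} w :: real)"
      using assms by (intro AE_I2) (auto simp: indicator_def max_def)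
  qed auto
  thus "integrable lborel (\<lambda>w. max (a - \<bar>v - w\<bar>) 0)" .
  show "(\<integral>w. max (a - \<bar>v - w\<bar>) 0 \<partial>lborel) = (\<integral>w. max (a - \<bar>w\<bar>) 0 \<partial>lborel)"
    by (subst lborel_integral_real_affine[of 1 _ v]) auto
  have "a^2 / 2 = (\<integral>w. (a / 2) * indicator {-(a / 2)..a / 2} w \<partial>lborel)"
    using assms by (simp add: power2_eq_square)
  also have "\<dots> \<le> (\<integral>w. max (a - \<bar>w\<bar>) 0 \<partial>lborel)"
  proof (rule integral_mono)
    show "integrable lborel (\<lambda>w. max (a - \<bar>w\<bar>) 0)" using int[of 0] by simp
    show "(a / 2) * indicator {-(a / 2)..a / 2} w \<le> max (a - \<bar>w\<bar>) 0" for w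
      using assms by (auto simp: indicator_def max_def)
  qed (use assms in auto)
  finally show "(\<integral>w. max (a - \<bar>w\<bar>) 0 \<partial>lborel) \<ge> a^2 / 2" .
qed

text \<open>Gives up half of the decay exp (-\<delta> v) to absorb a linear factor, so that only
  pure exponentials have to be integrated.\<close>

lemma add_one_le_exp_half:
  assumes "0 < \<delta>" "\<delta> \<le> 1" "v \<ge> (0::real)"
  shows "v + 1 \<le> 2 / \<delta> * exp (\<delta> / 2 * v)"
proof -
  have "1 \<le> 2 / \<delta>" using assms by (simp add: field_simps)
  hence "v + 1 \<le> 2 / \<delta> * (1 + \<delta> / 2 * v)" using assms by (simp add: distrib_left)
  also have "\<dots> \<le> 2 / \<delta> * exp (\<delta> / 2 * v)" using assms by (intro mult_left_mono exp_ge_add_one_self) auto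
  finally show ?thesis .
qed

text \<open>Within distance a the profile changes by at most E, so \<alpha> w may be replaced by
  \<alpha> v in the form: Re (G v) \<ge> T (|\<alpha> v|^2 - |\<alpha> v| E), and |\<alpha> v| E
  \<le> (|\<alpha> v|^2 + E^2) / 2 leaves half of the square. In effect a Fejer weight concentrated
  on |t| up to about 1 / a already captures the mean square of a function that hardly varies at
  scale a.\<close>

lemma fejer_form_log_profile_lower:
  assumes f: "bounded_cm f" and \<delta>: "0 < \<delta>" "\<delta> \<le> 1" and a: "0 < a" "a \<le> 1/2"
  defines "\<alpha> \<equiv> log_profile f (1 + \<delta>)"
  defines "T \<equiv> (\<integral>w. max (a - \<bar>w\<bar>) 0 \<partial>lborel)"
  shows "T / 2 * ((\<integral>v. norm (\<alpha> v) ^ 2 \<partial>lborel) - (200 * a^2 / \<delta>^3 + 8)) \<le>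
         Re (\<integral>v. (\<integral>w. \<alpha> v * cnj (\<alpha> w) * of_real (max (a - \<bar>v - w\<bar>) 0) \<partial>lborel) \<partial>lborel)"
proof -
  define G where "G = (\<lambda>v. \<integral>w. \<alpha> v * cnj (\<alpha> w) * of_real (max (a - \<bar>v - w\<bar>) 0) \<partial>lborel)"
  \<comment> \<open>A majorant of E^2. It stems from (5 a + e)^2 \<le> 50 a^2 + 2 e^2 with e = exp
    (-v), and from (v + 1)^2 \<le> 4 / \<delta>^2 exp (\<delta> v), used with 1 in place of \<delta>
    in the second term.\<close>
  define B where "B = (\<lambda>v. 200 * a^2 / \<delta>^2 * (indicator {0..} v *\<^sub>R exp (-\<delta> * v)) +
                            8 * (indicator {0..} v *\<^sub>R exp (- 1 * v :: real)))"
  have int: "integrable lborel \<alpha>" unfolding \<alpha>_def by (rule integrable_log_profile[OF f \<delta>(1)])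
  hence [measurable]: "\<alpha> \<in> borel_measurable borel" using borel_measurable_integrable by fastforce
  have int2: "integrable lborel (\<lambda>v. norm (\<alpha> v) ^ 2)"
    unfolding \<alpha>_def by (rule integrable_norm_log_profile_sq[OF f \<delta>(1)])
  have G: "integrable lborel G"
    unfolding G_def
    using integrable_fejer_form[OF _ int _ a(1), of "\<lambda>v. v"] lborel.sigma_finite_measure_axioms by simp
  have T0: "T \<ge> 0" unfolding T_def using triangle_kernel(3)[OF a(1)] by (smt (verit) zero_le_power2 divide_nonneg_nonneg)
  have B1: "integrable lborel (\<lambda>v. indicator {0..} v *\<^sub>R exp (-\<delta> * v))"
           "(\<integral>v. indicator {0..} v *\<^sub>R exp (-\<delta> * v) \<partial>lborel) = 1 / \<delta>"
    using set_integrable_exp_tail[of \<delta> 0] set_integral_exp_tail[of \<delta> 0] \<delta>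
    by (simp_all add: set_integrable_def set_lebesgue_integral_def)
  have B2: "integrable lborel (\<lambda>v. indicator {0..} v *\<^sub>R exp (- 1 * v :: real))"
           "(\<integral>v. indicator {0..} v *\<^sub>R exp (- 1 * v :: real) \<partial>lborel) = 1"
    using set_integrable_exp_tail[of 1 0] set_integral_exp_tail[of 1 0]
    by (simp_all add: set_integrable_def set_lebesgue_integral_def)
  have intB: "integrable lborel B"
    unfolding B_def by (intro Bochner_Integration.integrable_add integrable_mult_right B1 B2)
  have "(\<integral>v. B v \<partial>lborel) = 200 * a^2 / \<delta>^2 * (1 / \<delta>) + 8 * 1"
    unfolding B_def using B1 B2 by (subst Bochner_Integration.integral_add) auto
  hence IB: "(\<integral>v. B v \<partial>lborel) = 200 * a^2 / \<delta>^3 + 8"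
    by (simp add: power3_eq_cube power2_eq_square)
  have ptw: "T / 2 * (norm (\<alpha> v) ^ 2 - B v) \<le> Re (G v)" for v
  proof (cases "v < 0")
    case True
    thus ?thesis by (simp add: \<alpha>_def log_profile_neg G_def B_def)
  next
    case False
    define E where "E = (v + 1) * exp (-\<delta> * v) * (5 * a + exp (-v))"
    have "E \<ge> 0" using False a by (simp add: E_def)
    have EB: "E ^ 2 \<le> B v"
    proof -
      define e where "e = exp (-v)"
      have "(5 * a + e)^2 \<le> 50 * a^2 + 2 * e^2"
        using sum_squares_bound[of "5 * a" e] by (simp add: power2_eq_square algebra_simps)
      hence "E ^ 2 \<le> ((v + 1) * exp (-\<delta> * v))^2 * (50 * a^2 + 2 * e^2)"
        unfolding E_def e_def[symmetric] power_mult_distrib[of _ "5 * a + e"] by (intro mult_left_mono) auto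
      also have "\<dots> = 50 * a^2 * ((v + 1) * exp (-\<delta> * v))^2 + 2 * ((v + 1) * exp (-\<delta> * v) * e)^2"
      proof -
        have "p^2 * (50 * a^2 + 2 * e^2) = 50 * a^2 * p^2 + 2 * (p * e)^2" for p :: real
          by (simp add: power_mult_distrib algebra_simps)
        thus ?thesis .
      qed
      also have "\<dots> \<le> 50 * a^2 * (4 / \<delta>^2 * exp (-\<delta> * v)) + 2 * (4 * exp (- 1 * v))"
      proof (intro add_mono mult_left_mono)
        have "(v + 1) * exp (-\<delta> * v) \<le> 2 / \<delta> * exp (\<delta> / 2 * v) * exp (-\<delta> * v)"
          using add_one_le_exp_half[OF \<delta>] False by (intro mult_right_mono) auto
        hence "((v + 1) * exp (-\<delta> * v))^2 \<le> (2 / \<delta> * exp (\<delta> / 2 * v) * exp (-\<delta> * v))^2"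
          using False by (intro power_mono) auto
        also have "\<dots> = 4 / \<delta>^2 * exp (-\<delta> * v)"
          by (simp add: power_mult_distrib power_divide mult.assoc flip: exp_add exp_double)
        finally show "((v + 1) * exp (-\<delta> * v))^2 \<le> 4 / \<delta>^2 * exp (-\<delta> * v)" .
        have "exp (-\<delta> * v) \<le> 1" using \<delta> False by simp
        hence "(v + 1) * exp (-\<delta> * v) * e \<le> (2 / 1 * exp (1 / 2 * v)) * 1 * e"
          using add_one_le_exp_half[of 1 v] False by (intro mult_mono) (auto simp: e_def)
        hence "((v + 1) * exp (-\<delta> * v) * e)^2 \<le> ((2 / 1 * exp (1 / 2 * v)) * 1 * e)^2"
          using False by (intro power_mono) (auto simp: e_def)
        also have "\<dots> = 4 * exp (- 1 * v)"
          by (simp add: e_def power_mult_distrib power2_eq_square flip: exp_add)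
        finally show "((v + 1) * exp (-\<delta> * v) * e)^2 \<le> 4 * exp (- 1 * v)" .
      qed auto
      also have "\<dots> = B v" using False by (simp add: B_def)
      finally show ?thesis .
    qed
    define m where "m = (\<lambda>w. max (a - \<bar>v - w\<bar>) 0)"
    have m: "integrable lborel m" "(\<integral>w. m w \<partial>lborel) = T" "\<And>w. m w \<ge> 0"
      unfolding m_def T_def using triangle_kernel(1,2)[OF a(1)] by auto
    have [measurable]: "m \<in> borel_measurable borel" unfolding m_def by measurable
    have "integrable lborel (\<lambda>w. cnj (\<alpha> w))" using int by simp
    hence [measurable]: "(\<lambda>w. cnj (\<alpha> w)) \<in> borel_measurable borel" using borel_measurable_integrable by fastforce
    have i1: "integrable lborel (\<lambda>w. cnj (\<alpha> w) * of_real (m w))"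
    proof (rule Bochner_Integration.integrable_bound)
      show "integrable lborel (\<lambda>w. a * norm (\<alpha> w))" using int by simp
      show "AE w in lborel. norm (cnj (\<alpha> w) * of_real (m w)) \<le> norm (a * norm (\<alpha> w))"
      proof (rule AE_I2)
        fix w
        have "m w * norm (\<alpha> w) \<le> a * norm (\<alpha> w)" using a by (intro mult_right_mono) (auto simp: m_def)
        thus "norm (cnj (\<alpha> w) * of_real (m w)) \<le> norm (a * norm (\<alpha> w))"
          using a m(3)[of w] by (simp add: norm_mult mult.commute)
      qed
    qed auto
    have i2: "integrable lborel (\<lambda>w. cnj (\<alpha> v) * of_real (m w))"
      using m(1) by (intro integrable_mult_right integrable_of_real)
    define D where "D = (\<integral>w. cnj (\<alpha> w) * of_real (m w) - cnj (\<alpha> v) * of_real (m w) \<partial>lborel)"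
    have Dnorm: "norm D \<le> E * T"
    proof -
      have "norm D \<le> (\<integral>w. E * m w \<partial>lborel)"
        unfolding D_def
      proof (rule order_trans[OF Bochner_Integration.integral_norm_bound], rule integral_mono')
        show "integrable lborel (\<lambda>w. E * m w)" using m by simp
        fix w
        show "0 \<le> E * m w" using \<open>E \<ge> 0\<close> m(3) by simp
        show "norm (cnj (\<alpha> w) * of_real (m w) - cnj (\<alpha> v) * of_real (m w)) \<le> E * m w"
        proof (cases "\<bar>v - w\<bar> < a")
          case True
          have "norm (cnj (\<alpha> w) * of_real (m w) - cnj (\<alpha> v) * of_real (m w)) = norm (\<alpha> v - \<alpha> w) * m w"
            using m(3)[of w]
            by (simp add: norm_mult norm_minus_commute flip: left_diff_distrib complex_cnj_diff)
          also have "\<dots> \<le> E * m w"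
            unfolding E_def \<alpha>_def using False True
            by (intro mult_right_mono log_profile_modulus f \<delta> a m) auto
          finally show ?thesis .
        qed (simp add: m_def)
      qed
      thus ?thesis using m by simp
    qed
    have "G v = \<alpha> v * (\<integral>w. cnj (\<alpha> w) * of_real (m w) \<partial>lborel)"
      unfolding G_def m_def by (subst integral_mult_right_zero [symmetric]) (simp add: mult.assoc)
    also have "(\<integral>w. cnj (\<alpha> w) * of_real (m w) \<partial>lborel) = D + (\<integral>w. cnj (\<alpha> v) * of_real (m w) \<partial>lborel)"
      unfolding D_def using i1 i2 by (subst Bochner_Integration.integral_diff) auto
    also have "(\<integral>w. cnj (\<alpha> v) * of_real (m w) \<partial>lborel) = cnj (\<alpha> v) * of_real T"
      using m(2) by (simp add: integral_complex_of_real)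
    also have "\<alpha> v * (D + cnj (\<alpha> v) * of_real T) = \<alpha> v * D + of_real (norm (\<alpha> v) ^ 2 * T)"
      by (simp only: of_real_mult complex_norm_square distrib_left mult.assoc)
    finally have "Re (G v) = Re (\<alpha> v * D) + norm (\<alpha> v) ^ 2 * T"
      by (simp only: plus_complex.sel Re_complex_of_real)
    moreover have "Re (\<alpha> v * D) \<ge> - (norm (\<alpha> v) * (E * T))"
    proof -
      have "\<bar>Re (\<alpha> v * D)\<bar> \<le> norm (\<alpha> v * D)" by (rule abs_Re_le_cmod)
      also have "\<dots> \<le> norm (\<alpha> v) * (E * T)" unfolding norm_mult using Dnorm by (intro mult_left_mono) auto
      finally show ?thesis by linarith
    qed
    moreover have "norm (\<alpha> v) * E \<le> (norm (\<alpha> v) ^ 2 + B v) / 2"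
      using sum_squares_bound[of "norm (\<alpha> v)" E] EB by simp
    hence "norm (\<alpha> v) * E * T \<le> (norm (\<alpha> v) ^ 2 + B v) / 2 * T" using T0 by (intro mult_right_mono) auto
    ultimately show ?thesis by (simp add: algebra_simps)
  qed
  have "T / 2 * ((\<integral>v. norm (\<alpha> v) ^ 2 \<partial>lborel) - (200 * a^2 / \<delta>^3 + 8)) =
        (\<integral>v. T / 2 * (norm (\<alpha> v) ^ 2 - B v) \<partial>lborel)"
    using int2 intB IB by simp
  also have "\<dots> \<le> (\<integral>v. Re (G v) \<partial>lborel)"
    using int2 intB G ptw by (intro integral_mono) auto
  also have "\<dots> = Re (\<integral>v. G v \<partial>lborel)" by (rule integral_Re[OF G])
  finally show ?thesis unfolding G_def .
qed

text \<open>One quadratic form seen from two sides. The Fourier transform of the profile is F / s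
  times the series of f Lambda, so |F / s| \<le> l and \<open>mangoldt_mean_square\<close> bound the
  form by l^2 C a^2 / \<delta>; \<open>fejer_form_log_profile_lower\<close> bounds it below by T / 2
  times the mean square less its error. As T \<ge> a^2 / 2, the factors a^2 cancel.\<close>

lemma log_profile_mean_square:
  "\<exists>C. C \<ge> 0 \<and> (\<forall>f \<delta> a l. bounded_cm f \<longrightarrow> 0 < \<delta> \<longrightarrow> \<delta> \<le> 1 \<longrightarrow> 0 < a \<longrightarrow> a \<le> 1/2 \<longrightarrow> \<delta> \<le> a^2 \<longrightarrow> l \<ge> 0 \<longrightarrow>
     (\<forall>t. norm (dirichlet f (Complex (1 + \<delta>) t)) \<le> l * norm (Complex (1 + \<delta>) t)) \<longrightarrow>
     (\<integral>v. norm (log_profile f (1 + \<delta>) v) ^ 2 \<partial>lborel) \<le> C * l^2 / \<delta> + (200 * a^2 / \<delta>^3 + 8))"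
proof -
  obtain C where C: "C \<ge> 0" "\<And>f \<delta> a. bounded_cm f \<Longrightarrow> 0 < \<delta> \<Longrightarrow> \<delta> \<le> 1 \<Longrightarrow> 0 < a \<Longrightarrow> a \<le> 1/2 \<Longrightarrow> \<delta> \<le> a^2 \<Longrightarrow>
     integrable lborel (\<lambda>t. fejer a t * norm (dirichlet (\<lambda>n. f n * of_real (mangoldt n)) (Complex (1 + \<delta>) t)) ^ 2) \<and>
     (\<integral>t. fejer a t * norm (dirichlet (\<lambda>n. f n * of_real (mangoldt n)) (Complex (1 + \<delta>) t)) ^ 2 \<partial>lborel) \<le>
       fejer_const * (C * a^2 / \<delta>)"
    using mangoldt_mean_square by blast
  have "(\<integral>v. norm (log_profile f (1 + \<delta>) v) ^ 2 \<partial>lborel) \<le> 4 * C * l^2 / \<delta> + (200 * a^2 / \<delta>^3 + 8)"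
    if f: "bounded_cm f" and \<delta>: "0 < \<delta>" "\<delta> \<le> 1" and a: "0 < a" "a \<le> 1/2" "\<delta> \<le> a^2" and l: "l \<ge> 0"
      and F: "\<And>t. norm (dirichlet f (Complex (1 + \<delta>) t)) \<le> l * norm (Complex (1 + \<delta>) t)" for f \<delta> a l
  proof -
    define \<alpha> where "\<alpha> = log_profile f (1 + \<delta>)"
    define T where "T = (\<integral>w. max (a - \<bar>w\<bar>) 0 \<partial>lborel)"
    define X where "X = Re (\<integral>v. (\<integral>w. \<alpha> v * cnj (\<alpha> w) * of_real (max (a - \<bar>v - w\<bar>) 0) \<partial>lborel) \<partial>lborel)"
    define A where "A = (\<integral>v. norm (\<alpha> v) ^ 2 \<partial>lborel)"
    define P where "P = (\<lambda>t. dirichlet (\<lambda>n. f n * of_real (mangoldt n)) (Complex (1 + \<delta>) t))"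
    have T: "T \<ge> a^2 / 2" unfolding T_def by (rule triangle_kernel(3)[OF a(1)])
    have int: "integrable lborel \<alpha>" unfolding \<alpha>_def by (rule integrable_log_profile[OF f \<delta>(1)])
    have four: "(\<integral>v. \<alpha> v * cis (-t * v) \<partial>lborel) =
                dirichlet f (Complex (1 + \<delta>) t) * P t / Complex (1 + \<delta>) t" for t
    proof -
      have "dirichlet f (Complex (1 + \<delta>) t) * P t = dirichlet (log_twist f) (Complex (1 + \<delta>) t)"
        unfolding P_def using \<delta> by (subst dirichlet_mult_mangoldt[OF f]) (auto simp: log_twist_def [abs_def])
      thus ?thesis unfolding \<alpha>_def using fourier_log_profile[OF f \<delta>(1)] by simp
    qed
    have id: "(\<lambda>v::real. v) \<in> borel_measurable lborel" by simp
    note quad = integrable_fejer_quadratic[OF lborel.sigma_finite_measure_axioms int id a(1)]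
                integral_fejer_quadratic[OF lborel.sigma_finite_measure_axioms int id a(1)]
    have "fejer_const * X = Re (of_real (\<integral>t. fejer a t * (norm (\<integral>v. \<alpha> v * cis (-t * v) \<partial>lborel))^2 \<partial>lborel))"
      unfolding quad(2) X_def by simp
    also have "\<dots> = (\<integral>t. fejer a t * (norm (\<integral>v. \<alpha> v * cis (-t * v) \<partial>lborel))^2 \<partial>lborel)" by simp
    also have "\<dots> \<le> (\<integral>t. l^2 * (fejer a t * norm (P t) ^ 2) \<partial>lborel)"
    proof (rule integral_mono[OF quad(1)])
      show "integrable lborel (\<lambda>t. l^2 * (fejer a t * norm (P t) ^ 2))"
        unfolding P_def using C(2)[OF f \<delta> a] by (intro integrable_mult_right) auto
      fix t :: real
      have s: "norm (Complex (1 + \<delta>) t) > 0" using \<delta> by (auto simp: complex_eq_iff)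
      have "norm (dirichlet f (Complex (1 + \<delta>) t)) * norm (P t) / norm (Complex (1 + \<delta>) t) \<le> l * norm (P t)"
        using mult_right_mono[OF F[of t], of "norm (P t)"] s by (simp add: field_simps)
      hence "(norm (\<integral>v. \<alpha> v * cis (-t * v) \<partial>lborel))^2 \<le> (l * norm (P t))^2"
        unfolding four norm_mult norm_divide by (intro power_mono) auto
      from mult_left_mono[OF this fejer_nonneg[of a t]]
      show "fejer a t * (norm (\<integral>v. \<alpha> v * cis (-t * v) \<partial>lborel))^2 \<le> l^2 * (fejer a t * norm (P t) ^ 2)"
        by (simp add: power_mult_distrib mult_ac)
    qed
    also have "\<dots> = l^2 * (\<integral>t. fejer a t * norm (P t) ^ 2 \<partial>lborel)"
      by (rule integral_mult_right_zero)
    also have "\<dots> \<le> l^2 * (fejer_const * (C * a^2 / \<delta>))"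
      unfolding P_def by (rule mult_left_mono[OF conjunct2[OF C(2)[OF f \<delta> a]]]) simp
    finally have "fejer_const * X \<le> fejer_const * (l^2 * (C * a^2 / \<delta>))" by (simp only: mult_ac)
    hence X: "X \<le> l^2 * (C * a^2 / \<delta>)" using fejer_const_pos mult_le_cancel_left_pos by blast
    show ?thesis
    \<comment> \<open>The lower bound for T may be inserted when the bracket is non-negative;
      otherwise the claim is immediate.\<close>
    proof (cases "A \<le> 200 * a^2 / \<delta>^3 + 8")
      case True
      thus ?thesis using C(1) \<delta> unfolding A_def \<alpha>_def by (simp add: add_increasing)
    next
      case False
      have "a^2 / 4 * (A - (200 * a^2 / \<delta>^3 + 8)) \<le> T / 2 * (A - (200 * a^2 / \<delta>^3 + 8))"
        using T False by (intro mult_right_mono) auto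
      also have "\<dots> \<le> X"
        unfolding T_def A_def X_def \<alpha>_def by (rule fejer_form_log_profile_lower[OF f \<delta> a(1,2)])
      also note X
      also have "l^2 * (C * a^2 / \<delta>) = a^2 / 4 * (4 * C * l^2 / \<delta>)" by simp
      finally have "A - (200 * a^2 / \<delta>^3 + 8) \<le> 4 * C * l^2 / \<delta>"
        using a by (subst (asm) mult_le_cancel_left_pos) auto
      thus ?thesis unfolding A_def \<alpha>_def by simp
    qed
  qed
  moreover have "4 * C \<ge> 0" using C by simp
  ultimately show ?thesis by blast
qed

text \<open>Replacing ln n by v in the weighted sum costs the sum of ln (exp v / n), at most 4 exp
  v, and on [0, L] the damping exp (-v / L) loses at most a factor e. Squaring gives 2 e^2 \<le> 16
  and 2 times 4^2 = 32.\<close>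

lemma weighted_psum_mean_square:
  assumes f: "bounded_cm f" and L: "L \<ge> 1"
  defines "I \<equiv> (LINT v:{0..L}|lborel. (v * normalized_psum f v)^2)"
  shows "set_integrable lborel {0..L} (\<lambda>v. (v * normalized_psum f v)^2)"
    and "I \<le> 16 * (\<integral>v. norm (log_profile f (1 + 1 / L) v) ^ 2 \<partial>lborel) + 32 * L"
proof -
  define \<delta> where "\<delta> = 1 / L"
  have \<delta>: "\<delta> > 0" using L by (simp add: \<delta>_def)
  define \<alpha> where "\<alpha> = log_profile f (1 + \<delta>)"
  have int2: "integrable lborel (\<lambda>v. norm (\<alpha> v) ^ 2)"
    unfolding \<alpha>_def by (rule integrable_norm_log_profile_sq[OF f \<delta>(1)])
  have ptw: "(v * normalized_psum f v)^2 \<le> 16 * norm (\<alpha> v) ^ 2 + 32" if v: "v \<in> {0..L}" for v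
  proof -
    have "norm (of_real v * psum f (exp v) - psum (log_twist f) (exp v)) =
          norm (\<Sum>n\<in>nats_le (exp v). f n * of_real (v - ln (real n)))"
      unfolding psum_altdef log_twist_def sum_distrib_left sum_subtractf [symmetric]
      by (simp add: algebra_simps)
    also have "\<dots> \<le> (\<Sum>n\<in>nats_le (exp v). ln (exp v / n))"
    proof (rule sum_norm_le)
      fix n assume "n \<in> nats_le (exp v)"
      hence n: "1 \<le> n" "real n \<le> exp v" by (auto simp: in_nats_le)
      hence "ln (real n) \<le> ln (exp v)" by (subst ln_le_cancel_iff) auto
      hence "norm (f n) * \<bar>v - ln (real n)\<bar> \<le> 1 * (v - ln (real n))"
        using bounded_cm_norm[OF f] by (intro mult_mono) auto
      thus "norm (f n * of_real (v - ln (real n))) \<le> ln (exp v / n)"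
        using n by (simp add: norm_mult ln_div del: of_real_diff)
    qed
    also have "\<dots> \<le> 4 * exp v" by (rule sum_ln_quotient_le) auto
    finally have "norm (of_real v * psum f (exp v)) \<le> norm (psum (log_twist f) (exp v)) + 4 * exp v"
      by norm
    hence "v * norm (psum f (exp v)) \<le> norm (psum (log_twist f) (exp v)) + 4 * exp v"
      using v by (simp add: norm_mult)
    hence "v * norm (psum f (exp v)) * exp (-v) \<le> (norm (psum (log_twist f) (exp v)) + 4 * exp v) * exp (-v)"
      by (intro mult_right_mono) auto
    also have "\<dots> = norm (\<alpha> v) * exp (\<delta> * v) + 4"
    proof -
      have "exp (-(1 + \<delta>) * v) * exp (\<delta> * v) = exp (-v)" "exp v * exp (-v) = 1"
        by (simp_all add: algebra_simps flip: exp_add)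
      thus ?thesis
        by (simp only: \<alpha>_def log_profile_def norm_mult norm_of_real abs_exp_cancel distrib_right mult.assoc mult_1_right)
    qed
    also have "\<dots> \<le> norm (\<alpha> v) * exp 1 + 4"
      using v \<delta> L by (intro add_mono mult_left_mono) (auto simp: \<delta>_def field_simps)
    finally have "v * normalized_psum f v \<le> norm (\<alpha> v) * exp 1 + 4"
      by (simp add: normalized_psum_def)
    hence "(v * normalized_psum f v)^2 \<le> (norm (\<alpha> v) * exp 1 + 4)^2"
      using v by (intro power_mono) (auto simp: normalized_psum_def)
    also have "\<dots> \<le> 2 * (norm (\<alpha> v) * exp 1)^2 + 32"
      using sum_squares_bound[of "norm (\<alpha> v) * exp 1" 4] by (simp add: power2_eq_square algebra_simps)
    also have "(norm (\<alpha> v) * exp 1)^2 \<le> norm (\<alpha> v) ^ 2 * 8"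
    proof -
      have "(exp 1 :: real)^2 \<le> (2.72)^2" using e_less_272 by (intro power_mono) auto
      also have "\<dots> \<le> 8" by (simp add: power2_eq_square)
      finally show ?thesis unfolding power_mult_distrib by (intro mult_left_mono) auto
    qed
    finally show ?thesis by simp
  qed
  have i1: "set_integrable lborel {0..L} (\<lambda>v. 16 * norm (\<alpha> v) ^ 2 + 32)"
  proof (rule set_integral_add)
    have "set_integrable lborel UNIV (\<lambda>v. 16 * norm (\<alpha> v) ^ 2)"
      using int2 by (simp add: set_integrable_def)
    thus "set_integrable lborel {0..L} (\<lambda>v. 16 * norm (\<alpha> v) ^ 2)"
      by (rule set_integrable_subset) auto
    show "set_integrable lborel {0..L} (\<lambda>v. 32 :: real)" using L by (simp add: set_integrable_def)
  qed
  show i2: "set_integrable lborel {0..L} (\<lambda>v. (v * normalized_psum f v)^2)"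
  proof (rule set_integrable_bound[OF i1])
    show "AE v in lborel. v \<in> {0..L} \<longrightarrow> norm ((v * normalized_psum f v)^2) \<le> norm (16 * norm (\<alpha> v) ^ 2 + 32)"
      using ptw by (intro AE_I2) auto
  qed (auto simp: set_borel_measurable_def)
  have "I \<le> (LINT v:{0..L}|lborel. 16 * norm (\<alpha> v) ^ 2 + 32)"
    unfolding I_def by (rule set_integral_mono[OF i2 i1 ptw])
  also have "\<dots> = (\<integral>v. 16 * (indicator {0..L} v * norm (\<alpha> v) ^ 2) + 32 * indicator {0..L} v \<partial>lborel)"
    unfolding set_lebesgue_integral_def
    by (intro Bochner_Integration.integral_cong) (auto simp: algebra_simps)
  also have "\<dots> \<le> (\<integral>v. 16 * norm (\<alpha> v) ^ 2 + 32 * indicator {0..L} v \<partial>lborel)"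
  proof (rule integral_mono')
    show "integrable lborel (\<lambda>v. 16 * norm (\<alpha> v) ^ 2 + 32 * indicator {0..L} v)"
      using L by (intro Bochner_Integration.integrable_add integrable_mult_right int2) auto
  qed (auto simp: indicator_def intro!: add_nonneg_nonneg)
  also have "\<dots> = 16 * (\<integral>v. norm (\<alpha> v) ^ 2 \<partial>lborel) + 32 * L"
    using int2 L by simp
  finally show "I \<le> 16 * (\<integral>v. norm (log_profile f (1 + 1 / L) v) ^ 2 \<partial>lborel) + 32 * L"
    by (simp add: \<alpha>_def \<delta>_def)
qed

text \<open>For v > \<theta> L the inequality of the means gives \<rho> \<le> \<kappa> (v \<rho>)^2
  + 1 / (4 \<kappa> v^2), a pointwise substitute for Cauchy-Schwarz against 1 / v. With \<kappa> = 1
  / (\<theta> L)^2 the last term integrates to at most \<theta> L / 4, and the range up to \<theta>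
  L adds \<theta> L because \<rho> \<le> 1.\<close>

lemma average_le_weighted_mean_square:
  fixes \<rho> :: "real \<Rightarrow> real"
  assumes L: "L > 0" and \<theta>: "0 < \<theta>" "\<theta> \<le> 1"
    and \<rho>: "\<And>v. 0 \<le> \<rho> v" "\<And>v. \<rho> v \<le> 1" "set_integrable lborel {0..L} \<rho>"
    and sq: "set_integrable lborel {0..L} (\<lambda>v. (v * \<rho> v)^2)"
  shows "(LINT v:{0..L}|lborel. \<rho> v) \<le> 5 / 4 * \<theta> * L + (LINT v:{0..L}|lborel. (v * \<rho> v)^2) / (\<theta> * L)^2"
proof -
  define \<kappa> where "\<kappa> = 1 / (\<theta> * L)^2"
  have \<kappa>: "\<kappa> > 0" using L \<theta> by (simp add: \<kappa>_def)
  have \<theta>L: "0 < \<theta> * L" "\<theta> * L \<le> L" using L \<theta> by auto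
  define g where "g = (\<lambda>v. (1 / (4 * \<kappa>)) * (1 / v^2 * indicator {\<theta> * L..L} v))"
  have DERIV: "((\<lambda>v. - 1 / v) has_real_derivative 1 / v^2) (at v)" if "v > 0" for v :: real
    using that by (auto intro!: derivative_eq_intros simp: power2_eq_square)
  have FTC: "(\<integral>v. 1 / v^2 * indicator {\<theta> * L..L} v \<partial>lborel) = (- 1 / L) - (- 1 / (\<theta> * L))"
    using \<theta>L DERIV by (intro integral_FTC_Icc_real) (auto intro!: continuous_intros)
  have "set_integrable lborel {\<theta> * L..L} (\<lambda>v. 1 / v^2)"
    using \<theta>L by (intro borel_integrable_atLeastAtMost') (auto intro!: continuous_intros)
  hence gint: "integrable lborel g"
    unfolding g_def set_integrable_def by (intro integrable_mult_right) (simp add: mult.commute)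
  have i1: "integrable lborel (\<lambda>v. indicator {0..\<theta> * L} v :: real)" using \<theta>L by simp
  have i2: "integrable lborel (\<lambda>v. \<kappa> * (indicator {0..L} v *\<^sub>R (v * \<rho> v)^2))"
    using sq unfolding set_integrable_def by (intro integrable_mult_right)
  have "(LINT v:{0..L}|lborel. \<rho> v) \<le>
        (\<integral>v. indicator {0..\<theta> * L} v + \<kappa> * (indicator {0..L} v *\<^sub>R (v * \<rho> v)^2) + g v \<partial>lborel)"
    unfolding set_lebesgue_integral_def
  proof (rule integral_mono)
    show "integrable lborel (\<lambda>v. indicator {0..L} v *\<^sub>R \<rho> v)" using \<rho>(3) by (simp add: set_integrable_def)
    show "integrable lborel (\<lambda>v. indicator {0..\<theta> * L} v + \<kappa> * (indicator {0..L} v *\<^sub>R (v * \<rho> v)^2) + g v)"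
      by (intro Bochner_Integration.integrable_add i1 i2 gint)
    fix v :: real
    have g0: "g v \<ge> 0" using \<kappa> by (simp add: g_def)
    show "indicator {0..L} v *\<^sub>R \<rho> v \<le> indicator {0..\<theta> * L} v + \<kappa> * (indicator {0..L} v *\<^sub>R (v * \<rho> v)^2) + g v"
    proof (cases "v \<in> {0..L}")
      case True
      show ?thesis
      proof (cases "v \<le> \<theta> * L")
        case True
        have "\<kappa> * (v * \<rho> v)^2 \<ge> 0" using \<kappa> by simp
        thus ?thesis using True \<open>v \<in> {0..L}\<close> \<rho>(2)[of v] g0 by simp
      next
        case False
        hence v: "v > 0" using \<theta>L by linarith
        define w where "w = v * \<rho> v"
        have "2 * (2 * \<kappa> * w) * (1 / v) \<le> (2 * \<kappa> * w)^2 + (1 / v)^2"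
          using sum_squares_bound[of "2 * \<kappa> * w" "1 / v"] by simp
        hence "4 * \<kappa> * \<rho> v \<le> 4 * \<kappa>^2 * w^2 + 1 / v^2"
          using v by (simp add: w_def power2_eq_square mult_ac)
        hence "4 * \<kappa> * \<rho> v \<le> 4 * \<kappa> * (\<kappa> * w^2 + 1 / (4 * \<kappa>) * (1 / v^2))"
          using \<kappa> by (simp add: power2_eq_square algebra_simps)
        hence "\<rho> v \<le> \<kappa> * w^2 + 1 / (4 * \<kappa>) * (1 / v^2)" using \<kappa> by (subst (asm) mult_le_cancel_left_pos) auto
        thus ?thesis using False True by (simp add: g_def w_def)
      qed
    qed (use \<theta>L g0 in auto)
  qed
  also have "\<dots> = \<theta> * L + \<kappa> * (LINT v:{0..L}|lborel. (v * \<rho> v)^2) + (1 / (4 * \<kappa>)) * ((- 1 / L) - (- 1 / (\<theta> * L)))"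
  proof -
    have "(\<integral>v. g v \<partial>lborel) = (1 / (4 * \<kappa>)) * ((- 1 / L) - (- 1 / (\<theta> * L)))"
      unfolding g_def FTC [symmetric] by (rule integral_mult_right_zero)
    moreover have "(\<integral>v. \<kappa> * (indicator {0..L} v *\<^sub>R (v * \<rho> v)^2) \<partial>lborel) = \<kappa> * (LINT v:{0..L}|lborel. (v * \<rho> v)^2)"
      unfolding set_lebesgue_integral_def by (rule integral_mult_right_zero)
    moreover have "(\<integral>v. indicator {0..\<theta> * L} v \<partial>lborel) = \<theta> * L" using \<theta>L by simp
    ultimately show ?thesis
      using i1 i2 gint
      by (subst Bochner_Integration.integral_add, simp, simp, subst Bochner_Integration.integral_add) simp_all
  qed
  also have "(1 / (4 * \<kappa>)) * ((- 1 / L) - (- 1 / (\<theta> * L))) \<le> (1 / (4 * \<kappa>)) * (1 / (\<theta> * L))"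
    using \<kappa> L by (intro mult_left_mono) auto
  also have "(1 / (4 * \<kappa>)) * (1 / (\<theta> * L)) = \<theta> * L / 4"
    using \<theta>L by (simp add: \<kappa>_def power2_eq_square)
  finally show ?thesis by (simp add: \<kappa>_def mult_ac)
qed

text \<open>If F were below l |s| on the whole line, \<open>log_profile_mean_square\<close> would
  make Q small, hence the integral I, hence S x. The numbers form a budget: Q \<le> 3 W / 3200 with
  W = (\<eta> L)^3, the cut \<theta> = \<eta> / 10 turns this into I \<le> (1 / 8 + 3 / 32) \<eta>
  L, and \<eta> L \<le> (7 / 16 + 1 / 2) \<eta> L is absurd.\<close>

theorem large_psum_imp_large_dirichlet:
  "\<exists>c C. c > 0 \<and> C \<ge> 1 \<and> (\<forall>f \<eta> x. bounded_cm f \<longrightarrow> 0 < \<eta> \<longrightarrow> \<eta> \<le> 1 \<longrightarrow> x \<ge> 1 \<longrightarrow> ln x \<ge> C / \<eta>^3 \<longrightarrow>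
     norm (psum f x) \<ge> \<eta> * x \<longrightarrow>
     (\<exists>t. norm (dirichlet f (Complex (1 + 1 / ln x) t)) \<ge>
          c * sqrt (\<eta>^3) * norm (Complex (1 + 1 / ln x) t) * ln x))"
proof -
  obtain C1 where C1: "C1 \<ge> 0" "\<And>f \<delta> a l. bounded_cm f \<Longrightarrow> 0 < \<delta> \<Longrightarrow> \<delta> \<le> 1 \<Longrightarrow> 0 < a \<Longrightarrow> a \<le> 1/2 \<Longrightarrow> \<delta> \<le> a^2 \<Longrightarrow> l \<ge> 0 \<Longrightarrow>
     (\<And>t. norm (dirichlet f (Complex (1 + \<delta>) t)) \<le> l * norm (Complex (1 + \<delta>) t)) \<Longrightarrow>
     (\<integral>v. norm (log_profile f (1 + \<delta>) v) ^ 2 \<partial>lborel) \<le> C1 * l^2 / \<delta> + (200 * a^2 / \<delta>^3 + 8)"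
    using log_profile_mean_square by blast
  obtain C2 where C2: "C2 \<ge> 0" "\<And>f x. completely_multiplicative f \<Longrightarrow> (\<And>n. n > 0 \<Longrightarrow> norm (f n) \<le> 1) \<Longrightarrow> x \<ge> 1 \<Longrightarrow>
     norm (psum f x) * (ln x)^2 \<le>
       2 * x * ln x * (LINT v:{0..ln x}|lborel. normalized_psum f v) + C2 * x * (1 + ln x)"
    using psum_le_average by blast
  \<comment> \<open>Chosen so that 16 C1 c^2 \<le> 1 / 3200; adding 1 covers C1 = 0.\<close>
  define c where "c = sqrt (1 / (51200 * (C1 + 1)))"
  \<comment> \<open>10240000 = 3200^2 yields \<delta> \<le> a^2 as soon as L \<eta>^3 \<ge> C, and 4
    C2 makes the error 2 C2 of the averaging step at most half of \<eta> L.\<close>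
  define C where "C = 10240000 + 4 * C2"
  have c: "c > 0" "c^2 = 1 / (51200 * (C1 + 1))" using C1(1) by (auto simp: c_def)
  have cC1: "16 * C1 * c^2 \<le> 1 / 3200" unfolding c(2) using C1(1) by (simp add: field_simps)
  have "\<exists>t. norm (dirichlet f (Complex (1 + 1 / ln x) t)) \<ge> c * sqrt (\<eta>^3) * norm (Complex (1 + 1 / ln x) t) * ln x"
    if f: "bounded_cm f" and \<eta>: "0 < \<eta>" "\<eta> \<le> 1" and x: "x \<ge> 1" "ln x \<ge> C / \<eta>^3" "norm (psum f x) \<ge> \<eta> * x" for f \<eta> x
  proof (rule ccontr)
    assume contra: "\<not> ?thesis"
    define L where "L = ln x"
    define \<delta> where "\<delta> = 1 / L"
    \<comment> \<open>With this a the smoothing error 16 times 200 a^2 / \<delta>^3 equals \<eta>^3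
      L^3 / 3200, the same share that the choice of c allows for F.\<close>
    define a where "a = sqrt (\<eta>^3) / 3200"
    define l where "l = c * sqrt (\<eta>^3) * L"
    define A where "A = (\<integral>v. norm (log_profile f (1 + \<delta>) v) ^ 2 \<partial>lborel)"
    define Q where "Q = (LINT v:{0..L}|lborel. (v * normalized_psum f v)^2)"
    define I where "I = (LINT v:{0..L}|lborel. normalized_psum f v)"
    have \<eta>3: "0 < \<eta>^3" "\<eta>^3 \<le> 1" "\<eta>^3 \<le> \<eta>"
      using \<eta> power_le_one[of \<eta> 3] power_decreasing[of 1 3 \<eta>] by auto
    have C\<eta>: "C \<le> L * \<eta>^3" using x(2) \<eta>3 by (simp add: L_def field_simps)
    have "L * \<eta>^3 \<le> L * 1"
    proof (rule mult_left_mono)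
      show "L \<ge> 0" using x by (simp add: L_def)
    qed (use \<eta>3 in auto)
    hence L: "L \<ge> C" using C\<eta> by simp
    have L1: "L \<ge> 10240000" using L C2(1) by (simp add: C_def)
    have L\<eta>: "L * \<eta>^3 \<ge> 10240000" "L * \<eta> \<ge> 4 * C2" 
    proof -
      show "L * \<eta>^3 \<ge> 10240000" using C\<eta> C2(1) by (simp add: C_def)
      have "L * \<eta>^3 \<le> L * \<eta>" using L1 \<eta>3 by (intro mult_left_mono) auto
      thus "L * \<eta> \<ge> 4 * C2" using C\<eta> by (simp add: C_def)
    qed
    have \<delta>: "0 < \<delta>" "\<delta> \<le> 1" using L1 by (auto simp: \<delta>_def)
    have a: "0 < a" "a \<le> 1/2" "\<delta> \<le> a^2"
    proof -
      show "0 < a" using \<eta>3 by (simp add: a_def)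
      have "sqrt (\<eta>^3) \<le> 1" using \<eta>3 by simp
      thus "a \<le> 1/2" unfolding a_def by linarith
      have "a^2 = \<eta>^3 / 10240000" using \<eta>3 by (simp add: a_def power_divide)
      hence "\<eta>^3 = 10240000 * a^2" by simp
      hence "L * \<eta>^3 = 10240000 * (L * a^2)" by simp
      hence "L * a^2 \<ge> 1" using L\<eta>(1) by linarith
      thus "\<delta> \<le> a^2" using L1 by (simp add: \<delta>_def field_simps)
    qed
    have a2: "a^2 = \<eta>^3 / 10240000" using \<eta>3 by (simp add: a_def power_divide)
    have l: "l \<ge> 0" "l^2 = c^2 * \<eta>^3 * L^2" using c L1 \<eta>3 by (auto simp: l_def power_mult_distrib)
    have "A \<le> C1 * l^2 / \<delta> + (200 * a^2 / \<delta>^3 + 8)"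
      unfolding A_def
    proof (rule C1(2)[OF f \<delta> a l(1)])
      fix t
      from contra have "norm (dirichlet f (Complex (1 + \<delta>) t)) < c * sqrt (\<eta>^3) * norm (Complex (1 + \<delta>) t) * L"
        unfolding \<delta>_def L_def by (simp add: not_le)
      thus "norm (dirichlet f (Complex (1 + \<delta>) t)) \<le> l * norm (Complex (1 + \<delta>) t)"
        by (simp add: l_def mult_ac)
    qed
    also have "C1 * l^2 / \<delta> = (C1 * c^2) * (\<eta>^3 * L^3)"
      unfolding l(2) using L1 by (simp add: \<delta>_def power2_eq_square power3_eq_cube)
    also have "200 * a^2 / \<delta>^3 = 1 / 51200 * (\<eta>^3 * L^3)"
      unfolding a2 by (simp add: \<delta>_def power_divide)
    finally have A: "A \<le> (C1 * c^2) * (\<eta>^3 * L^3) + (1 / 51200 * (\<eta>^3 * L^3) + 8)" .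
    define W where "W = \<eta>^3 * L^3"
    have W: "W \<ge> 10240000 * L^2"
    proof -
      have "W = (L * \<eta>^3) * L^2" by (simp add: W_def power2_eq_square power3_eq_cube)
      also have "\<dots> \<ge> 10240000 * L^2" using L\<eta>(1) by (intro mult_right_mono) auto
      finally show ?thesis .
    qed
    have "L^2 \<ge> L * 1" unfolding power2_eq_square using L1 by (intro mult_left_mono) auto
    \<comment> \<open>The remaining terms, 16 times 8 and 32 L, are of lower order in L and fit into
      a third share of W / 3200.\<close>
    hence WL: "128 + 32 * L \<le> W / 3200" using W L1 by simp
    have "Q \<le> 16 * A + 32 * L"
      unfolding Q_def A_def \<delta>_def using L1 by (intro weighted_psum_mean_square(2) f) auto
    also have "\<dots> \<le> 16 * C1 * c^2 * W + W / 3200 + (128 + 32 * L)"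
      using A unfolding W_def [symmetric] by simp
    also have "16 * C1 * c^2 * W \<le> 1 / 3200 * W"
      using cC1 \<eta>3 L1 by (intro mult_right_mono) (auto simp: W_def)
    also note WL
    finally have Q: "Q \<le> 3 / 3200 * W" by simp
    have nb: "\<And>n. n > 0 \<Longrightarrow> norm (f n) \<le> 1" using bounded_cm_norm[OF f] by blast
    have "I \<le> 5 / 4 * (\<eta> / 10) * L + Q / ((\<eta> / 10) * L)^2"
      unfolding I_def Q_def using \<eta> L1 nb
      by (intro average_le_weighted_mean_square normalized_psum_bounds set_integrable_normalized_psum
                weighted_psum_mean_square(1) f) auto
    also have "Q / ((\<eta> / 10) * L)^2 \<le> (3 / 3200 * W) / ((\<eta> / 10) * L)^2"
      using Q by (intro divide_right_mono) auto
    also have "\<dots> = 3 / 32 * (\<eta> * L)"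
      using \<eta> L1 by (simp add: W_def power2_eq_square power3_eq_cube)
    finally have I: "I \<le> 7 / 32 * (\<eta> * L)" by (simp add: mult.commute)
    have "\<eta> * x * L^2 \<le> norm (psum f x) * L^2" using x by (intro mult_right_mono) auto
    also have "\<dots> \<le> 2 * x * L * I + C2 * x * (1 + L)"
      unfolding L_def I_def using f nb x(1) by (intro C2(2)) (auto simp: bounded_cm_def)
    also have "C2 * x * (1 + L) \<le> C2 * x * (2 * L)"
      using C2(1) x L1 by (intro mult_left_mono) auto
    finally have "(x * L) * (\<eta> * L) \<le> (x * L) * (2 * I + 2 * C2)"
      by (simp add: power2_eq_square algebra_simps)
    hence "\<eta> * L \<le> 2 * I + 2 * C2" using x L1 by (subst (asm) mult_le_cancel_left_pos) auto
    also have "\<dots> \<le> 7 / 16 * (\<eta> * L) + 1 / 2 * (\<eta> * L)" using I L\<eta>(2) by (simp add: mult.commute)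
    finally have "\<eta> * L \<le> 0" by (simp add: mult.commute)
    moreover have "\<eta> * L > 0" using \<eta> L1 by simp
    ultimately show False by linarith
  qed
  moreover have "C \<ge> 1" using C2(1) by (simp add: C_def)
  ultimately show ?thesis using c(1) by blast
qed

section \<open>Products of two functions with large partial sums\<close>

text \<open>At 1 + 1 / M the quotient |F / \<zeta>| is at least m / 2, since \<zeta> is at most 2 M
  there; it does not decrease on the way to 1 + 1 / L, where \<zeta> is at least L.\<close>

lemma dirichlet_lower_transfer:
  assumes f: "bounded_cm f" and L: "1 \<le> L" "L \<le> M" and m: "m \<ge> 0"
    and le: "norm (dirichlet f (Complex (1 + 1 / M) t)) \<ge> m * M"
  shows "norm (dirichlet f (Complex (1 + 1 / L) t)) \<ge> m * L / 2"
proof -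
  let ?Z = "\<lambda>\<sigma>. norm (dirichlet one_fn (of_real \<sigma>))"
  have "(m * M) * L \<le> norm (dirichlet f (Complex (1 + 1 / M) t)) * ?Z (1 + 1 / L)"
    using le m L zeta_lower[of "1 / L"] by (intro mult_mono) auto
  also have "\<dots> \<le> norm (dirichlet f (Complex (1 + 1 / L) t)) * ?Z (1 + 1 / M)"
    using L by (intro dirichlet_zeta_ratio_mono f) (auto simp: frac_le)
  also have "\<dots> \<le> norm (dirichlet f (Complex (1 + 1 / L) t)) * (2 * M)"
  proof (rule mult_left_mono)
    have "?Z (1 + 1 / M) \<le> (1 + 1 / M) / (1 / M)" using L by (intro zeta_upper) auto
    also have "\<dots> \<le> 2 * M" using L by (simp add: field_simps)
    finally show "?Z (1 + 1 / M) \<le> 2 * M" .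
  qed auto
  finally have "(2 * M) * (m * L / 2) \<le> (2 * M) * norm (dirichlet f (Complex (1 + 1 / L) t))"
    by (simp add: mult_ac)
  thus ?thesis using L by (subst (asm) mult_le_cancel_left_pos) auto
qed

lemma psum_ge_imp_bounds:
  fixes f :: "nat \<Rightarrow> complex"
  assumes f: "\<And>n. n > 0 \<Longrightarrow> norm (f n) \<le> 1" and "\<eta> > 0" "x > 0" "norm (psum f x) \<ge> \<eta> * x"
  shows "\<eta> \<le> 1" "x \<ge> 1"
proof -
  have "norm (psum f x) \<le> x" using f assms(3) by (intro norm_psum_le') auto
  hence "\<eta> * x \<le> 1 * x" using assms(4) by linarith
  thus "\<eta> \<le> 1" using assms(3) by (subst (asm) mult_le_cancel_right_pos) auto
  show "x \<ge> 1"
  proof (rule ccontr)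
    assume "\<not> x \<ge> 1"
    hence "norm (psum f x) = 0" by (simp add: psum_altdef nats_le_empty)
    thus False using assms(4) mult_pos_pos[OF assms(2,3)] by linarith
  qed
qed

theorem theorem6p2:
  "\<exists>c::real. c > 0 \<and>
     (\<forall>(f1::nat \<Rightarrow> complex) (f2::nat \<Rightarrow> complex) (\<eta>::real) (x1::real) (x2::real).
        completely_multiplicative f1 \<and> completely_multiplicative f2 \<and>
        (\<forall>n>0. norm (f1 n) \<le> 1) \<and> (\<forall>n>0. norm (f2 n) \<le> 1) \<and>
        \<eta> > 0 \<and> x1 > 0 \<and> x2 > 0 \<and>
        norm (psum f1 x1) \<ge> \<eta> * x1 \<and> norm (psum f2 x2) \<ge> \<eta> * x2
        \<longrightarrow> (\<exists>x::real. x \<ge> (min x1 x2) powr (c * \<eta> ^ 6) \<and>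
               norm (psum (\<lambda>n. f1 n * f2 n) x) \<ge> (c * \<eta> ^ 6) * x))"
proof -
  obtain c0 C where c0: "c0 > 0" and C: "C \<ge> 1" and large: "\<And>f \<eta> x. bounded_cm f \<Longrightarrow> 0 < \<eta> \<Longrightarrow> \<eta> \<le> 1 \<Longrightarrow>
     x \<ge> 1 \<Longrightarrow> ln x \<ge> C / \<eta>^3 \<Longrightarrow> norm (psum f x) \<ge> \<eta> * x \<Longrightarrow>
     \<exists>t. norm (dirichlet f (Complex (1 + 1 / ln x) t)) \<ge>
          c0 * sqrt (\<eta>^3) * norm (Complex (1 + 1 / ln x) t) * ln x"
    using large_psum_imp_large_dirichlet by blast
  \<comment> \<open>The first bound lets \<xi> L \<ge> 1 / 2 imply L \<ge> C / \<eta>^3; the second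
    is half of what the final inequality c0^4 \<le> 1024 c would require.\<close>
  define c where "c = min (1 / (2 * C)) (c0^4 / 2048)"
  have c: "c > 0" "c \<le> 1 / (2 * C)" "c \<le> c0^4 / 2048" using c0 C by (auto simp: c_def)
  have "1 / (2 * C) \<le> 1 / 2" using C by (simp add: field_simps)
  hence c2: "c \<le> 1 / 2" using c(2) by linarith
  have "\<exists>x. x \<ge> (min x1 x2) powr (c * \<eta> ^ 6) \<and> norm (psum (\<lambda>n. f1 n * f2 n) x) \<ge> (c * \<eta> ^ 6) * x"
    if cm: "completely_multiplicative f1" "completely_multiplicative f2"
      and b1: "\<forall>n>0. norm (f1 n) \<le> 1" and b2: "\<forall>n>0. norm (f2 n) \<le> 1"
      and pos: "\<eta> > 0" "x1 > 0" "x2 > 0"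
      and big: "norm (psum f1 x1) \<ge> \<eta> * x1" "norm (psum f2 x2) \<ge> \<eta> * x2"
    for f1 f2 :: "nat \<Rightarrow> complex" and \<eta> x1 x2 :: real
  proof (rule ccontr)
    assume contra: "\<not> ?thesis"
    define \<xi> where "\<xi> = c * \<eta> ^ 6"
    define X where "X = min x1 x2"
    define g where "g = (\<lambda>n. f1 n * f2 n)"
    have \<eta>: "0 < \<eta>" "\<eta> \<le> 1" and x: "x1 \<ge> 1" "x2 \<ge> 1"
      using psum_ge_imp_bounds[of f1 \<eta> x1] psum_ge_imp_bounds[of f2 \<eta> x2] b1 b2 pos big by auto
    have "\<eta>^6 \<le> 1" using \<eta> by (intro power_le_one) auto
    hence "\<xi> \<le> c * 1" unfolding \<xi>_def using c by (intro mult_left_mono) auto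
    moreover have "0 < \<xi>" using c(1) \<eta> by (simp add: \<xi>_def)
    ultimately have \<xi>: "0 < \<xi>" "\<xi> \<le> 1 / 2" using c2 by auto
    have X: "X \<ge> 1" "X \<le> x1" "X \<le> x2" using x by (auto simp: X_def)
    have small: "norm (psum g y) < \<xi> * y" if "y \<ge> X powr \<xi>" for y
      using contra that unfolding X_def \<xi>_def g_def by (meson not_le)
    have g1: "psum g y = 1" if "1 \<le> y" "y < 2" for y
    proof -
      have "\<lfloor>y\<rfloor> = 1" using that by linarith
      thus ?thesis using cm by (simp add: psum_def g_def completely_multiplicative_def)
    qed
    \<comment> \<open>Otherwise y = \<open>X powr \<xi>\<close> lies in [1, 2), where the partial
      sum is 1 and hence not below \<xi> y, contrary to \<open>small\<close>. This disposes of small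
      x1 or x2, since it bounds \<xi> L below.\<close>
    have "X powr \<xi> \<ge> 2"
    proof (rule ccontr)
      assume "\<not> X powr \<xi> \<ge> 2"
      moreover have "X powr \<xi> \<ge> 1" using X \<xi> by (intro ge_one_powr_ge_zero) auto
      moreover have "\<xi> * X powr \<xi> \<le> 1 / 2 * 2" using \<xi> calculation by (intro mult_mono) auto
      ultimately show False using small[of "X powr \<xi>"] g1[of "X powr \<xi>"] by simp
    qed
    hence "ln 2 \<le> ln (X powr \<xi>)" by (subst ln_le_cancel_iff) auto
    hence "ln 2 \<le> \<xi> * ln X" using X by (simp add: ln_powr)
    hence \<xi>L: "1 / 2 \<le> \<xi> * ln X" using ln2_ge_two_thirds by linarith
    define L where "L = ln X"
    have L: "L \<ge> C / \<eta>^3"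
    proof -
      have "\<eta>^6 \<le> \<eta>^3" using \<eta> by (intro power_decreasing) auto
      hence "\<xi> \<le> 1 / (2 * C) * \<eta>^3" unfolding \<xi>_def using c \<eta> C by (intro mult_mono) auto
      moreover have "L \<ge> 0" using X by (simp add: L_def)
      ultimately have le: "\<xi> * L \<le> 1 / (2 * C) * \<eta>^3 * L" by (intro mult_right_mono) auto
      have "1 / 2 \<le> \<xi> * L" using \<xi>L by (simp add: L_def)
      also note le
      also have "1 / (2 * C) * \<eta>^3 * L = (\<eta>^3 * L / C) / 2" by simp
      finally have "1 \<le> \<eta>^3 * L / C" by simp
      thus ?thesis using C \<eta> by (simp add: field_simps)
    qed
    have "\<eta>^3 \<le> 1" using \<eta> by (intro power_le_one) auto
    hence "C / \<eta>^3 \<ge> 1" using C \<eta> by (simp add: field_simps)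
    hence L1: "L \<ge> 1" using L by linarith
    have Lx: "L \<le> ln x1" "L \<le> ln x2" unfolding L_def using X x by (auto intro!: ln_mono)
    \<comment> \<open>The values of f1 and f2 at 0 are arbitrary; \<open>bounded_cm\<close> wants 0
      there, and partial sums do not notice the change.\<close>
    define F1 where "F1 = (\<lambda>n. if n = 0 then 0 else f1 n)"
    define F2 where "F2 = (\<lambda>n. if n = 0 then 0 else f2 n)"
    have F: "bounded_cm F1" "bounded_cm F2"
      using cm b1 b2 by (auto simp: bounded_cm_def completely_multiplicative_def F1_def F2_def)
    have psums: "psum F1 y = psum f1 y" "psum F2 y = psum f2 y" "psum (\<lambda>n. F1 n * F2 n) y = psum g y" for y
      unfolding psum_def F1_def F2_def g_def by (auto intro!: sum.cong)
    define l where "l = c0 * sqrt (\<eta>^3)"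
    have l0: "l \<ge> 0" using c0 \<eta> by (simp add: l_def)
    obtain t1 where t1: "norm (dirichlet F1 (Complex (1 + 1 / ln x1) t1)) \<ge>
        l * norm (Complex (1 + 1 / ln x1) t1) * ln x1"
      using large[OF F(1) \<eta> x(1)] L Lx big psums unfolding l_def by auto
    obtain t2 where t2: "norm (dirichlet F2 (Complex (1 + 1 / ln x2) t2)) \<ge>
        l * norm (Complex (1 + 1 / ln x2) t2) * ln x2"
      using large[OF F(2) \<eta> x(2)] L Lx big psums unfolding l_def by auto
    define m1 where "m1 = norm (Complex (1 + 1 / ln x1) t1)"
    define m2 where "m2 = norm (Complex (1 + 1 / ln x2) t2)"
    have m: "m1 \<ge> 1" "m2 \<ge> 1" "\<bar>t1\<bar> \<le> m1" "\<bar>t2\<bar> \<le> m2"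
      using complex_Re_le_cmod[of "Complex (1 + 1 / ln x1) t1"] complex_Re_le_cmod[of "Complex (1 + 1 / ln x2) t2"]
        abs_Im_le_cmod[of "Complex (1 + 1 / ln x1) t1"] abs_Im_le_cmod[of "Complex (1 + 1 / ln x2) t2"]
        x zero_le_divide_1_iff[of "ln x1"] zero_le_divide_1_iff[of "ln x2"] ln_ge_zero[OF x(1)] ln_ge_zero[OF x(2)]
      unfolding m1_def m2_def complex.sel by linarith+
    define \<delta> where "\<delta> = 1 / L"
    have \<delta>: "0 < \<delta>" "\<delta> \<le> 1" using L1 by (auto simp: \<delta>_def)
    define s where "s = Complex (1 + \<delta>) (t1 + t2)"
    define Z where "Z = norm (dirichlet one_fn (of_real (1 + \<delta>)))"
    define G where "G = norm (dirichlet (\<lambda>n. F1 n * F2 n) s)"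
    \<comment> \<open>The large values were found on the lines belonging to x1 and x2; both move to
      the line of the minimum X. The numbers m1 and m2 remain the moduli on the original
      lines.\<close>
    have D1: "norm (dirichlet F1 (Complex (1 + \<delta>) t1)) \<ge> l * m1 * L / 2"
      unfolding \<delta>_def using t1 L1 Lx l0 m by (intro dirichlet_lower_transfer F) (auto simp: m1_def)
    have D2: "norm (dirichlet F2 (Complex (1 + \<delta>) t2)) \<ge> l * m2 * L / 2"
      unfolding \<delta>_def using t2 L1 Lx l0 m by (intro dirichlet_lower_transfer F) (auto simp: m2_def)
    have Z: "0 \<le> Z" "Z \<le> 2 * L"
    proof -
      have "Z \<le> (1 + \<delta>) / \<delta>" unfolding Z_def by (rule zeta_upper[OF \<delta>(1)])
      also have "\<dots> \<le> 2 * L" using L1 by (simp add: \<delta>_def field_simps)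
      finally show "Z \<le> 2 * L" .
    qed (simp add: Z_def)
    \<comment> \<open>Beyond exp (\<xi> L) = \<open>X powr \<xi>\<close> the partial sums are small
      by assumption; the initial range costs \<xi> L, exactly as much as the tail \<xi> /
      \<delta>.\<close>
    have G: "G \<le> norm s * (\<xi> * L + \<xi> / \<delta>)"
      unfolding G_def
    proof (rule norm_dirichlet_le)
      fix y :: real assume "y \<ge> exp (\<xi> * L)"
      moreover have "exp (\<xi> * L) = X powr \<xi>" using X by (simp add: powr_def L_def)
      ultimately show "norm (psum (\<lambda>n. F1 n * F2 n) y) \<le> \<xi> * y" using small[of y] by (simp add: psums)
    qed (use F \<delta> \<xi> L1 in \<open>auto simp: s_def intro!: bounded_cm_times\<close>)
    \<comment> \<open>The lower bounds for F1 and F2 supply the factor m1^2 m2^2 on the other side,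
      so m1 and m2 cancel however large the ordinates are.\<close>
    have ns: "norm s \<le> 4 * (m1^2 * m2^2)"
    proof -
      have "norm s \<le> \<bar>Re s\<bar> + \<bar>Im s\<bar>" by (rule cmod_le)
      also have "\<dots> \<le> 2 + m1 + m2" using \<delta> m by (auto simp: s_def)
      also have "2 + m1 + m2 \<le> 4 * (m1^2 * m2^2)"
      proof -
        have sq: "m1 \<le> m1^2" "m2 \<le> m2^2" "1 \<le> m1^2" "1 \<le> m2^2"
          using m by (auto intro: self_le_power one_le_power)
        have "m1 * 1 \<le> m1^2 * m2^2" "1 * m2 \<le> m1^2 * m2^2" "1 * 1 \<le> m1^2 * m2^2"
          using m sq by (intro mult_mono; linarith)+
        thus ?thesis by linarith
      qed
      finally show ?thesis .
    qed
    have "(l * m1 * L / 2)^2 * (l * m2 * L / 2)^2 \<le>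
          norm (dirichlet F1 (Complex (1 + \<delta>) t1))^2 * norm (dirichlet F2 (Complex (1 + \<delta>) t2))^2"
      using D1 D2 l0 m L1 by (intro mult_mono power_mono) auto
    also have "\<dots> \<le> Z^3 * G"
      unfolding Z_def G_def s_def using \<delta> by (intro dirichlet_triangle F) auto
    also have "\<dots> \<le> (2 * L)^3 * (4 * (m1^2 * m2^2) * (\<xi> * L + \<xi> * L))"
    proof (intro mult_mono power_mono)
      have "norm s * (\<xi> * L + \<xi> / \<delta>) \<le> 4 * (m1^2 * m2^2) * (\<xi> * L + \<xi> * L)"
        using ns \<xi> L1 by (simp add: \<delta>_def mult_right_mono)
      thus "G \<le> 4 * (m1^2 * m2^2) * (\<xi> * L + \<xi> * L)" using G by linarith
    qed (use Z L1 in \<open>auto simp: G_def\<close>)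
    also have "\<dots> = 64 * \<xi> * (m1^2 * m2^2 * L^4)"
      by (simp add: power_mult_distrib power3_eq_cube power4_eq_xxxx)
    finally have le: "(l * m1 * L / 2)^2 * (l * m2 * L / 2)^2 \<le> 64 * \<xi> * (m1^2 * m2^2 * L^4)" .
    have "(m1^2 * m2^2 * L^4) * l^4 = 16 * ((l * m1 * L / 2)^2 * (l * m2 * L / 2)^2)"
      unfolding power_mult_distrib power_divide by (simp add: power4_eq_xxxx power2_eq_square)
    also have "\<dots> \<le> 16 * (64 * \<xi> * (m1^2 * m2^2 * L^4))" using le by (rule mult_left_mono) simp
    also have "\<dots> = (m1^2 * m2^2 * L^4) * (1024 * \<xi>)" by simp
    finally have "(m1^2 * m2^2 * L^4) * l^4 \<le> (m1^2 * m2^2 * L^4) * (1024 * \<xi>)" .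
    hence "l^4 \<le> 1024 * \<xi>" using m L1 by (subst (asm) mult_le_cancel_left_pos) auto
    moreover have "l^4 = c0^4 * \<eta>^6"
    proof -
      have "sqrt (\<eta>^3)^4 = (sqrt (\<eta>^3)^2)^2" by (simp flip: power_mult)
      also have "\<dots> = \<eta>^6" using \<eta> by (simp flip: power_mult)
      finally show ?thesis by (simp add: l_def power_mult_distrib)
    qed
    ultimately have "c0^4 * \<eta>^6 \<le> (1024 * c) * \<eta>^6" by (simp add: \<xi>_def)
    hence "c0^4 \<le> 1024 * c" using \<eta> by (subst (asm) mult_le_cancel_right_pos) auto
    moreover have "c0^4 > 0" using c0 by simp
    ultimately show False using c(3) by linarith
  qed
  note * = this
  show ?thesis
    by (rule exI[of _ c], intro conjI c(1) allI impI, elim conjE) (rule *, assumption+)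
qed

end
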